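(* Let $\beta > 0$. The $\operatorname{Sine}_{\beta}$ point process $X$ on $\mathbb{R}$, defined as the weak limit, when $n$ goes to infinity, of the point process of the eigenangles of the $n$-dimensional Circular Beta Ensemble multiplied by $n/(2\pi)$, is rigid: for every bounded Borel subset $B$ of $\mathbb{R}$, the number of points $X(B)$ of $X$ in $B$ is almost surely equal to a random variable which is measurable with respect to the $\sigma$-algebra $\Sigma_{\mathbb{R} \setminus B}$.
   Context: A point process on a complete separable metric space is a random purely atomic Radon measure $X$ (with integer masses), viewed as a random locally finite collection of points, with possible repetitions; $X(B)$ denotes the number of points in the Borel set $B$. For a Borel set $B$, $\Sigma_B$ denotes the $\sigma$-algebra generated by all the variables $X(A)$ for Borel sets $A \subset B$. For $\beta > 0$ and $n \geq 1$, the Circular Beta Ensemble ($C\beta E$) of dimension $n$ is the random set of $n$ points $\{z_1, \dots, z_n\}$ on the unit circle $\mathbb{U} = \{z \in \mathbb{C} : |z| = 1\}$ whose joint density with respect to the $n$-fold product of the uniform probability measure on $\mathbb{U}$ is proportional to $\prod_{1 \leq j < k \leq n} |z_j - z_k|^{\beta}$. Let $E_n$ be the ($n$-periodic) set of all determinations of the arguments of the points of the $C\beta E$ of dimension $n$, multiplied by $n/(2\pi)$, i.e. $E_n = \{x \in \mathbb{R} : e^{2 i \pi x/n} \in \{z_1,\dots,z_n\}\}$. It is known (Killip and Stoiciu) that as $n \to \infty$ the point process $E_n$ converges in law (weakly, for the vague topology on locally finite measures on $\mathbb{R}$; in particular $\sum_{x \in E_n} \varphi(x)$ converges in law to $\sum_{x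 \in X} \varphi(x)$ for every continuous compactly supported $\varphi$) to a point process on $\mathbb{R}$; this limit is by definition the $\operatorname{Sine}_\beta$ process. (Taking only the arguments in $(-\pi,\pi]$ instead of all determinations gives the same limit.) *)

theory Defs
  imports "HOL-Probability.Probability"
begin

section \<open>Point processes\<close>

text \<open>On a complete separable metric space every locally finite Borel measure is inner regular,
  hence Radon.\<close>

definition radon_measures :: "'a::polish_space measure set" where
  "radon_measures = {\<mu>. sets \<mu> = sets borel \<and>
     (\<forall>x. \<exists>U. open U \<and> x \<in> U \<and> emeasure \<mu> U < \<infinity>)}"

text \<open>The purely atomic Radon measures with integer masses: \<open>m x\<close> is the multiplicity of the
  point \<open>x\<close>, and the integral over the counting measure is the sum of the multiplicities.\<close>

definition point_configurations :: "'a::polish_space measure set" where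
  "point_configurations = {\<mu> \<in> radon_measures. \<exists>m :: 'a \<Rightarrow> nat.
     \<forall>A\<in>sets borel. emeasure \<mu> A = (\<integral>\<^sup>+ x. of_nat (m x) \<partial>count_space A)}"

definition point_process :: "'w measure \<Rightarrow> ('w \<Rightarrow> 'a::polish_space measure) \<Rightarrow> bool" where
  "point_process M X \<longleftrightarrow> prob_space M \<and>
     (\<forall>w\<in>space M. X w \<in> point_configurations) \<and>
     (\<forall>A\<in>sets borel. (\<lambda>w. emeasure (X w) A) \<in> borel_measurable M)"

definition point_sigma ::
  "'w measure \<Rightarrow> ('w \<Rightarrow> 'a::polish_space measure) \<Rightarrow> 'a set \<Rightarrow> 'w measure" where
  "point_sigma M X B = sigma (space M)
     {(\<lambda>w. emeasure (X w) A) -` U \<inter> space M | A U.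
        A \<in> sets borel \<and> A \<subseteq> B \<and> U \<in> sets (borel :: ennreal measure)}"

section \<open>Weak convergence for the vague topology\<close>

definition test_functions :: "(real \<Rightarrow> real) set" where
  "test_functions = {\<phi>. continuous_on UNIV \<phi> \<and> (\<exists>K. compact K \<and> (\<forall>x. x \<notin> K \<longrightarrow> \<phi> x = 0))}"

definition vague_topology :: "real measure topology" where
  "vague_topology = topology_generated_by
     {{\<mu> \<in> radon_measures. (\<integral>x. \<phi> x \<partial>\<mu>) \<in> U} | \<phi> U. \<phi> \<in> test_functions \<and> open U}"

definition converges_in_law_vaguely ::
  "(nat \<Rightarrow> 'v measure) \<Rightarrow> (nat \<Rightarrow> 'v \<Rightarrow> real measure) \<Rightarrow>
   'w measure \<Rightarrow> ('w \<Rightarrow> real measure) \<Rightarrow> bool" where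
  "converges_in_law_vaguely N Y M X \<longleftrightarrow>
     (\<forall>F :: real measure \<Rightarrow> real.
        continuous_map vague_topology euclideanreal F \<and> bounded (F ` radon_measures) \<longrightarrow>
        (\<lambda>n. \<integral>v. F (Y n v) \<partial>N n) \<longlonglongrightarrow> (\<integral>w. F (X w) \<partial>M))"

section \<open>The circular beta ensemble and the sine-beta process\<close>

definition circle_uniform :: "complex measure" where
  "circle_uniform = distr (uniform_measure lborel {0..<2 * pi}) borel cis"

definition vandermonde_weight :: "real \<Rightarrow> nat \<Rightarrow> (nat \<Rightarrow> complex) \<Rightarrow> real" where
  "vandermonde_weight \<beta> n z = (\<Prod>k<n. \<Prod>j<k. cmod (z j - z k) powr \<beta>)"

definition circular_beta_ensemble :: "real \<Rightarrow> nat \<Rightarrow> (nat \<Rightarrow> complex) measure" where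
  "circular_beta_ensemble \<beta> n =
     (let P = (\<Pi>\<^sub>M j\<in>{..<n}. circle_uniform);
          Z = (\<integral>\<^sup>+ z. ennreal (vandermonde_weight \<beta> n z) \<partial>P)
      in density P (\<lambda>z. ennreal (vandermonde_weight \<beta> n z) / Z))"

definition scaled_eigenangles :: "nat \<Rightarrow> (nat \<Rightarrow> complex) \<Rightarrow> real set" where
  "scaled_eigenangles n z = {x. cis (2 * pi * x / real n) \<in> z ` {..<n}}"

definition counting_measure :: "real set \<Rightarrow> real measure" where
  "counting_measure E = distr (count_space E) borel (\<lambda>x. x)"

definition sine_beta_process :: "real \<Rightarrow> 'w measure \<Rightarrow> ('w \<Rightarrow> real measure) \<Rightarrow> bool" where
  "sine_beta_process \<beta> M X \<longleftrightarrow> point_process M X \<and>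
     converges_in_law_vaguely (circular_beta_ensemble \<beta>)
       (\<lambda>n z. counting_measure (scaled_eigenangles n z)) M X"

end

theory Submission
  imports Defs
begin

text \<open>
  It suffices to find, for every bounded interval and every \<open>\<eta> > 0\<close>, a nonnegative continuous function \<open>\<phi>\<close>
  with compact support that is \<open>\<eta>\<close>-close to 1 on the interval and whose sum over the points of the process is
  \<open>\<eta>\<close>-close in probability to a constant: then \<open>X(B)\<close> is a limit of constants minus sums over the points outside \<open>B\<close>.

  For the circular ensemble, \<open>E \<bar>\<Sum>\<^sub>j z\<^sub>j\<^sup>k\<bar>\<^sup>2 \<le> 4 k / \<beta>\<close> whenever \<open>2 k \<le> n\<close>. Indeed the generator of circular
  Dyson Brownian motion is symmetric in \<open>L\<^sup>2\<close> of the ensemble and acts on symmetric polynomials that are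
  homogeneous of degree \<open>k\<close> as a triangular matrix on the symmetrized monomials, so its eigenvalues are
  the diagonal entries, which are all at least \<open>(\<beta>/2) k (n - k)\<close>; on the other hand the Dirichlet form of
  the \<open>k\<close>-th power trace is \<open>k\<^sup>2 n\<close>. The squared \<open>H\<^sup>1\<^sup>/\<^sup>2\<close>-norm of an average of \<open>N\<close> Fejer
  kernels at dyadic scales is \<open>O(1/N)\<close>, so such averages concentrate, and in the scaling limit they become averages of
  squared sinc functions. The error made by cutting these off to compact support is controlled in \<open>L\<^sup>1\<close>,
  since the one-point intensity is uniform.
\<close>

section \<open>Triangular self-adjoint operators\<close>

text \<open>The squared \<open>H^{1/2}\<close> norm is invariant under dilation, so widening a
  single smooth statistic does not make its variance bound small. Kernels at different dyadic scales
  are almost orthogonal for this norm, with inner products decaying geometrically in the difference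
  of the exponents, so averaging N of them gains a factor 1/N. Triangularity rests on divisibility:
  the difference of the derivatives of a symmetric polynomial in two of its variables vanishes where
  these variables agree, so the singular pair interaction maps polynomials to polynomials. The
  condition 2 k \<le> n keeps n - k comparable with n, so that the n of the Dirichlet form cancels.
  This is why the widest frequency band in use is n/2. Dimensions are restricted to multiples of
  \<open>2 ^ L\<close>, a subsequence being enough to identify the limit; the constant around which
  the statistic concentrates is then explicit, namely its zero Fourier mode.\<close>

locale psd_form =
  fixes B :: "('i \<Rightarrow> real) \<Rightarrow> ('i \<Rightarrow> real) \<Rightarrow> real"
  assumes add_scale: "B (\<lambda>a. x a + c * y a) z = B x z + c * B y z"
    and commute: "B x y = B y x"
    and nonneg: "0 \<le> B x x"
begin

lemma add_scale_right: "B z (\<lambda>a. x a + c * y a) = B z x + c * B z y"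
  using add_scale commute by metis

text \<open>Cauchy-Schwarz in the degenerate case: along the line x + c u the quadratic form is
  affine in c, so a nonzero slope would make it negative somewhere. The chosen c gives the value
  -1.\<close>

lemma null_orthogonal:
  assumes "B u u = 0"
  shows "B x u = 0"
proof (rule ccontr)
  assume ne: "B x u \<noteq> 0"
  define c where "c = - (B x x + 1) / (2 * B x u)"
  have "B (\<lambda>a. x a + c * u a) (\<lambda>a. x a + c * u a) = B x x + 2 * c * B x u + c\<^sup>2 * B u u"
    by (simp add: add_scale add_scale_right commute[of u x] power2_eq_square algebra_simps)
  also have "\<dots> = - 1"
    using ne assms by (simp add: c_def field_simps)
  finally show False
    using nonneg by (metis not_one_le_zero neg_0_le_iff_le)
qed

definition supported :: "'i set \<Rightarrow> ('i \<Rightarrow> real) set" where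
  "supported J = {x. \<forall>a. a \<notin> J \<longrightarrow> x a = 0}"

lemma supported_insertE:
  assumes "x \<in> supported (insert m J)" "m \<notin> J" "u m = 1" "u \<in> supported (insert m J)"
  obtains v where "v \<in> supported J" "x = (\<lambda>a. v a + x m * u a)"
proof
  have "x a = x m * u a" if "a \<notin> J" for a
    using assms that by (cases "a = m") (auto simp: supported_def)
  then show "(\<lambda>a. x a - x m * u a) \<in> supported J"
    by (simp add: supported_def)
qed auto

text \<open>Gram-Schmidt, one index at a time. Degeneracy of the form costs the uniqueness of the
  projection but not its existence, as a direction of norm zero is orthogonal to everything.\<close>

lemma orthogonal_projection:
  assumes "finite J"
  shows "\<exists>p\<in>supported J. \<forall>v\<in>supported J. B (\<lambda>a. x a - p a) v = 0"
  using assms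
proof (induction J arbitrary: x rule: finite_induct)
  case empty
  have "B y (\<lambda>a. 0) = 0" for y
    using add_scale_right[of y "\<lambda>a. 0" "-1" "\<lambda>a. 0"] by simp
  moreover have "v = (\<lambda>a. 0)" if "v \<in> supported {}" for v
    using that by (auto simp: supported_def)
  ultimately have "\<forall>v\<in>supported {}. B (\<lambda>a. x a - 0) v = 0"
    by metis
  moreover have "(\<lambda>a. 0) \<in> supported {}"
    by (simp add: supported_def)
  ultimately show ?case
    by (rule bexI)
next
  case (insert m J)
  define e :: "'i \<Rightarrow> real" where "e = (\<lambda>a. if a = m then 1 else 0)"
  obtain p where p: "p \<in> supported J" "\<forall>v\<in>supported J. B (\<lambda>a. x a - p a) v = 0"
    using insert.IH[of x] by (rule bexE)
  obtain q where q: "q \<in> supported J" "\<forall>v\<in>supported J. B (\<lambda>a. e a - q a) v = 0"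
    using insert.IH[of e] by (rule bexE)
  define u where "u = (\<lambda>a. e a - q a)"
  have u: "u m = 1" "u \<in> supported (insert m J)"
    using q(1) insert.hyps by (auto simp: u_def e_def supported_def)
  \<comment> \<open>If \<open>B u u\<close> is 0 the quotient is 0 by convention, and the next
    equation still holds because \<open>null_orthogonal\<close> makes the numerator vanish.\<close>
  define t where "t = B (\<lambda>a. x a - p a) u / B u u"
  have t: "t * B u u = B (\<lambda>a. x a - p a) u"
    using null_orthogonal[of u] by (auto simp: t_def)
  show ?case
  proof (intro bexI[of _ "\<lambda>a. p a + t * u a"] ballI)
    show "(\<lambda>a. p a + t * u a) \<in> supported (insert m J)"
      using p(1) u(2) by (auto simp: supported_def)
  next
    fix v assume "v \<in> supported (insert m J)"
    then obtain v' where v': "v' \<in> supported J" "v = (\<lambda>a. v' a + v m * u a)"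
      by (rule supported_insertE[OF _ insert.hyps(2) u])
    have uv: "B u v' = 0"
      using bspec[OF q(2) v'(1)] by (simp add: u_def)
    have eq: "(\<lambda>a. x a - (p a + t * u a)) = (\<lambda>a. (x a - p a) + (- t) * u a)"
      by (auto simp: fun_eq_iff)
    have "B (\<lambda>a. x a - (p a + t * u a)) w = B (\<lambda>a. x a - p a) w - t * B u w" for w
      unfolding eq add_scale by simp
    moreover define c where "c = v m"
    then have "v = (\<lambda>a. v' a + c * u a)"
      using v'(2) by simp
    ultimately show "B (\<lambda>a. x a - (p a + t * u a)) v = 0"
      by (simp add: add_scale_right bspec[OF p(2) v'(1)] uv t[symmetric])
  qed
qed

text \<open>The form may be degenerate and the indexing family linearly dependent: this is used for
  the symmetrized monomials, which are indexed by all exponent vectors rather than by partitions.\<close>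

lemma selfadjoint_triangular_bound:
  fixes T :: "('i \<Rightarrow> real) \<Rightarrow> ('i \<Rightarrow> real)" and s :: "'i \<Rightarrow> nat"
  assumes T_lin: "\<And>x y c. T (\<lambda>a. x a + c * y a) = (\<lambda>a. T x a + c * T y a)"
    and T_adj: "\<And>x y. B (T x) y = B x (T y)"
    and "finite J"
    and diag: "\<And>a. a \<in> J \<Longrightarrow> l \<le> T (\<lambda>b. if b = a then 1 else 0) a"
    and tri: "\<And>a c. \<lbrakk>a \<in> J; T (\<lambda>b. if b = a then 1 else 0) c \<noteq> 0\<rbrakk> \<Longrightarrow> c = a \<or> c \<in> J \<and> s c < s a"
    and "x \<in> supported J"
  shows "T x \<in> supported J \<and> l * B x x \<le> B (T x) x"
  using assms(3-)
proof (induction J arbitrary: x rule: finite_ranking_induct[where f = s])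
  case empty
  have x: "x = (\<lambda>a. 0)"
    using empty.prems by (auto simp: supported_def)
  have "B y (\<lambda>a. 0) = 0" for y
    using add_scale_right[of y "\<lambda>a. 0" "-1" "\<lambda>a. 0"] by simp
  moreover have "T (\<lambda>a. 0) = (\<lambda>a. 0)"
    using T_lin[of "\<lambda>a. 0" "-1" "\<lambda>a. 0"] by simp
  ultimately show ?case
    using x by (simp add: supported_def)
next
  case (insert m J)
  show ?case
  proof (cases "m \<in> J")
    case True
    then show ?thesis
      using insert by (simp add: insert_absorb)
  next
    case m: False
    define e :: "'i \<Rightarrow> real" where "e = (\<lambda>a. if a = m then 1 else 0)"
    have IH: "T v \<in> supported J \<and> l * B v v \<le> B (T v) v" if "v \<in> supported J" for v
    proof (rule insert.IH)
      show "l \<le> T (\<lambda>b. if b = a then 1 else 0) a" if "a \<in> J" for a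
        using that insert.prems(1) by auto
      \<comment> \<open>Here c = m is excluded: m was adjoined with \<open>s m\<close> at least
        \<open>s a\<close>, while an index reached from a has smaller rank. So \<open>T\<close>
        preserves the span of J.\<close>
      show "c = a \<or> c \<in> J \<and> s c < s a" if "a \<in> J" "T (\<lambda>b. if b = a then 1 else 0) c \<noteq> 0" for a c
        using that insert.prems(2)[of a c] insert.hyps(2)[of a] by auto
    qed fact
    obtain q where q: "q \<in> supported J" "\<forall>v\<in>supported J. B (\<lambda>a. e a - q a) v = 0"
      using orthogonal_projection[OF insert.hyps(1), of e] by (rule bexE)
    define u where "u = (\<lambda>a. e a - q a)"
    have u: "u m = 1" "u \<in> supported (insert m J)"
      using q(1) m by (auto simp: u_def e_def supported_def)
    have ort: "B u v = 0" "B v u = 0" if "v \<in> supported J" for v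
      using bspec[OF q(2) that] commute[of u v] by (simp_all add: u_def)
    define d where "d = T e m"
    have d: "l \<le> d"
      using insert.prems(1)[of m] by (simp add: d_def e_def)
    \<comment> \<open>The vector u is orthogonal to the span of J, and triangularity gives
      \<open>T u\<close> as d times u plus an element r of that span. So r drops out of
      \<open>B (T u) u\<close> and the diagonal entry d acts as an eigenvalue.\<close>
    define r where "r = (\<lambda>a. T u a - d * u a)"
    have Tu: "T u = (\<lambda>a. T e a - T q a)"
      using T_lin[of e "-1" q] by (simp add: u_def)
    have Te: "T e a = 0" if "a \<notin> insert m J" for a
      using that insert.prems(2)[of m a] by (auto simp: e_def)
    have Tq: "T q \<in> supported J"
      using IH q(1) by blast
    have "r a = 0" if "a \<notin> J" for a
      using that Te[of a] Tq q(1) u m by (cases "a = m") (auto simp: r_def Tu d_def supported_def)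
    then have r: "r \<in> supported J"
      by (simp add: supported_def)
    have "B (T u) u = B (\<lambda>a. r a + d * u a) u"
      by (simp add: r_def)
    also have "\<dots> = d * B u u"
      by (simp add: add_scale ort[OF r])
    finally have Tuu: "B (T u) u = d * B u u" .
    obtain v where v: "v \<in> supported J" "x = (\<lambda>a. v a + x m * u a)"
      by (rule supported_insertE[OF insert.prems(3) m u]) blast
    define c where "c = x m"
    have xv: "x = (\<lambda>a. v a + c * u a)" using v(2) by (simp add: c_def)
    have Tx: "T x = (\<lambda>a. T v a + c * T u a)"
      unfolding xv T_lin ..
    have Tv: "T v \<in> supported J" "l * B v v \<le> B (T v) v"
      using IH[OF v(1)] by auto
    \<comment> \<open>Self-adjointness moves \<open>T\<close> onto v, and \<open>T v\<close> stays
      in the span of J. Hence the form splits without a cross term.\<close>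
    have "B (T u) v = 0"
      using T_adj[of u v] ort[OF Tv(1)] by simp
    then have "B (T x) x = B (T v) v + c\<^sup>2 * (d * B u u)"
      unfolding Tx unfolding xv using ort(2)[OF Tv(1)]
      by (simp add: add_scale add_scale_right Tuu power2_eq_square algebra_simps)
    moreover have "B x x = B v v + c\<^sup>2 * B u u"
      unfolding xv using ort[OF v(1)]
      by (simp add: add_scale add_scale_right power2_eq_square algebra_simps)
    moreover have "l * (c\<^sup>2 * B u u) \<le> c\<^sup>2 * (d * B u u)"
      using mult_right_mono[OF d, of "c\<^sup>2 * B u u"] nonneg[of u] by (simp add: algebra_simps)
    ultimately have "l * B x x \<le> B (T x) x"
      using Tv(2) by (simp add: algebra_simps)
    moreover have "T u \<in> supported (insert m J)"
      using Te Tq by (auto simp: Tu supported_def)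
    then have "T x \<in> supported (insert m J)"
      using Tv(1) by (auto simp: Tx supported_def)
    ultimately show ?thesis by blast
  qed
qed

end

section \<open>Symmetrized monomials\<close>

type_synonym config = "nat \<Rightarrow> complex"

definition monomial :: "nat \<Rightarrow> (nat \<Rightarrow> nat) \<Rightarrow> config \<Rightarrow> complex" where
  "monomial n b z = (\<Prod>i<n. z i ^ b i)"

text \<open>Permutations giving the same monomial are counted separately, so this is the monomial
  symmetric polynomial times the order of the stabilizer of the exponent vector. Reindexing by a
  permutation then never has to deal with stabilizers.\<close>

definition msym :: "nat \<Rightarrow> (nat \<Rightarrow> nat) \<Rightarrow> config \<Rightarrow> complex" where
  "msym n a z = (\<Sum>\<sigma> | \<sigma> permutes {..<n}. monomial n (a \<circ> \<sigma>) z)"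

text \<open>Here \<open>D\<^sub>j = z\<^sub>j \<partial>/\<partial>z\<^sub>j\<close>, so that \<open>\<i> D\<^sub>j\<close> is the derivative in the \<open>j\<close>-th angle, and \<open>dsym j n a\<close> is
  \<open>D\<^sub>j (msym n a)\<close>; likewise \<open>ddsym j n a\<close> below is \<open>D\<^sub>j\<^sup>2 (msym n a)\<close>.\<close>

definition dsym :: "nat \<Rightarrow> nat \<Rightarrow> (nat \<Rightarrow> nat) \<Rightarrow> config \<Rightarrow> complex" where
  "dsym j n a z = (\<Sum>\<sigma> | \<sigma> permutes {..<n}. of_nat (a (\<sigma> j)) * monomial n (a \<circ> \<sigma>) z)"

text \<open>For 0 < r < a j - a k two exponents come closer with their sum kept, a downward move in
  the dominance order; r = 0 changes nothing.\<close>

definition squeeze :: "nat \<Rightarrow> nat \<Rightarrow> nat \<Rightarrow> (nat \<Rightarrow> nat) \<Rightarrow> nat \<Rightarrow> nat" where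
  "squeeze j k r a = a(j := a j - r, k := a k + r)"

text \<open>The quotient of \<open>dsym j n a - dsym k n a\<close> by \<open>z j - z k\<close>, written without a division.\<close>

definition pair_quotient :: "nat \<Rightarrow> nat \<Rightarrow> nat \<Rightarrow> (nat \<Rightarrow> nat) \<Rightarrow> config \<Rightarrow> complex" where
  "pair_quotient j k n a z = (\<Sum>\<sigma> | \<sigma> permutes {..<n}.
     let b = a \<circ> \<sigma> in of_nat (b j - b k) *
       (\<Sum>r<b j - b k. monomial n (b(j := b j - Suc r, k := b k + r)) z))"

lemma monomial_split:
  assumes "j < n" "k < n" "j \<noteq> k"
  shows "monomial n b z = z j ^ b j * z k ^ b k * (\<Prod>i\<in>{..<n} - {j, k}. z i ^ b i)"
proof -
  have "{..<n} = insert j (insert k ({..<n} - {j, k}))"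
    using assms by auto
  then have "monomial n b z = (\<Prod>i\<in>insert j (insert k ({..<n} - {j, k})). z i ^ b i)"
    unfolding monomial_def by metis
  then show ?thesis
    using assms by simp
qed

text \<open>Once \<open>(z j * z k) ^ b k\<close> and the other variables are factored out, this is
  the factorization of x^d - y^d with \<open>d = b j - b k\<close>.\<close>

lemma monomial_swap_diff:
  assumes "j < n" "k < n" "j \<noteq> k" "b k \<le> b j"
  shows "monomial n b z - monomial n (b \<circ> Transposition.transpose j k) z
    = (z j - z k) * (\<Sum>r<b j - b k. monomial n (b(j := b j - Suc r, k := b k + r)) z)"
proof -
  define R where "R = (\<Prod>i\<in>{..<n} - {j, k}. z i ^ b i)"
  have R: "(\<Prod>i\<in>{..<n} - {j, k}. z i ^ c i) = R" if "\<And>i. i \<noteq> j \<Longrightarrow> i \<noteq> k \<Longrightarrow> c i = b i" for c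
    unfolding R_def by (rule prod.cong) (auto simp: that)
  define d where "d = b j - b k"
  have bj: "b j = b k + d"
    using assms by (simp add: d_def)
  have 1: "monomial n b z = z j ^ (b k + d) * z k ^ b k * R"
    using monomial_split[OF assms(1-3)] by (simp add: R_def bj)
  have 2: "monomial n (b \<circ> Transposition.transpose j k) z = z j ^ b k * z k ^ (b k + d) * R"
    using monomial_split[OF assms(1-3), of "b \<circ> Transposition.transpose j k"]
      R[of "b \<circ> Transposition.transpose j k"] by (simp add: bj)
  have "monomial n (b(j := b j - Suc r, k := b k + r)) z = (z k ^ r * z j ^ (d - Suc r)) * (z j * z k) ^ b k * R"
    if "r < d" for r
  proof -
    have "b k + d - Suc r = b k + (d - Suc r)"
      using that by simp
    then show ?thesis
      using monomial_split[OF assms(1-3), of "b(j := b j - Suc r, k := b k + r)"]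
      R[of "b(j := b j - Suc r, k := b k + r)"] assms(3)
      by (simp add: bj power_add power_mult_distrib)
  qed
  then have "(\<Sum>r<d. monomial n (b(j := b j - Suc r, k := b k + r)) z)
    = (\<Sum>r<d. z k ^ r * z j ^ (d - Suc r)) * (z j * z k) ^ b k * R"
    by (simp add: sum_distrib_right)
  moreover have "z j ^ d - z k ^ d = (z j - z k) * (\<Sum>r<d. z k ^ r * z j ^ (d - Suc r))"
    using power_diff_sumr2[of "z k" d "z j"] by (simp add: algebra_simps)
  ultimately have "(z j - z k) * (\<Sum>r<d. monomial n (b(j := b j - Suc r, k := b k + r)) z)
    = (z j ^ d - z k ^ d) * (z j * z k) ^ b k * R"
    by (simp add: mult_ac)
  then show ?thesis
    unfolding 1 2 by (simp add: power_add power_mult_distrib algebra_simps d_def[symmetric])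
qed

text \<open>Swapping j and k pairs the permutations. The coefficient changes sign under the swap, so
  the sum consists of differences between a monomial and its swapped copy, each divisible by
  \<open>z j - z k\<close>.\<close>

lemma dsym_diff:
  assumes "j < n" "k < n" "j \<noteq> k"
  shows "dsym j n a z - dsym k n a z = (z j - z k) * pair_quotient j k n a z"
proof -
  let ?P = "{\<sigma>. \<sigma> permutes {..<n}}" and ?t = "Transposition.transpose j k"
  let ?c = "\<lambda>j k \<sigma>. of_nat (a (\<sigma> j) - a (\<sigma> k)) :: complex" and ?m = "\<lambda>\<sigma>. monomial n (a \<circ> \<sigma>) z"
  have t: "?t permutes {..<n}"
    using assms by (simp add: permutes_swap_id)
  have "dsym j n a z - dsym k n a z
    = (\<Sum>\<sigma>\<in>?P. (of_nat (a (\<sigma> j)) - of_nat (a (\<sigma> k))) * ?m \<sigma>)"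
    by (simp add: dsym_def sum_subtractf[symmetric] left_diff_distrib)
  \<comment> \<open>Truncated subtraction splits the integer difference into its positive and
    negative parts; the swap then turns the negative part into the positive one.\<close>
  also have "\<dots> = (\<Sum>\<sigma>\<in>?P. ?c j k \<sigma> * ?m \<sigma>)
      - (\<Sum>\<sigma>\<in>?P. ?c k j \<sigma> * ?m \<sigma>)"
    unfolding sum_subtractf[symmetric]
  proof (rule sum.cong[OF refl])
    fix \<sigma>
    show "(of_nat (a (\<sigma> j)) - of_nat (a (\<sigma> k))) * ?m \<sigma>
      = ?c j k \<sigma> * ?m \<sigma> - ?c k j \<sigma> * ?m \<sigma>"
      by (cases "a (\<sigma> j) \<le> a (\<sigma> k)") (auto simp: of_nat_diff algebra_simps)
  qed
  also have "(\<Sum>\<sigma>\<in>?P. ?c k j \<sigma> * ?m \<sigma>)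
    = (\<Sum>\<sigma>\<in>?P. ?c j k \<sigma> * ?m (\<sigma> \<circ> ?t))"
    by (subst sum_permutations_compose_right[OF t]) (simp add: o_assoc)
  also have "(\<Sum>\<sigma>\<in>?P. ?c j k \<sigma> * ?m \<sigma>)
      - (\<Sum>\<sigma>\<in>?P. ?c j k \<sigma> * ?m (\<sigma> \<circ> ?t))
    = (\<Sum>\<sigma>\<in>?P. ?c j k \<sigma> * (?m \<sigma> - ?m (\<sigma> \<circ> ?t)))"
    by (simp add: sum_subtractf[symmetric] right_diff_distrib)
  also have "\<dots> = (z j - z k) * pair_quotient j k n a z"
    unfolding pair_quotient_def Let_def sum_distrib_left
  proof (rule sum.cong[OF refl])
    fix \<sigma>
    show "?c j k \<sigma> * (?m \<sigma> - ?m (\<sigma> \<circ> ?t))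
      = (\<Sum>r<(a \<circ> \<sigma>) j - (a \<circ> \<sigma>) k. (z j - z k) * (of_nat ((a \<circ> \<sigma>) j - (a \<circ> \<sigma>) k) *
          monomial n ((a \<circ> \<sigma>)(j := (a \<circ> \<sigma>) j - Suc r, k := (a \<circ> \<sigma>) k + r)) z))"
      using monomial_swap_diff[OF assms, of "a \<circ> \<sigma>" z]
      by (cases "a (\<sigma> k) \<le> a (\<sigma> j)") (auto simp: sum_distrib_left mult_ac o_assoc)
  qed
  finally show ?thesis .
qed

definition squeeze_sum :: "nat \<Rightarrow> nat \<Rightarrow> nat \<Rightarrow> (nat \<Rightarrow> nat) \<Rightarrow> config \<Rightarrow> complex" where
  "squeeze_sum j k n b z = of_nat (b j - b k) * (\<Sum>r<b j - b k. monomial n (squeeze j k r b) z)"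

text \<open>The factor \<open>z j + z k\<close> comes from the cotangent drift: the cotangent of
  half the angle difference is the imaginary unit times (z j + z k) / (z j - z k). Multiplying by
  \<open>z j\<close> restores one unit at j, multiplying by \<open>z k\<close> one unit at k. The
  second family becomes squeezes in the other direction after a swap, which the sum over
  permutations absorbs.\<close>

lemma pair_quotient_sum:
  assumes "j < n" "k < n" "j \<noteq> k"
  shows "(z j + z k) * pair_quotient j k n a z
    = (\<Sum>\<sigma> | \<sigma> permutes {..<n}. squeeze_sum j k n (a \<circ> \<sigma>) z + squeeze_sum k j n (a \<circ> \<sigma>) z)"
proof -
  let ?P = "{\<sigma>. \<sigma> permutes {..<n}}" and ?t = "Transposition.transpose j k"
  have t: "?t permutes {..<n}"
    using assms by (simp add: permutes_swap_id)
  have *: "(z j + z k) * (\<Sum>r<b j - b k. monomial n (b(j := b j - Suc r, k := b k + r)) z)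
    = (\<Sum>r<b j - b k. monomial n (squeeze j k r b) z) + (\<Sum>r<b j - b k. monomial n (squeeze k j r (b \<circ> ?t)) z)" for b
  proof -
    have 1: "z j * monomial n (b(j := b j - Suc r, k := b k + r)) z = monomial n (squeeze j k r b) z"
      if "r < b j - b k" for r
    proof -
      have "z j * z j ^ (b j - Suc r) = z j ^ (b j - r)"
        using that by (metis Suc_diff_Suc less_diff_conv add_lessD1 power_Suc)
      then show ?thesis
        using assms(3) unfolding squeeze_def monomial_split[OF assms] by (auto simp: mult_ac intro!: prod.cong)
    qed
    \<comment> \<open>After the swap the same exponents are reached by moving
      \<open>b j - b k - Suc r\<close> units in the opposite direction, hence the reversed
      index.\<close>
    have 2: "z k * monomial n (b(j := b j - Suc r, k := b k + r)) z
        = monomial n (squeeze k j (b j - b k - Suc r) (b \<circ> ?t)) z"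
      if "r < b j - b k" for r
    proof -
      have "b j - (b j - b k - Suc r) = Suc (b k + r)" "b k + (b j - b k - Suc r) = b j - Suc r"
        using that by auto
      then have "squeeze k j (b j - b k - Suc r) (b \<circ> ?t) = b(j := b j - Suc r, k := Suc (b k + r))"
        using assms(3) by (auto simp: squeeze_def fun_eq_iff transpose_def)
      then show ?thesis
        using assms(3) by (auto simp: monomial_split[OF assms] mult_ac intro!: prod.cong)
    qed
    have "(\<Sum>r<b j - b k. z k * monomial n (b(j := b j - Suc r, k := b k + r)) z)
      = (\<Sum>r<b j - b k. monomial n (squeeze k j (b j - b k - Suc r) (b \<circ> ?t)) z)"
      by (rule sum.cong) (auto simp: 2)
    also have "\<dots> = (\<Sum>r<b j - b k. monomial n (squeeze k j r (b \<circ> ?t)) z)"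
      by (rule sum.nat_diff_reindex)
    finally show ?thesis
      by (simp add: distrib_right sum_distrib_left 1 sum.distrib)
  qed
  have "(z j + z k) * pair_quotient j k n a z = (\<Sum>\<sigma>\<in>?P. squeeze_sum j k n (a \<circ> \<sigma>) z
     + of_nat (a (\<sigma> j) - a (\<sigma> k)) * (\<Sum>r<a (\<sigma> j) - a (\<sigma> k). monomial n (squeeze k j r (a \<circ> \<sigma> \<circ> ?t)) z))"
    unfolding pair_quotient_def sum_distrib_left[of "z j + z k"]
  proof (rule sum.cong[OF refl])
    fix \<sigma>
    show "(z j + z k) * (let b = a \<circ> \<sigma> in of_nat (b j - b k) *
       (\<Sum>r<b j - b k. monomial n (b(j := b j - Suc r, k := b k + r)) z)) = squeeze_sum j k n (a \<circ> \<sigma>) z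
     + of_nat (a (\<sigma> j) - a (\<sigma> k)) * (\<Sum>r<a (\<sigma> j) - a (\<sigma> k). monomial n (squeeze k j r (a \<circ> \<sigma> \<circ> ?t)) z)"
      unfolding Let_def mult.left_commute[of "z j + z k"] *[of "a \<circ> \<sigma>"] squeeze_sum_def
      by (simp add: distrib_left)
  qed
  also have "\<dots> = (\<Sum>\<sigma>\<in>?P. squeeze_sum j k n (a \<circ> \<sigma>) z)
      + (\<Sum>\<sigma>\<in>?P. of_nat (a (\<sigma> j) - a (\<sigma> k)) * (\<Sum>r<a (\<sigma> j) - a (\<sigma> k). monomial n (squeeze k j r (a \<circ> \<sigma> \<circ> ?t)) z))"
    by (rule sum.distrib)
  also have "(\<Sum>\<sigma>\<in>?P. of_nat (a (\<sigma> j) - a (\<sigma> k)) * (\<Sum>r<a (\<sigma> j) - a (\<sigma> k). monomial n (squeeze k j r (a \<circ> \<sigma> \<circ> ?t)) z))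
    = (\<Sum>\<sigma>\<in>?P. squeeze_sum k j n (a \<circ> \<sigma>) z)"
    by (subst (2) sum_permutations_compose_right[OF t]) (simp add: o_assoc squeeze_sum_def)
  finally show ?thesis
    by (simp only: sum.distrib)
qed

text \<open>Squeezing \<open>a \<circ> \<sigma>\<close> at the positions j, k amounts to squeezing a
  at \<open>\<sigma> j\<close>, \<open>\<sigma> k\<close> and then permuting. In the sum over all
  pairs of positions the relabelling disappears, and symmetrized monomials remain.\<close>

lemma sum_squeeze_sum:
  "(\<Sum>j<n. \<Sum>k<n. \<Sum>\<sigma> | \<sigma> permutes {..<n}. squeeze_sum j k n (a \<circ> \<sigma>) z)
    = (\<Sum>j<n. \<Sum>k<n. of_nat (a j - a k) * (\<Sum>r<a j - a k. msym n (squeeze j k r a) z))"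
proof -
  let ?P = "{\<sigma>. \<sigma> permutes {..<n}}"
  let ?g = "\<lambda>j k \<sigma>. of_nat (a j - a k) * (\<Sum>r<a j - a k. monomial n (squeeze j k r a \<circ> \<sigma>) z)"
  have inj: "squeeze j k r (a \<circ> \<sigma>) = squeeze (\<sigma> j) (\<sigma> k) r a \<circ> \<sigma>" if "\<sigma> permutes {..<n}" for \<sigma> j k r
    using permutes_inj[OF that] by (auto simp: squeeze_def fun_eq_iff inj_eq)
  have "(\<Sum>j<n. \<Sum>k<n. \<Sum>\<sigma>\<in>?P. squeeze_sum j k n (a \<circ> \<sigma>) z)
    = (\<Sum>\<sigma>\<in>?P. \<Sum>j<n. \<Sum>k<n. squeeze_sum j k n (a \<circ> \<sigma>) z)"
    by (simp add: sum.swap[of _ _ ?P])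
  also have "\<dots> = (\<Sum>\<sigma>\<in>?P. \<Sum>j<n. \<Sum>k<n. ?g (\<sigma> j) (\<sigma> k) \<sigma>)"
    by (intro sum.cong refl) (simp add: squeeze_sum_def inj)
  also have "\<dots> = (\<Sum>\<sigma>\<in>?P. \<Sum>j<n. \<Sum>k<n. ?g j k \<sigma>)"
  proof (rule sum.cong[OF refl])
    fix \<sigma> assume "\<sigma> \<in> ?P"
    then have b: "bij_betw \<sigma> {..<n} {..<n}"
      by (simp add: permutes_imp_bij)
    have "(\<Sum>j<n. \<Sum>k<n. ?g (\<sigma> j) (\<sigma> k) \<sigma>) = (\<Sum>j<n. \<Sum>k<n. ?g (\<sigma> j) k \<sigma>)"
      by (rule sum.cong[OF refl], rule sum.reindex_bij_betw[OF b])
    also have "\<dots> = (\<Sum>j<n. \<Sum>k<n. ?g j k \<sigma>)"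
      by (rule sum.reindex_bij_betw[OF b])
    finally show "(\<Sum>j<n. \<Sum>k<n. ?g (\<sigma> j) (\<sigma> k) \<sigma>) = (\<Sum>j<n. \<Sum>k<n. ?g j k \<sigma>)" .
  qed
  also have "\<dots> = (\<Sum>j<n. \<Sum>k<n. \<Sum>\<sigma>\<in>?P. ?g j k \<sigma>)"
    by (simp add: sum.swap[of _ _ ?P])
  also have "\<dots> = (\<Sum>j<n. \<Sum>k<n. of_nat (a j - a k) * (\<Sum>r<a j - a k. msym n (squeeze j k r a) z))"
    by (intro sum.cong refl) (simp add: msym_def sum_distrib_left sum.swap[of _ _ ?P])
  finally show ?thesis .
qed

lemma sum_pair_quotient:
  "(\<Sum>j<n. \<Sum>k<n. (z j + z k) * pair_quotient j k n a z)
    = 2 * (\<Sum>j<n. \<Sum>k<n. of_nat (a j - a k) * (\<Sum>r<a j - a k. msym n (squeeze j k r a) z))"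
proof -
  let ?S = "\<lambda>j k. \<Sum>\<sigma> | \<sigma> permutes {..<n}. squeeze_sum j k n (a \<circ> \<sigma>) z"
  have "(\<Sum>j<n. \<Sum>k<n. (z j + z k) * pair_quotient j k n a z) = (\<Sum>j<n. \<Sum>k<n. ?S j k + ?S k j)"
  proof (intro sum.cong refl)
    fix j k assume "j \<in> {..<n}" "k \<in> {..<n}"
    then show "(z j + z k) * pair_quotient j k n a z = ?S j k + ?S k j"
      using pair_quotient_sum[of j n k z a]
      by (cases "j = k") (auto simp: sum.distrib pair_quotient_def squeeze_sum_def Let_def)
  qed
  also have "\<dots> = (\<Sum>j<n. \<Sum>k<n. ?S j k) + (\<Sum>j<n. \<Sum>k<n. ?S k j)"
    by (simp add: sum.distrib)
  also have "(\<Sum>j<n. \<Sum>k<n. ?S k j) = (\<Sum>j<n. \<Sum>k<n. ?S j k)"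
    by (rule sum.swap)
  finally show ?thesis
    unfolding sum_squeeze_sum by simp
qed

section \<open>The uniform measure on the torus\<close>

lemma sets_circle_uniform [simp, measurable_cong]: "sets circle_uniform = sets borel"
  by (simp add: circle_uniform_def)

lemma space_circle_uniform [simp]: "space circle_uniform = UNIV"
  by (simp add: circle_uniform_def)

lemma borel_measurable_cis [measurable]: "cis \<in> borel_measurable borel"
  by (intro borel_measurable_continuous_onI continuous_intros)

lemma prob_space_circle_uniform: "prob_space circle_uniform"
proof -
  interpret prob_space "uniform_measure lborel {0..<2 * pi}"
    by (rule prob_space_uniform_measure) (auto simp: pi_gt_zero)
  show ?thesis
    unfolding circle_uniform_def by (rule prob_space_distr) simp
qed

lemma nn_integral_circle_uniform:
  assumes [measurable]: "g \<in> borel_measurable borel"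
  shows "(\<integral>\<^sup>+u. g u \<partial>circle_uniform) = (\<integral>\<^sup>+t. g (cis t) * indicator {0..<2 * pi} t \<partial>lborel) / ennreal (2 * pi)"
  by (simp add: circle_uniform_def nn_integral_distr nn_integral_uniform_measure)

lemma integral_circle_uniform:
  fixes h :: "complex \<Rightarrow> real"
  assumes [measurable]: "h \<in> borel_measurable borel"
  shows "(\<integral>u. h u \<partial>circle_uniform) = (\<integral>t. indicator {0..2 * pi} t *\<^sub>R h (cis t) \<partial>lborel) / (2 * pi)"
proof -
  have dens: "uniform_measure lborel {0..<2 * pi} = density lborel (\<lambda>t. ennreal (indicator {0..<2 * pi} t / (2 * pi)))"
    unfolding uniform_measure_def by (rule density_cong) (auto simp: divide_ennreal split: split_indicator simp flip: ennreal_1)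
  have "(\<integral>u. h u \<partial>circle_uniform) = (\<integral>t. (indicator {0..<2 * pi} t / (2 * pi)) *\<^sub>R h (cis t) \<partial>lborel)"
    unfolding circle_uniform_def by (subst integral_distr) (auto simp: dens integral_density)
  also have "\<dots> = (\<integral>t. (indicator {0..2 * pi} t *\<^sub>R h (cis t)) / (2 * pi) \<partial>lborel)"
  proof (rule integral_cong_AE)
    show "AE t in lborel. (indicator {0..<2 * pi} t / (2 * pi)) *\<^sub>R h (cis t)
        = (indicator {0..2 * pi} t *\<^sub>R h (cis t)) / (2 * pi)"
      using AE_lborel_singleton[of "2 * pi"] by eventually_elim (auto split: split_indicator)
  qed auto
  finally show ?thesis
    by simp
qed

lemma AE_circle_uniform: "AE u in circle_uniform. cmod u = 1"
  unfolding circle_uniform_def by (subst AE_distr_iff) auto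

text \<open>By periodicity the part of the window beyond 2 pi is carried back to [0, s). Both
  rotation invariance and the passage to angles in [-pi, pi) reduce to this.\<close>

lemma nn_integral_cis_window:
  assumes [measurable]: "g \<in> borel_measurable borel" and s: "0 \<le> s" "s \<le> 2 * pi"
  shows "(\<integral>\<^sup>+t. g (cis t) * indicator {s..<s + 2 * pi} t \<partial>lborel)
       = (\<integral>\<^sup>+t. g (cis t) * indicator {0..<2 * pi} t \<partial>lborel)"
proof -
  have "(\<integral>\<^sup>+t. g (cis t) * indicator {s..<s + 2 * pi} t \<partial>lborel)
      = (\<integral>\<^sup>+t. g (cis t) * indicator {s..<2 * pi} t + g (cis t) * indicator {2 * pi..<s + 2 * pi} t \<partial>lborel)"
    using s by (intro nn_integral_cong) (auto split: split_indicator)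
  also have "\<dots> = (\<integral>\<^sup>+t. g (cis t) * indicator {s..<2 * pi} t \<partial>lborel)
      + (\<integral>\<^sup>+t. g (cis t) * indicator {2 * pi..<s + 2 * pi} t \<partial>lborel)"
    by (rule nn_integral_add) auto
  also have "(\<integral>\<^sup>+t. g (cis t) * indicator {2 * pi..<s + 2 * pi} t \<partial>lborel)
      = (\<integral>\<^sup>+t. g (cis (2 * pi + 1 * t)) * indicator {2 * pi..<s + 2 * pi} (2 * pi + 1 * t) \<partial>lborel)"
    by (subst nn_integral_real_affine[where c = 1 and t = "2 * pi"]) auto
  also have "\<dots> = (\<integral>\<^sup>+t. g (cis t) * indicator {0..<s} t \<partial>lborel)"
    by (intro nn_integral_cong) (auto split: split_indicator simp: cis_mult[symmetric])
  also have "(\<integral>\<^sup>+t. g (cis t) * indicator {s..<2 * pi} t \<partial>lborel) + (\<integral>\<^sup>+t. g (cis t) * indicator {0..<s} t \<partial>lborel)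
      = (\<integral>\<^sup>+t. g (cis t) * indicator {s..<2 * pi} t + g (cis t) * indicator {0..<s} t \<partial>lborel)"
    by (rule nn_integral_add[symmetric]) auto
  also have "\<dots> = (\<integral>\<^sup>+t. g (cis t) * indicator {0..<2 * pi} t \<partial>lborel)"
    using s by (intro nn_integral_cong) (auto split: split_indicator)
  finally show ?thesis .
qed

lemma nn_integral_circle_uniform_rotate:
  assumes [measurable]: "g \<in> borel_measurable borel" and "cmod c = 1"
  shows "(\<integral>\<^sup>+u. g (c * u) \<partial>circle_uniform) = (\<integral>\<^sup>+u. g u \<partial>circle_uniform)"
proof -
  define s where "s = Arg2pi c"
  have s: "0 \<le> s" "s \<le> 2 * pi" "c = cis s"
    using Arg2pi[of c] assms(2) by (auto simp: s_def is_Arg_def cis_conv_exp)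
  have "(\<integral>\<^sup>+t. g (cis t) * indicator {s..<s + 2 * pi} t \<partial>lborel)
      = (\<integral>\<^sup>+t. g (cis (s + 1 * t)) * indicator {s..<s + 2 * pi} (s + 1 * t) \<partial>lborel)"
    by (subst nn_integral_real_affine[where c = 1 and t = s]) auto
  also have "\<dots> = (\<integral>\<^sup>+t. g (c * cis t) * indicator {0..<2 * pi} t \<partial>lborel)"
    by (intro nn_integral_cong) (auto split: split_indicator simp: cis_mult s(3))
  finally show ?thesis
    by (simp add: nn_integral_circle_uniform nn_integral_cis_window s(1,2))
qed

lemma distr_circle_uniform_rotate:
  assumes "cmod c = 1"
  shows "distr circle_uniform circle_uniform (\<lambda>u. c * u) = circle_uniform"
proof (rule measure_eqI)
  fix A assume "A \<in> sets (distr circle_uniform circle_uniform (\<lambda>u. c * u))"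
  then have [measurable]: "A \<in> sets borel" by simp
  have "emeasure (distr circle_uniform circle_uniform (\<lambda>u. c * u)) A
      = (\<integral>\<^sup>+u. indicator A u \<partial>distr circle_uniform circle_uniform (\<lambda>u. c * u))"
    by simp
  also have "\<dots> = (\<integral>\<^sup>+u. indicator A (c * u) \<partial>circle_uniform)"
    by (subst nn_integral_distr) auto
  also have "\<dots> = emeasure circle_uniform A"
    by (subst nn_integral_circle_uniform_rotate[OF _ assms]) auto
  finally show "emeasure (distr circle_uniform circle_uniform (\<lambda>u. c * u)) A = emeasure circle_uniform A" .
qed simp

abbreviation torus :: "nat \<Rightarrow> config measure" where
  "torus n \<equiv> Pi\<^sub>M {..<n} (\<lambda>_. circle_uniform)"

interpretation circle: prob_space circle_uniform
  by (rule prob_space_circle_uniform)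

interpretation circle_prod: product_sigma_finite "\<lambda>_. circle_uniform"
  by (simp add: product_sigma_finite_def circle.sigma_finite_measure_axioms)

lemma prob_space_torus: "prob_space (torus n)"
  by (intro prob_space_PiM circle.prob_space_axioms)

interpretation torus: prob_space "torus n" for n
  by (rule prob_space_torus)

lemma AE_torus: "AE z in torus n. \<forall>j<n. cmod (z j) = 1"
proof -
  have "AE z in torus n. cmod (z j) = 1" if "j \<in> {..<n}" for j
    using that AE_PiM_component[of "{..<n}" "\<lambda>_. circle_uniform" j "\<lambda>u. cmod u = 1"]
      prob_space_circle_uniform AE_circle_uniform by auto
  then have "AE z in torus n. \<forall>j\<in>{..<n}. cmod (z j) = 1"
    by (intro AE_ball_countable') auto
  then show ?thesis by (auto elim: eventually_mono)
qed

lemma distr_torus_rotate: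
  assumes "cmod c = 1"
  shows "distr (torus n) (torus n) (\<lambda>z. \<lambda>i\<in>{..<n}. c * z i) = torus n"
proof (rule circle_prod.PiM_eqI)
  fix A assume A: "\<And>i. i \<in> {..<n} \<Longrightarrow> A i \<in> sets circle_uniform"
  then have [measurable]: "Pi\<^sub>E {..<n} A \<in> sets (torus n)"
    by (intro sets_PiM_I_finite) auto
  have [measurable]: "(\<lambda>z. \<lambda>i\<in>{..<n}. c * z i) \<in> torus n \<rightarrow>\<^sub>M torus n"
    by measurable
  have "emeasure (distr (torus n) (torus n) (\<lambda>z. \<lambda>i\<in>{..<n}. c * z i)) (Pi\<^sub>E {..<n} A)
    = emeasure (torus n) ((\<lambda>z. \<lambda>i\<in>{..<n}. c * z i) -` Pi\<^sub>E {..<n} A \<inter> space (torus n))"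
    by (rule emeasure_distr) auto
  also have "(\<lambda>z. \<lambda>i\<in>{..<n}. c * z i) -` Pi\<^sub>E {..<n} A \<inter> space (torus n) = (\<Pi>\<^sub>E i\<in>{..<n}. (\<lambda>u. c * u) -` A i)"
    by (auto simp: space_PiM PiE_iff)
  also have "emeasure (torus n) \<dots> = (\<Prod>i<n. emeasure circle_uniform ((\<lambda>u. c * u) -` A i))"
    using A measurable_sets[of "\<lambda>u. c * u" circle_uniform circle_uniform]
    by (intro circle_prod.emeasure_PiM) auto
  also have "\<dots> = (\<Prod>i<n. emeasure circle_uniform (A i))"
  proof (rule prod.cong[OF refl])
    fix i assume "i \<in> {..<n}"
    then have "A i \<in> sets circle_uniform" by (rule A)
    then have "emeasure (distr circle_uniform circle_uniform (\<lambda>u. c * u)) (A i)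
      = emeasure circle_uniform ((\<lambda>u. c * u) -` A i)"
      by (subst emeasure_distr) auto
    then show "emeasure circle_uniform ((\<lambda>u. c * u) -` A i) = emeasure circle_uniform (A i)"
      by (simp add: distr_circle_uniform_rotate[OF assms])
  qed
  finally show "emeasure (distr (torus n) (torus n) (\<lambda>z. \<lambda>i\<in>{..<n}. c * z i)) (Pi\<^sub>E {..<n} A)
    = (\<Prod>i<n. emeasure circle_uniform (A i))" .
qed auto

lemma borel_measurable_coordinate: "i < n \<Longrightarrow> (\<lambda>z. z i) \<in> borel_measurable (torus n)"
  using measurable_component_singleton[of i "{..<n}" "\<lambda>_. circle_uniform"]
  by (simp add: measurable_cong_sets[OF refl sets_circle_uniform])

text \<open>The derivative is recorded only where the j-th coordinate lies on the unit circle, while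
  all other coordinates are arbitrary; this allows integration over one angle with the rest
  frozen.\<close>

definition ang_deriv :: "nat \<Rightarrow> (config \<Rightarrow> 'b::real_normed_vector) \<Rightarrow> (config \<Rightarrow> 'b) \<Rightarrow> bool" where
  "ang_deriv j F F' \<longleftrightarrow>
     (\<forall>x t. ((\<lambda>t. F (x(j := cis t))) has_vector_derivative F' (x(j := cis t))) (at t))"

text \<open>Fubini isolates the j-th angle, and a derivative integrates to zero over a full period
  because \<open>cis 0\<close> and \<open>cis (2 * pi)\<close> agree.\<close>

lemma integral_ang_deriv:
  fixes F F' :: "config \<Rightarrow> real"
  assumes "j < n" and int: "integrable (torus n) F'" and der: "ang_deriv j F F'"
    and cont: "continuous_on UNIV F'"
  shows "(\<integral>z. F' z \<partial>torus n) = 0"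
proof -
  define I where "I = {..<n} - {j}"
  have ins: "{..<n} = insert j I" and I: "finite I" "j \<notin> I"
    using assms(1) by (auto simp: I_def)
  have upd: "continuous_on UNIV (\<lambda>u. x(j := u))" for x :: "nat \<Rightarrow> complex"
  proof (rule continuous_on_coordinatewise_then_product)
    show "continuous_on UNIV (\<lambda>u. (x(j := u)) i)" for i
      by (cases "i = j") (auto intro: continuous_intros)
  qed
  have "(\<integral>u. F' (x(j := u)) \<partial>circle_uniform) = 0" for x
  proof -
    have c: "continuous_on UNIV (\<lambda>u. F' (x(j := u)))"
      by (rule continuous_on_compose2[OF cont upd]) auto
    then have [measurable]: "(\<lambda>u. F' (x(j := u))) \<in> borel_measurable borel"
      by (rule borel_measurable_continuous_onI)
    have "(\<integral>t. indicator {0..2 * pi} t *\<^sub>R F' (x(j := cis t)) \<partial>lborel)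
      = F (x(j := cis (2 * pi))) - F (x(j := cis 0))"
    proof (rule integral_FTC_atLeastAtMost)
      show "((\<lambda>t. F (x(j := cis t))) has_vector_derivative F' (x(j := cis t))) (at t within {0..2 * pi})" for t
        using der unfolding ang_deriv_def by (blast intro: has_vector_derivative_at_within)
      show "continuous_on {0..2 * pi} (\<lambda>t. F' (x(j := cis t)))"
        by (rule continuous_on_compose2[OF c]) (auto intro: continuous_intros)
    qed simp
    then show ?thesis
      by (simp add: integral_circle_uniform)
  qed
  then show ?thesis
    using int unfolding ins by (simp add: circle_prod.product_integral_insert[OF I])
qed

section \<open>Integration by parts\<close>

lemma ang_derivD:
  "ang_deriv j F F' \<Longrightarrow> ((\<lambda>t. F (x(j := cis t))) has_vector_derivative F' (x(j := cis t))) (at t)"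
  by (auto simp: ang_deriv_def)

lemma ang_deriv_sum:
  assumes "\<And>i. i \<in> A \<Longrightarrow> ang_deriv j (F i) (F' i)"
  shows "ang_deriv j (\<lambda>z. \<Sum>i\<in>A. F i z) (\<lambda>z. \<Sum>i\<in>A. F' i z)"
  unfolding ang_deriv_def by (intro allI has_vector_derivative_sum ang_derivD[OF assms])

lemma ang_deriv_mult:
  fixes F G :: "config \<Rightarrow> 'b::real_normed_algebra"
  assumes "ang_deriv j F F'" "ang_deriv j G G'"
  shows "ang_deriv j (\<lambda>z. F z * G z) (\<lambda>z. F z * G' z + F' z * G z)"
  unfolding ang_deriv_def
  by (intro allI has_vector_derivative_mult ang_derivD[OF assms(1)] ang_derivD[OF assms(2)])

lemma ang_deriv_diff:
  assumes "ang_deriv j F F'" "ang_deriv j G G'"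
  shows "ang_deriv j (\<lambda>z. F z - G z) (\<lambda>z. F' z - G' z)"
  unfolding ang_deriv_def
  by (intro allI has_vector_derivative_diff ang_derivD[OF assms(1)] ang_derivD[OF assms(2)])

lemma ang_deriv_linear:
  assumes "bounded_linear f" "ang_deriv j F F'"
  shows "ang_deriv j (\<lambda>z. f (F z)) (\<lambda>z. f (F' z))"
  unfolding ang_deriv_def
  by (intro allI bounded_linear.has_vector_derivative[OF assms(1)] ang_derivD[OF assms(2)])

lemma ang_deriv_coordinate: "ang_deriv j (\<lambda>z. z i) (\<lambda>z. if i = j then \<i> * z i else 0)"
proof -
  have "(cis has_vector_derivative \<i> * cis t) (at t)" for t
    unfolding has_vector_derivative_def
    by (rule has_derivative_eq_rhs[OF has_derivative_cis[OF has_derivative_ident]])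
       (auto simp: fun_eq_iff scaleR_conv_of_real)
  then show ?thesis
    by (auto simp: ang_deriv_def intro: has_vector_derivative_const)
qed

lemma ang_deriv_compose_real:
  fixes G :: "config \<Rightarrow> real"
  assumes "\<And>z. (f has_real_derivative f' (G z)) (at (G z))" "ang_deriv j G G'"
  shows "ang_deriv j (\<lambda>z. f (G z)) (\<lambda>z. f' (G z) * G' z)"
  unfolding ang_deriv_def
proof (intro allI)
  fix x t
  have "((\<lambda>t. G (x(j := cis t))) has_real_derivative G' (x(j := cis t))) (at t)"
    using ang_derivD[OF assms(2)] by (simp add: has_real_derivative_iff_has_vector_derivative)
  from DERIV_chain2[OF assms(1) this]
  show "((\<lambda>t. f (G (x(j := cis t)))) has_vector_derivative f' (G (x(j := cis t))) * G' (x(j := cis t))) (at t)"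
    by (simp add: has_real_derivative_iff_has_vector_derivative)
qed

lemma ang_deriv_monomial:
  assumes "j < n"
  shows "ang_deriv j (monomial n b) (\<lambda>z. \<i> * of_nat (b j) * monomial n b z)"
  unfolding ang_deriv_def
proof (intro allI)
  fix x :: "nat \<Rightarrow> complex" and t :: real
  define R where "R = (\<Prod>i\<in>{..<n} - {j}. x i ^ b i)"
  have m: "monomial n b (x(j := cis t)) = cis (of_nat (b j) * t) * R" for t
  proof -
    have "monomial n b (x(j := cis t)) = cis t ^ b j * (\<Prod>i\<in>{..<n} - {j}. (x(j := cis t)) i ^ b i)"
      unfolding monomial_def using assms by (subst prod.remove[of _ j]) auto
    also have "(\<Prod>i\<in>{..<n} - {j}. (x(j := cis t)) i ^ b i) = R"
      unfolding R_def by (rule prod.cong) auto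
    finally show ?thesis by (simp only: Complex.DeMoivre)
  qed
  have "((\<lambda>t. cis (of_nat (b j) * t)) has_vector_derivative \<i> * of_nat (b j) * cis (of_nat (b j) * t)) (at t)"
    unfolding has_vector_derivative_def
    by (rule has_derivative_eq_rhs[OF has_derivative_cis[OF has_derivative_mult_right[OF has_derivative_ident]]])
       (auto simp: fun_eq_iff scaleR_conv_of_real)
  from has_vector_derivative_mult_left[OF this, of R]
  show "((\<lambda>t. monomial n b (x(j := cis t))) has_vector_derivative
      \<i> * of_nat (b j) * monomial n b (x(j := cis t))) (at t)"
    unfolding m by (simp add: mult_ac)
qed

definition ddsym :: "nat \<Rightarrow> nat \<Rightarrow> (nat \<Rightarrow> nat) \<Rightarrow> config \<Rightarrow> complex" where
  "ddsym j n a z = (\<Sum>\<sigma> | \<sigma> permutes {..<n}. of_nat (a (\<sigma> j)) * (of_nat (a (\<sigma> j)) * monomial n (a \<circ> \<sigma>) z))"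

lemma sum_ddsym: "(\<Sum>j<n. ddsym j n a z) = of_nat (\<Sum>j<n. (a j)\<^sup>2) * msym n a z"
proof -
  let ?P = "{\<sigma>. \<sigma> permutes {..<n}}"
  have "(\<Sum>j<n. ddsym j n a z) = (\<Sum>\<sigma>\<in>?P. \<Sum>j<n. of_nat ((a (\<sigma> j))\<^sup>2) * monomial n (a \<circ> \<sigma>) z)"
    unfolding ddsym_def by (subst sum.swap) (simp add: power2_eq_square mult_ac)
  also have "\<dots> = (\<Sum>\<sigma>\<in>?P. of_nat (\<Sum>j<n. (a j)\<^sup>2) * monomial n (a \<circ> \<sigma>) z)"
  proof (rule sum.cong[OF refl])
    fix \<sigma> assume "\<sigma> \<in> ?P"
    then have "(\<Sum>j<n. (a (\<sigma> j))\<^sup>2) = (\<Sum>j<n. (a j)\<^sup>2)"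
      using sum.reindex_bij_betw[OF permutes_imp_bij, of \<sigma> "{..<n}" "\<lambda>j. (a j)\<^sup>2"] by simp
    then show "(\<Sum>j<n. of_nat ((a (\<sigma> j))\<^sup>2) * monomial n (a \<circ> \<sigma>) z) = of_nat (\<Sum>j<n. (a j)\<^sup>2) * monomial n (a \<circ> \<sigma>) z"
      by (simp only: sum_distrib_right[symmetric] of_nat_sum[symmetric])
  qed
  finally show ?thesis
    by (simp add: msym_def sum_distrib_left)
qed

lemma ang_deriv_msym:
  assumes "j < n"
  shows "ang_deriv j (msym n a) (\<lambda>z. \<i> * dsym j n a z)"
proof -
  have "ang_deriv j (\<lambda>z. \<Sum>\<sigma> | \<sigma> permutes {..<n}. monomial n (a \<circ> \<sigma>) z)
     (\<lambda>z. \<Sum>\<sigma> | \<sigma> permutes {..<n}. \<i> * of_nat ((a \<circ> \<sigma>) j) * monomial n (a \<circ> \<sigma>) z)"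
    by (rule ang_deriv_sum) (rule ang_deriv_monomial[OF assms])
  then show ?thesis
    by (simp add: msym_def[abs_def] dsym_def sum_distrib_left mult_ac)
qed

lemma ang_deriv_dsym:
  assumes "j < n"
  shows "ang_deriv j (dsym j n a) (\<lambda>z. \<i> * ddsym j n a z)"
proof -
  have "ang_deriv j (\<lambda>z. \<Sum>\<sigma> | \<sigma> permutes {..<n}. of_nat (a (\<sigma> j)) * monomial n (a \<circ> \<sigma>) z)
     (\<lambda>z. \<Sum>\<sigma> | \<sigma> permutes {..<n}. of_nat (a (\<sigma> j)) * (\<i> * of_nat ((a \<circ> \<sigma>) j) * monomial n (a \<circ> \<sigma>) z))"
    by (rule ang_deriv_sum, rule ang_deriv_linear[OF bounded_linear_mult_right], rule ang_deriv_monomial[OF assms])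
  then show ?thesis
    by (simp add: dsym_def[abs_def] ddsym_def sum_distrib_left mult_ac)
qed

text \<open>A class stable under algebraic operations in which integrability is automatic.
  Boundedness is required only on the unit torus, which carries the measure, since polynomials are
  in general unbounded elsewhere. Continuity serves the fundamental theorem of calculus in one
  angle, and measurability is recorded separately because it refers to the product
  sigma-algebra.\<close>

definition tame :: "nat \<Rightarrow> (config \<Rightarrow> 'b::real_normed_vector) \<Rightarrow> bool" where
  "tame n F \<longleftrightarrow> continuous_on UNIV F \<and> F \<in> borel_measurable (torus n) \<and>
     (\<exists>C. \<forall>z. (\<forall>j<n. cmod (z j) = 1) \<longrightarrow> norm (F z) \<le> C)"

lemma tame_const: "tame n (\<lambda>z. c)"
  by (auto simp: tame_def)

lemma tame_coordinate: "i < n \<Longrightarrow> tame n (\<lambda>z. z i)"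
  unfolding tame_def by (intro conjI exI[of _ 1] continuous_on_product_coordinates borel_measurable_coordinate) auto

lemma tame_add:
  fixes F G :: "config \<Rightarrow> 'b::{real_normed_vector, second_countable_topology}"
  assumes "tame n F" "tame n G"
  shows "tame n (\<lambda>z. F z + G z)"
proof -
  obtain C D where C: "\<And>z. (\<forall>j<n. cmod (z j) = 1) \<Longrightarrow> norm (F z) \<le> C"
    and D: "\<And>z. (\<forall>j<n. cmod (z j) = 1) \<Longrightarrow> norm (G z) \<le> D"
    using assms unfolding tame_def by blast
  have "norm (F z + G z) \<le> C + D" if "\<forall>j<n. cmod (z j) = 1" for z
    using norm_add_rule_thm[OF C[OF that] D[OF that]] .
  then show ?thesis
    using assms unfolding tame_def by (auto intro!: continuous_intros)
qed

lemma tame_mult: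
  fixes F G :: "config \<Rightarrow> 'b::{real_normed_algebra, second_countable_topology}"
  assumes "tame n F" "tame n G"
  shows "tame n (\<lambda>z. F z * G z)"
proof -
  obtain C D where C: "\<And>z. (\<forall>j<n. cmod (z j) = 1) \<Longrightarrow> norm (F z) \<le> C"
    and D: "\<And>z. (\<forall>j<n. cmod (z j) = 1) \<Longrightarrow> norm (G z) \<le> D"
    using assms unfolding tame_def by blast
  have "norm (F z * G z) \<le> C * D" if "\<forall>j<n. cmod (z j) = 1" for z
    by (rule order_trans[OF norm_mult_ineq mult_mono'[OF C[OF that] D[OF that]]]) auto
  then show ?thesis
    using assms unfolding tame_def by (auto intro!: continuous_intros)
qed

lemma tame_sum:
  fixes F :: "'i \<Rightarrow> config \<Rightarrow> 'b::{real_normed_vector, second_countable_topology}"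
  assumes "\<And>i. i \<in> A \<Longrightarrow> tame n (F i)"
  shows "tame n (\<lambda>z. \<Sum>i\<in>A. F i z)"
  using assms by (induction A rule: infinite_finite_induct) (auto intro: tame_add tame_const)

lemma tame_prod:
  fixes F :: "'i \<Rightarrow> config \<Rightarrow> 'b::{real_normed_field, second_countable_topology}"
  assumes "\<And>i. i \<in> A \<Longrightarrow> tame n (F i)"
  shows "tame n (\<lambda>z. \<Prod>i\<in>A. F i z)"
  using assms by (induction A rule: infinite_finite_induct) (auto intro: tame_mult tame_const)

text \<open>The closed set S keeps the argument away from singularities; it is \<open>{e..}\<close>
  for the inverse and the logarithm. Its intersection with a ball is compact, whence the
  bound.\<close>

lemma tame_compose_on:
  fixes G :: "config \<Rightarrow> 'b::euclidean_space" and f :: "'b \<Rightarrow> 'c::real_normed_vector"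
  assumes "tame n G" "closed S" "\<And>z. G z \<in> S" "continuous_on S f"
  shows "tame n (\<lambda>z. f (G z))"
proof -
  obtain C where C: "\<And>z. (\<forall>j<n. cmod (z j) = 1) \<Longrightarrow> norm (G z) \<le> C"
    using assms unfolding tame_def by blast
  have "compact (f ` (S \<inter> cball 0 C))"
    using assms by (intro compact_continuous_image) (auto intro: continuous_on_subset closed_Int_compact)
  then have "bounded (f ` (S \<inter> cball 0 C))"
    by (rule compact_imp_bounded)
  then obtain D where D: "\<And>y. y \<in> f ` (S \<inter> cball 0 C) \<Longrightarrow> norm y \<le> D"
    unfolding bounded_iff by blast
  have "norm (f (G z)) \<le> D" if "\<forall>j<n. cmod (z j) = 1" for z
    using C[OF that] assms(3) by (intro D imageI) (simp add: dist_norm)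
  have "(\<lambda>z. f (G z)) \<in> borel_measurable (torus n)"
    using assms by (intro measurable_compose[OF _ borel_measurable_continuous_on_restrict[OF assms(4)]]
      measurable_restrict_space2) (auto simp: tame_def)
  moreover have "continuous_on UNIV (\<lambda>z. f (G z))"
    using assms by (intro continuous_on_compose2[OF assms(4)]) (auto simp: tame_def)
  ultimately show ?thesis
    using \<open>\<And>z. \<forall>j<n. cmod (z j) = 1 \<Longrightarrow> norm (f (G z)) \<le> D\<close>
    unfolding tame_def by (intro conjI exI[of _ D]) auto
qed

lemma tame_compose:
  fixes G :: "config \<Rightarrow> 'b::euclidean_space" and f :: "'b \<Rightarrow> 'c::real_normed_vector"
  assumes "continuous_on UNIV f" "tame n G"
  shows "tame n (\<lambda>z. f (G z))"
  using assms by (intro tame_compose_on[of n G UNIV f]) auto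

lemma tame_linear:
  fixes G :: "config \<Rightarrow> 'b::euclidean_space"
  assumes "bounded_linear f" "tame n G"
  shows "tame n (\<lambda>z. f (G z))"
  using assms by (intro tame_compose[of f]) (simp_all add: linear_continuous_on)

lemmas tame_Re = tame_linear[OF bounded_linear_Re]
lemmas tame_Im = tame_linear[OF bounded_linear_Im]
lemmas tame_cnj = tame_linear[OF bounded_linear_cnj]

lemma tame_uminus:
  fixes G :: "config \<Rightarrow> 'b::euclidean_space"
  assumes "tame n G"
  shows "tame n (\<lambda>z. - G z)"
  by (rule tame_compose[OF _ assms]) (intro continuous_intros)

lemma tame_norm:
  fixes G :: "config \<Rightarrow> 'b::euclidean_space"
  assumes "tame n G"
  shows "tame n (\<lambda>z. norm (G z))"
  by (rule tame_compose[OF _ assms]) (intro continuous_intros)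

lemma tame_diff:
  fixes F G :: "config \<Rightarrow> 'b::euclidean_space"
  assumes "tame n F" "tame n G"
  shows "tame n (\<lambda>z. F z - G z)"
  using tame_add[OF assms(1) tame_uminus[OF assms(2)]] by simp

lemma tame_power:
  fixes F :: "config \<Rightarrow> 'b::{real_normed_field, euclidean_space}"
  assumes "tame n F"
  shows "tame n (\<lambda>z. F z ^ m)"
  by (rule tame_compose[OF _ assms]) (intro continuous_intros)

lemma tame_monomial: "tame n (monomial n b)"
  unfolding monomial_def[abs_def] by (intro tame_prod tame_power tame_coordinate) auto

lemma tame_msym: "tame n (msym n a)"
  unfolding msym_def[abs_def] by (intro tame_sum tame_monomial)

lemma tame_dsym: "tame n (dsym j n a)"
  unfolding dsym_def[abs_def] by (intro tame_sum tame_monomial tame_mult tame_const)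

lemma tame_ddsym: "tame n (ddsym j n a)"
  unfolding ddsym_def[abs_def] by (intro tame_sum tame_monomial tame_mult tame_const)

lemma tame_pair_quotient: "tame n (pair_quotient j k n a)"
  unfolding pair_quotient_def[abs_def] Let_def by (intro tame_sum tame_monomial tame_mult tame_const)

lemmas tame_intros = tame_const tame_coordinate tame_add tame_mult tame_sum tame_Re tame_Im tame_cnj
  tame_uminus tame_norm tame_diff tame_power tame_monomial tame_msym tame_dsym tame_ddsym tame_pair_quotient

lemma integrable_tame:
  fixes F :: "config \<Rightarrow> 'b::{banach, second_countable_topology}"
  assumes "tame n F"
  shows "integrable (torus n) F"
proof -
  obtain C where C: "\<And>z. (\<forall>j<n. cmod (z j) = 1) \<Longrightarrow> norm (F z) \<le> C"
    using assms unfolding tame_def by blast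
  show ?thesis
  proof (rule torus.integrable_const_bound)
    show "AE z in torus n. norm (F z) \<le> C"
      using AE_torus[of n] by eventually_elim (rule C)
    show "F \<in> borel_measurable (torus n)"
      using assms unfolding tame_def by blast
  qed
qed

text \<open>For \<open>\<beta> \<le> 1\<close> the weight is not differentiable where points collide, so integrations by parts are done with
  this regularization. Its logarithmic derivative stays bounded after symmetrization, because
  \<open>dsym j n a - dsym k n a\<close> vanishes where \<open>z j = z k\<close>.\<close>

definition reg_weight :: "real \<Rightarrow> real \<Rightarrow> nat \<Rightarrow> config \<Rightarrow> real" where
  "reg_weight \<beta> e n z = (\<Prod>k<n. \<Prod>l<k. ((cmod (z l - z k))\<^sup>2 + e) powr (\<beta> / 2))"

abbreviation chord_deriv :: "nat \<Rightarrow> nat \<Rightarrow> nat \<Rightarrow> config \<Rightarrow> complex" where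
  "chord_deriv i l k z \<equiv> (if l = i then \<i> * z l else 0) - (if k = i then \<i> * z k else 0)"

definition reg_log_deriv :: "real \<Rightarrow> real \<Rightarrow> nat \<Rightarrow> nat \<Rightarrow> config \<Rightarrow> real" where
  "reg_log_deriv \<beta> e n i z = (\<Sum>k<n. \<Sum>l<k. \<beta> / 2 * (inverse ((cmod (z l - z k))\<^sup>2 + e) *
     (2 * Re (chord_deriv i l k z * cnj (z l - z k)))))"

text \<open>Positive e makes the logarithms available, through which the derivative of the double
  product becomes a double sum.\<close>

lemma reg_weight_exp:
  assumes "0 < e"
  shows "reg_weight \<beta> e n = (\<lambda>z. exp (\<Sum>k<n. \<Sum>l<k. \<beta> / 2 * ln ((cmod (z l - z k))\<^sup>2 + e)))"
proof
  fix z :: "nat \<Rightarrow> complex"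
  have "(cmod (z l - z k))\<^sup>2 + e \<noteq> 0" for l k
    using assms by (smt (verit) zero_le_power2)
  then show "reg_weight \<beta> e n z = exp (\<Sum>k<n. \<Sum>l<k. \<beta> / 2 * ln ((cmod (z l - z k))\<^sup>2 + e))"
    by (simp add: reg_weight_def powr_def exp_sum)
qed

lemma ang_deriv_norm_square:
  "ang_deriv i (\<lambda>z. (cmod (z l - z k))\<^sup>2)
    (\<lambda>z. 2 * Re (chord_deriv i l k z * cnj (z l - z k)))"
proof -
  define d where "d = (\<lambda>z. (if l = i then \<i> * z l else 0) - (if k = i then \<i> * z k else 0))"
  have d: "ang_deriv i (\<lambda>z. z l - z k) d"
    unfolding d_def by (intro ang_deriv_diff ang_deriv_coordinate)
  have "ang_deriv i (\<lambda>z. Re ((z l - z k) * cnj (z l - z k)))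
      (\<lambda>z. Re ((z l - z k) * cnj (d z) + d z * cnj (z l - z k)))"
    by (intro ang_deriv_linear[OF bounded_linear_Re] ang_deriv_mult
        ang_deriv_linear[OF bounded_linear_cnj] d)
  moreover have "Re ((z l - z k) * cnj (z l - z k)) = (cmod (z l - z k))\<^sup>2" for z :: "nat \<Rightarrow> complex"
    by (simp add: cmod_power2) (simp add: power2_eq_square algebra_simps)
  moreover have "Re ((z l - z k) * cnj (d z) + d z * cnj (z l - z k)) = 2 * Re (d z * cnj (z l - z k))" for z
    by (simp add: algebra_simps)
  ultimately show ?thesis
    by (simp only: d_def)
qed

lemma ang_deriv_reg_weight:
  assumes "0 < e"
  shows "ang_deriv i (reg_weight \<beta> e n) (\<lambda>z. reg_weight \<beta> e n z * reg_log_deriv \<beta> e n i z)"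
  unfolding reg_weight_exp[OF assms] reg_log_deriv_def
proof (rule ang_deriv_compose_real[where f = exp and f' = exp])
  show "(exp has_real_derivative exp x) (at x)" for x :: real
    by (rule DERIV_exp)
  have "ang_deriv i (\<lambda>z. ln ((cmod (z l - z k))\<^sup>2 + e)) (\<lambda>z. inverse ((cmod (z l - z k))\<^sup>2 + e) *
     (2 * Re (chord_deriv i l k z * cnj (z l - z k))))" for k l
  proof (rule ang_deriv_compose_real[OF _ ang_deriv_norm_square])
    fix z :: "nat \<Rightarrow> complex"
    have "0 < (cmod (z l - z k))\<^sup>2 + e"
      using assms by (smt (verit) zero_le_power2)
    then show "((\<lambda>y. ln (y + e)) has_real_derivative inverse ((cmod (z l - z k))\<^sup>2 + e)) (at ((cmod (z l - z k))\<^sup>2))"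
      by (auto intro!: derivative_eq_intros simp: divide_inverse)
  qed
  then show "ang_deriv i (\<lambda>z. \<Sum>k<n. \<Sum>l<k. \<beta> / 2 * ln ((cmod (z l - z k))\<^sup>2 + e))
     (\<lambda>z. \<Sum>k<n. \<Sum>l<k. \<beta> / 2 * (inverse ((cmod (z l - z k))\<^sup>2 + e) *
     (2 * Re (chord_deriv i l k z * cnj (z l - z k)))))"
    by (intro ang_deriv_sum ang_deriv_linear[OF bounded_linear_mult_right])
qed

lemma tame_inverse_reg:
  assumes "0 < e" "l < n" "k < n"
  shows "tame n (\<lambda>z. inverse ((cmod (z l - z k))\<^sup>2 + e))"
proof (rule tame_compose_on[where S = "{e..}" and f = inverse])
  show "tame n (\<lambda>z. (cmod (z l - z k))\<^sup>2 + e)"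
    using assms by (intro tame_intros)
  show "continuous_on {e..} inverse"
    using assms by (intro continuous_intros) auto
qed auto

lemma tame_reg_log_deriv:
  assumes "0 < e"
  shows "tame n (reg_log_deriv \<beta> e n i)"
proof -
  have *: "tame n (\<lambda>z. if l = i then \<i> * z l else 0)" if "l < n" for l
    using that by (cases "l = i") (auto intro: tame_intros)
  show ?thesis
    unfolding reg_log_deriv_def[abs_def] using assms
    by (intro tame_sum tame_mult tame_const tame_inverse_reg tame_Re tame_diff tame_cnj tame_coordinate *) auto
qed

lemma tame_reg_weight:
  assumes "0 < e"
  shows "tame n (reg_weight \<beta> e n)"
proof -
  have *: "tame n (\<lambda>z. ln ((cmod (z l - z k))\<^sup>2 + e))" if "k < n" "l < k" for k l
  proof (rule tame_compose_on[where S = "{e..}" and f = ln])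
    show "tame n (\<lambda>z. (cmod (z l - z k))\<^sup>2 + e)"
      using that by (intro tame_intros) auto
    show "continuous_on {e..} ln"
      using assms by (intro continuous_intros) auto
  qed auto
  show ?thesis
    unfolding reg_weight_exp[OF assms]
    by (rule tame_compose[where f = exp], intro continuous_intros) (intro tame_sum tame_mult tame_const *, auto)
qed

lemma reg_weight_nonneg: "0 \<le> reg_weight \<beta> e n z"
  unfolding reg_weight_def by (intro prod_nonneg) auto

lemma reg_weight_mono:
  assumes "0 \<le> e" "e \<le> e'" "0 \<le> \<beta>"
  shows "reg_weight \<beta> e n z \<le> reg_weight \<beta> e' n z"
  unfolding reg_weight_def using assms by (intro prod_mono conjI prod_nonneg powr_mono2) auto

lemma reg_weight_0: "reg_weight \<beta> 0 n z = vandermonde_weight \<beta> n z"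
proof -
  have "(x\<^sup>2 + 0) powr (\<beta> / 2) = x powr \<beta>" if "0 \<le> x" for x :: real
  proof (cases "x = 0")
    case False
    then have "x\<^sup>2 = x powr 2"
      using that by (simp add: powr_numeral)
    then show ?thesis
      by (simp add: powr_powr)
  qed auto
  then show ?thesis
    unfolding reg_weight_def vandermonde_weight_def by simp
qed

text \<open>Positivity of \<beta> makes \<open>powr\<close> continuous at the base 0, which is what
  the limit requires at collisions.\<close>

lemma tendsto_reg_weight:
  assumes "0 < \<beta>"
  shows "(\<lambda>m. reg_weight \<beta> (1 / real (Suc m)) n z) \<longlonglongrightarrow> vandermonde_weight \<beta> n z"
  unfolding reg_weight_0[symmetric] unfolding reg_weight_def
proof (intro tendsto_prod tendsto_powr' tendsto_add tendsto_const)
  show "(\<lambda>m. 1 / real (Suc m)) \<longlonglongrightarrow> 0"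
    using lim_inverse_n' by (rule LIMSEQ_Suc)
qed (use assms in auto)

lemma vandermonde_weight_nonneg: "0 \<le> vandermonde_weight \<beta> n z"
  unfolding vandermonde_weight_def by (intro prod_nonneg) auto

lemma vandermonde_weight_eq_0:
  assumes "k < n" "l < k" "z l = z k"
  shows "vandermonde_weight \<beta> n z = 0"
proof -
  have "(\<Prod>j<k. cmod (z j - z k) powr \<beta>) = 0"
    using assms by (intro prod_zero) auto
  then show ?thesis
    unfolding vandermonde_weight_def using assms(1) by (intro prod_zero) (simp, rule bexI[of _ k], auto)
qed

text \<open>This is the real part of the j-th angular derivative of \<open>msym n a\<close> times
  the conjugate of \<open>msym n b\<close>, since that derivative is the imaginary unit times
  \<open>dsym\<close>. The divergence of the weighted field yields Green's identity.\<close>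

definition vfield :: "nat \<Rightarrow> nat \<Rightarrow> (nat \<Rightarrow> nat) \<Rightarrow> (nat \<Rightarrow> nat) \<Rightarrow> config \<Rightarrow> real" where
  "vfield j n a b z = - Im (dsym j n a z * cnj (msym n b z))"

definition dvfield :: "nat \<Rightarrow> nat \<Rightarrow> (nat \<Rightarrow> nat) \<Rightarrow> (nat \<Rightarrow> nat) \<Rightarrow> config \<Rightarrow> real" where
  "dvfield j n a b z = Re (dsym j n a z * cnj (dsym j n b z)) - Re (ddsym j n a z * cnj (msym n b z))"

lemma ang_deriv_vfield:
  assumes "j < n"
  shows "ang_deriv j (vfield j n a b) (dvfield j n a b)"
proof -
  have "ang_deriv j (\<lambda>z. - Im (dsym j n a z * cnj (msym n b z)))
     (\<lambda>z. - Im (dsym j n a z * cnj (\<i> * dsym j n b z) + \<i> * ddsym j n a z * cnj (msym n b z)))"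
    using bounded_linear_compose[OF bounded_linear_minus[OF bounded_linear_ident] bounded_linear_Im]
    by (rule ang_deriv_linear) (intro ang_deriv_mult ang_deriv_linear[OF bounded_linear_cnj]
      ang_deriv_dsym ang_deriv_msym assms)
  then show ?thesis
    by (simp add: vfield_def[abs_def] dvfield_def[abs_def] algebra_simps)
qed

lemma tame_vfield: "tame n (vfield j n a b)"
  unfolding vfield_def[abs_def] by (intro tame_intros)

lemma tame_dvfield: "tame n (dvfield j n a b)"
  unfolding dvfield_def[abs_def] by (intro tame_intros)

definition reg_interaction :: "real \<Rightarrow> real \<Rightarrow> nat \<Rightarrow> (nat \<Rightarrow> nat) \<Rightarrow> (nat \<Rightarrow> nat) \<Rightarrow> config \<Rightarrow> real" where
  "reg_interaction \<beta> e n a b z = (\<Sum>k<n. \<Sum>l<k. \<beta> / 2 * (inverse ((cmod (z l - z k))\<^sup>2 + e) *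
     (2 * Im (z l * cnj (z k)) * - Im ((z l - z k) * pair_quotient l k n a z * cnj (msym n b z)))))"

text \<open>The pair l, k acts only on the angles l and k, with opposite signs, so the field enters
  through the difference of two components. \<open>dsym_diff\<close> extracts from it the factor
  \<open>z l - z k\<close> that compensates the nearly singular denominator.\<close>

lemma sum_reg_log_deriv_vfield:
  "(\<Sum>i<n. reg_log_deriv \<beta> e n i z * vfield i n a b z) = reg_interaction \<beta> e n a b z"
proof -
  let ?D = "\<lambda>l k. inverse ((cmod (z l - z k))\<^sup>2 + e)"
  let ?R = "\<lambda>i l k. Re (chord_deriv i l k z * cnj (z l - z k))"
  have halve: "\<beta> * d * u * x = \<beta> / 2 * (d * (2 * u * x))" for d u x
    by simp
  have R: "?R i l k = (if l = i then Im (z l * cnj (z k)) else 0) - (if k = i then Im (z l * cnj (z k)) else 0)"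
    if "l \<noteq> k" for i l k
    using that by (auto simp: algebra_simps)
  have "(\<Sum>i<n. reg_log_deriv \<beta> e n i z * vfield i n a b z)
    = (\<Sum>i<n. \<Sum>k<n. \<Sum>l<k. \<beta> / 2 * (?D l k * (2 * ?R i l k)) * vfield i n a b z)"
    unfolding reg_log_deriv_def sum_distrib_right ..
  also have "\<dots> = (\<Sum>k<n. \<Sum>i<n. \<Sum>l<k. \<beta> / 2 * (?D l k * (2 * ?R i l k)) * vfield i n a b z)"
    by (rule sum.swap)
  also have "\<dots> = (\<Sum>k<n. \<Sum>l<k. \<Sum>i<n. \<beta> / 2 * (?D l k * (2 * ?R i l k)) * vfield i n a b z)"
    by (rule sum.cong[OF refl], rule sum.swap)
  also have "\<dots> = reg_interaction \<beta> e n a b z"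
    unfolding reg_interaction_def
  proof (intro sum.cong refl)
    fix k l assume "k \<in> {..<n}" "l \<in> {..<k}"
    then have kl: "k < n" "l < n" "l \<noteq> k" by auto
    have "(\<Sum>i<n. \<beta> / 2 * (?D l k * (2 * ?R i l k)) * vfield i n a b z)
      = (\<Sum>i<n. \<beta> * ?D l k * Im (z l * cnj (z k)) * (if l = i then vfield i n a b z else 0)
          - \<beta> * ?D l k * Im (z l * cnj (z k)) * (if k = i then vfield i n a b z else 0))"
      unfolding R[OF kl(3)] by (intro sum.cong refl) (auto simp: algebra_simps)
    also have "\<dots> = \<beta> * ?D l k * Im (z l * cnj (z k)) * (vfield l n a b z - vfield k n a b z)"
      using kl by (simp add: sum_subtractf sum_distrib_left[symmetric] right_diff_distrib)
    also have "vfield l n a b z - vfield k n a b z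
        = - Im ((dsym l n a z - dsym k n a z) * cnj (msym n b z))"
      by (simp add: vfield_def left_diff_distrib)
    also have "\<dots> = - Im ((z l - z k) * pair_quotient l k n a z * cnj (msym n b z))"
      using kl by (simp add: dsym_diff)
    also have "\<beta> * ?D l k * Im (z l * cnj (z k)) * - Im ((z l - z k) * pair_quotient l k n a z * cnj (msym n b z))
      = \<beta> / 2 * (?D l k * (2 * Im (z l * cnj (z k)) * - Im ((z l - z k) * pair_quotient l k n a z * cnj (msym n b z))))"
      using halve .
    finally show "(\<Sum>i<n. \<beta> / 2 * (?D l k * (2 * ?R i l k)) * vfield i n a b z)
      = \<beta> / 2 * (?D l k * (2 * Im (z l * cnj (z k)) * - Im ((z l - z k) * pair_quotient l k n a z * cnj (msym n b z))))" .
  qed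
  finally show ?thesis .
qed

lemma tame_reg_interaction:
  assumes "0 < e"
  shows "tame n (reg_interaction \<beta> e n a b)"
  unfolding sum_reg_log_deriv_vfield[symmetric]
  by (intro tame_sum tame_mult tame_reg_log_deriv tame_vfield assms)

text \<open>Divergence theorem on the torus for the regularized weight times the field: each partial
  derivative integrates to zero.\<close>

lemma integral_reg:
  assumes "0 < e"
  shows "(\<integral>z. reg_weight \<beta> e n z * (reg_interaction \<beta> e n a b z + (\<Sum>j<n. dvfield j n a b z)) \<partial>torus n) = 0"
proof -
  let ?g = "\<lambda>j z. reg_weight \<beta> e n z * dvfield j n a b z + reg_weight \<beta> e n z * reg_log_deriv \<beta> e n j z * vfield j n a b z"
  have tame: "tame n (?g j)" for j
    by (intro tame_add tame_mult tame_reg_weight tame_dvfield tame_reg_log_deriv tame_vfield assms)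
  have "(\<integral>z. ?g j z \<partial>torus n) = 0" if "j < n" for j
  proof (rule integral_ang_deriv[OF that])
    show "ang_deriv j (\<lambda>z. reg_weight \<beta> e n z * vfield j n a b z) (?g j)"
      by (intro ang_deriv_mult ang_deriv_reg_weight ang_deriv_vfield assms that)
  qed (use tame[of j] in \<open>auto simp: tame_def intro: integrable_tame tame\<close>)
  then have "0 = (\<Sum>j<n. \<integral>z. ?g j z \<partial>torus n)"
    by simp
  also have "\<dots> = (\<integral>z. (\<Sum>j<n. ?g j z) \<partial>torus n)"
    by (rule Bochner_Integration.integral_sum[symmetric]) (intro integrable_tame tame)
  also have "\<dots> = (\<integral>z. reg_weight \<beta> e n z * (reg_interaction \<beta> e n a b z + (\<Sum>j<n. dvfield j n a b z)) \<partial>torus n)"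
    by (simp add: sum_reg_log_deriv_vfield[symmetric] sum_distrib_left sum.distrib algebra_simps)
  finally show ?thesis by simp
qed

section \<open>Gram and Dirichlet forms, and removal of the regularization\<close>

definition gram :: "real \<Rightarrow> nat \<Rightarrow> (nat \<Rightarrow> nat) \<Rightarrow> (nat \<Rightarrow> nat) \<Rightarrow> real" where
  "gram \<beta> n a b = (\<integral>z. vandermonde_weight \<beta> n z * Re (msym n a z * cnj (msym n b z)) \<partial>torus n)"

text \<open>The Dirichlet form; the imaginary units of the two derivatives cancel. Like
  \<open>gram\<close> it is not divided by the total mass of the weight, since only homogeneous
  inequalities between the two are used.\<close>

definition energy :: "real \<Rightarrow> nat \<Rightarrow> (nat \<Rightarrow> nat) \<Rightarrow> (nat \<Rightarrow> nat) \<Rightarrow> real" where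
  "energy \<beta> n a b = (\<integral>z. vandermonde_weight \<beta> n z * (\<Sum>j<n. Re (dsym j n a z * cnj (dsym j n b z))) \<partial>torus n)"

lemma borel_measurable_vandermonde_weight [measurable]: "vandermonde_weight \<beta> n \<in> borel_measurable (torus n)"
proof -
  note borel_measurable_coordinate [measurable]
  show ?thesis
    unfolding vandermonde_weight_def[abs_def] by measurable
qed

text \<open>The weight is dominated by its regularization with e = 1, which is bounded on the unit
  torus.\<close>

lemma integrable_vandermonde_tame:
  fixes F :: "config \<Rightarrow> real"
  assumes "0 \<le> \<beta>" "tame n F"
  shows "integrable (torus n) (\<lambda>z. vandermonde_weight \<beta> n z * F z)"
proof (rule Bochner_Integration.integrable_bound)
  show "integrable (torus n) (\<lambda>z. reg_weight \<beta> 1 n z * F z)"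
    by (intro integrable_tame tame_mult tame_reg_weight assms) simp
  have [measurable]: "F \<in> borel_measurable (torus n)"
    using assms by (simp add: tame_def)
  show "(\<lambda>z. vandermonde_weight \<beta> n z * F z) \<in> borel_measurable (torus n)"
    by measurable
  show "AE z in torus n. norm (vandermonde_weight \<beta> n z * F z) \<le> norm (reg_weight \<beta> 1 n z * F z)"
    using reg_weight_mono[of 0 1 \<beta> n] assms(1)
    by (auto simp: reg_weight_0 abs_mult vandermonde_weight_nonneg reg_weight_nonneg intro!: mult_right_mono)
qed

definition interaction :: "real \<Rightarrow> nat \<Rightarrow> (nat \<Rightarrow> nat) \<Rightarrow> (nat \<Rightarrow> nat) \<Rightarrow> config \<Rightarrow> real" where
  "interaction \<beta> n a b z = (\<Sum>k<n. \<Sum>l<k. \<beta> / 2 * - Re ((z l + z k) * pair_quotient l k n a z * cnj (msym n b z)))"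

lemma Re_of_real_mult: "Re (of_real r * w) = r * Re w" and Im_of_real_mult: "Im (of_real r * w) = r * Im w"
  by simp_all

lemma Re_of_nat_mult: "Re (of_nat m * w) = of_nat m * Re w"
  by simp

lemma Im_cross_le:
  assumes "cmod v = 1"
  shows "\<bar>Im (u * cnj v)\<bar> \<le> cmod (u - v)"
proof -
  have "Im (u * cnj v) = Im ((u - v) * cnj v)"
    by (simp add: algebra_simps)
  then have "\<bar>Im (u * cnj v)\<bar> \<le> cmod ((u - v) * cnj v)"
    using abs_Im_le_cmod by metis
  then show ?thesis
    using assms by (simp add: norm_mult)
qed

text \<open>The half-angle formula for the cotangent with its denominators multiplied out:
  \<open>2 * Im (u * cnj v)\<close> divided by the squared chord is the cotangent of half the angle
  from v to u.\<close>

lemma unit_cross_identity: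
  assumes "cmod u = 1" "cmod v = 1"
  shows "of_real (2 * Im (u * cnj v)) * (u - v) = \<i> * (u + v) * of_real ((cmod (u - v))\<^sup>2)"
proof -
  have u: "u * cnj u = 1" and v: "v * cnj v = 1"
    using assms by (simp_all add: complex_norm_square[symmetric])
  have "of_real (2 * Im (u * cnj v)) = - \<i> * (u * cnj v - cnj u * v)"
    by (simp add: complex_eq_iff)
  also have "\<dots> = \<i> * ((u + v) * (cnj u - cnj v))"
    using u v by (simp add: algebra_simps)
  finally have "of_real (2 * Im (u * cnj v)) * (u - v) = \<i> * (u + v) * ((u - v) * cnj (u - v))"
    by (simp only: complex_cnj_diff mult_ac)
  then show ?thesis
    by (simp only: complex_norm_square)
qed

text \<open>The cross term and the factor \<open>z l - z k\<close> are each at most the chord d, so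
  the numerator is of order d^2 and is absorbed by the denominator d^2 + e. The bound is free of e,
  hence usable for dominated convergence.\<close>

lemma reg_interaction_bound:
  assumes "\<forall>j<n. cmod (z j) = 1" "0 < e" "0 \<le> \<beta>"
  shows "\<bar>reg_interaction \<beta> e n a b z\<bar>
    \<le> (\<Sum>k<n. \<Sum>l<k. \<beta> / 2 * (2 * cmod (pair_quotient l k n a z * cnj (msym n b z))))"
  unfolding reg_interaction_def
proof (intro order_trans[OF sum_abs] sum_mono)
  fix k l assume "k \<in> {..<n}" "l \<in> {..<k}"
  then have kl: "cmod (z l) = 1" "cmod (z k) = 1"
    using assms(1) by auto
  define d where "d = cmod (z l - z k)"
  define q where "q = pair_quotient l k n a z * cnj (msym n b z)"
  have pos: "0 < d\<^sup>2 + e"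
    using assms(2) by (smt (verit) zero_le_power2)
  have "\<bar>Im ((z l - z k) * q)\<bar> \<le> d * cmod q"
    using abs_Im_le_cmod[of "(z l - z k) * q"] by (simp add: norm_mult d_def)
  then have "\<bar>2 * Im (z l * cnj (z k)) * - Im ((z l - z k) * q)\<bar> \<le> (2 * d) * (d * cmod q)"
    unfolding abs_mult abs_minus_cancel using Im_cross_le[OF kl(2), of "z l"]
    by (intro mult_mono) (auto simp: d_def)
  also have "\<dots> \<le> (d\<^sup>2 + e) * (2 * cmod q)"
    using mult_right_mono[of "d\<^sup>2" "d\<^sup>2 + e" "2 * cmod q"] assms(2) by (simp add: power2_eq_square mult_ac)
  finally have "inverse (d\<^sup>2 + e) * \<bar>2 * Im (z l * cnj (z k)) * - Im ((z l - z k) * q)\<bar> \<le> 2 * cmod q"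
    using pos by (simp add: field_simps)
  then have "\<beta> / 2 * (inverse (d\<^sup>2 + e) * \<bar>2 * Im (z l * cnj (z k)) * - Im ((z l - z k) * q)\<bar>) \<le> \<beta> / 2 * (2 * cmod q)"
    using assms(3) by (intro mult_left_mono) auto
  moreover have "\<bar>\<beta> / 2 * (inverse (d\<^sup>2 + e) * (2 * Im (z l * cnj (z k)) * - Im ((z l - z k) * q)))\<bar>
    = \<beta> / 2 * (inverse (d\<^sup>2 + e) * \<bar>2 * Im (z l * cnj (z k)) * - Im ((z l - z k) * q)\<bar>)"
    using assms(3) pos by (simp only: abs_mult) simp
  ultimately show "\<bar>\<beta> / 2 * (inverse ((cmod (z l - z k))\<^sup>2 + e) *
      (2 * Im (z l * cnj (z k)) * - Im ((z l - z k) * pair_quotient l k n a z * cnj (msym n b z))))\<bar>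
    \<le> \<beta> / 2 * (2 * cmod (pair_quotient l k n a z * cnj (msym n b z)))"
    by (simp add: d_def q_def mult.assoc)
qed

lemma tendsto_reg_interaction:
  assumes "\<forall>j<n. cmod (z j) = 1" and distinct: "\<And>k l. k < n \<Longrightarrow> l < k \<Longrightarrow> z l \<noteq> z k"
  shows "(\<lambda>m. reg_interaction \<beta> (1 / real (Suc m)) n a b z) \<longlonglongrightarrow> interaction \<beta> n a b z"
proof -
  have *: "- Re ((z l + z k) * pair_quotient l k n a z * cnj (msym n b z))
    = inverse ((cmod (z l - z k))\<^sup>2 + 0) *
     (2 * Im (z l * cnj (z k)) * - Im ((z l - z k) * pair_quotient l k n a z * cnj (msym n b z)))"
    if "k < n" "l < k" for k l
  proof -
    define q where "q = pair_quotient l k n a z * cnj (msym n b z)"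
    have "cmod (z l) = 1" "cmod (z k) = 1"
      using that assms(1) by auto
    from unit_cross_identity[OF this]
    have "of_real (2 * Im (z l * cnj (z k))) * (z l - z k) * q = \<i> * (z l + z k) * of_real ((cmod (z l - z k))\<^sup>2) * q"
      by simp
    then have "Im (of_real (2 * Im (z l * cnj (z k))) * ((z l - z k) * q)) = Im (of_real ((cmod (z l - z k))\<^sup>2) * (\<i> * ((z l + z k) * q)))"
      by (simp only: mult_ac)
    then have "2 * Im (z l * cnj (z k)) * Im ((z l - z k) * q) = (cmod (z l - z k))\<^sup>2 * Re ((z l + z k) * q)"
      unfolding Im_of_real_mult by simp
    moreover have "(cmod (z l - z k))\<^sup>2 \<noteq> 0"
      using distinct[OF that] by simp
    ultimately show ?thesis
      unfolding mult.assoc q_def[symmetric] by (simp add: field_simps)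
  qed
  show ?thesis
    unfolding reg_interaction_def interaction_def
  proof (intro tendsto_sum tendsto_mult[OF tendsto_const])
    fix k l assume "k \<in> {..<n}" "l \<in> {..<k}"
    then have kl: "k < n" "l < k" by auto
    show "(\<lambda>m. inverse ((cmod (z l - z k))\<^sup>2 + 1 / real (Suc m)) *
     (2 * Im (z l * cnj (z k)) * - Im ((z l - z k) * pair_quotient l k n a z * cnj (msym n b z))))
      \<longlonglongrightarrow> - Re ((z l + z k) * pair_quotient l k n a z * cnj (msym n b z))"
      unfolding *[OF kl]
    proof (intro tendsto_mult tendsto_const tendsto_inverse tendsto_add)
      show "(\<lambda>m. 1 / real (Suc m)) \<longlonglongrightarrow> 0"
        using lim_inverse_n' by (rule LIMSEQ_Suc)
    qed (use distinct[OF kl] in auto)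
  qed
qed

lemma integral_interaction:
  assumes "0 < \<beta>"
  shows "(\<integral>z. vandermonde_weight \<beta> n z * (interaction \<beta> n a b z + (\<Sum>j<n. dvfield j n a b z)) \<partial>torus n) = 0"
proof -
  define D where "D = (\<lambda>z. \<Sum>j<n. dvfield j n a b z)"
  define S where "S = (\<lambda>z. \<Sum>k<n. \<Sum>l<k. \<beta> / 2 * (2 * cmod (pair_quotient l k n a z * cnj (msym n b z))))"
  define G where "G = (\<lambda>z. S z + \<bar>D z\<bar>)"
  let ?e = "\<lambda>m. 1 / real (Suc m)"
  let ?f = "\<lambda>m z. reg_weight \<beta> (?e m) n z * (reg_interaction \<beta> (?e m) n a b z + D z)"
  have niceD: "tame n D"
    unfolding D_def by (intro tame_sum tame_dvfield)
  have niceG: "tame n G"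
    unfolding G_def S_def using tame_norm[OF niceD]
    by (intro tame_add tame_sum tame_mult tame_const tame_norm tame_cnj tame_msym tame_pair_quotient) simp
  have bound: "\<bar>reg_interaction \<beta> (?e m) n a b z + D z\<bar> \<le> G z" if "\<forall>j<n. cmod (z j) = 1" for z m
    using reg_interaction_bound[OF that, of "?e m" \<beta> a b] assms by (auto simp: G_def S_def)
  have "(\<lambda>m. \<integral>z. ?f m z \<partial>torus n) \<longlonglongrightarrow> (\<integral>z. vandermonde_weight \<beta> n z * (interaction \<beta> n a b z + D z) \<partial>torus n)"
  proof (rule integral_dominated_convergence)
    show "integrable (torus n) (\<lambda>z. reg_weight \<beta> 1 n z * G z)"
      by (intro integrable_tame tame_mult tame_reg_weight niceG) simp
    show "?f m \<in> borel_measurable (torus n)" for m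
      by (intro borel_measurable_integrable integrable_tame tame_mult tame_add tame_reg_weight tame_reg_interaction niceD) simp_all
    have "tame n (interaction \<beta> n a b)"
      unfolding interaction_def[abs_def]
      by (intro tame_sum tame_mult tame_const tame_uminus tame_Re tame_add tame_cnj tame_msym tame_pair_quotient tame_coordinate) auto
    then show "(\<lambda>z. vandermonde_weight \<beta> n z * (interaction \<beta> n a b z + D z)) \<in> borel_measurable (torus n)"
      using niceD assms by (intro borel_measurable_integrable integrable_vandermonde_tame tame_add) auto
    show "AE z in torus n. norm (?f m z) \<le> reg_weight \<beta> 1 n z * G z" for m
      using AE_torus[of n]
    proof eventually_elim
      case (elim z)
      have "\<bar>?f m z\<bar> = reg_weight \<beta> (?e m) n z * \<bar>reg_interaction \<beta> (?e m) n a b z + D z\<bar>"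
        by (simp add: abs_mult reg_weight_nonneg)
      also have "\<dots> \<le> reg_weight \<beta> 1 n z * G z"
        using assms by (intro mult_mono bound elim reg_weight_mono reg_weight_nonneg) auto
      finally show ?case by simp
    qed
    show "AE z in torus n. (\<lambda>m. ?f m z) \<longlonglongrightarrow> vandermonde_weight \<beta> n z * (interaction \<beta> n a b z + D z)"
      using AE_torus[of n]
    proof eventually_elim
      case (elim z)
      show ?case
      proof (cases "\<exists>k<n. \<exists>l<k. z l = z k")
        case True
        then have w: "vandermonde_weight \<beta> n z = 0"
          using vandermonde_weight_eq_0 by metis
        \<comment> \<open>At a collision \<open>reg_interaction\<close> need not converge to
          \<open>interaction\<close>; the weight tends to 0 there and absorbs the bounded factor, so
          the limit holds on the diagonals too.\<close>
        have "(\<lambda>m. ?f m z) \<longlonglongrightarrow> 0"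
        proof (rule Lim_null_comparison)
          show "\<forall>\<^sub>F m in sequentially. norm (?f m z) \<le> reg_weight \<beta> (?e m) n z * G z"
            using mult_left_mono[OF bound[OF elim] reg_weight_nonneg]
            by (intro always_eventually allI) (simp add: abs_mult reg_weight_nonneg)
          show "(\<lambda>m. reg_weight \<beta> (?e m) n z * G z) \<longlonglongrightarrow> 0"
            using tendsto_mult[OF tendsto_reg_weight[OF assms, of n z] tendsto_const[of "G z"]] w by simp
        qed
        then show ?thesis
          using w by simp
      next
        case False
        then show ?thesis
          using elim assms by (intro tendsto_intros tendsto_reg_weight tendsto_reg_interaction) auto
      qed
    qed
  qed
  moreover have "(\<integral>z. ?f m z \<partial>torus n) = 0" for m
    unfolding D_def by (rule integral_reg) simp
  ultimately have "(\<lambda>m::nat. 0) \<longlonglongrightarrow> (\<integral>z. vandermonde_weight \<beta> n z * (interaction \<beta> n a b z + D z) \<partial>torus n)"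
    by (simp only:)
  then show ?thesis
    unfolding D_def by (simp only: LIMSEQ_const_iff)
qed

lemma sum_lower_triangle:
  fixes f :: "nat \<Rightarrow> nat \<Rightarrow> complex"
  shows "(\<Sum>k<n. \<Sum>l<n. f k l) = (\<Sum>k<n. \<Sum>l<k. f k l + f l k) + (\<Sum>k<n. f k k)"
proof (induction n)
  case (Suc n)
  have "(\<Sum>k<Suc n. \<Sum>l<Suc n. f k l) = ((\<Sum>k<n. \<Sum>l<n. f k l) + (\<Sum>k<n. f k n)) + ((\<Sum>l<n. f n l) + f n n)"
    by (simp add: sum.distrib)
  then show ?case
    unfolding Suc by (simp add: sum.distrib)
qed simp

lemma pair_quotient_commute:
  assumes "j < n" "k < n"
  shows "(z j + z k) * pair_quotient j k n a z = (z k + z j) * pair_quotient k j n a z"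
proof (cases "j = k")
  case False
  then show ?thesis
    using pair_quotient_sum[of j n k z a] pair_quotient_sum[of k n j z a] assms by (simp add: add.commute)
qed simp

text \<open>The summand is symmetric in the pair, so the triangular sum is half the full one, and
  this half cancels the factor 2 of \<open>sum_pair_quotient\<close>.\<close>

lemma interaction_eq:
  "interaction \<beta> n a b z = - (\<beta> / 2) * (\<Sum>j<n. \<Sum>k<n. real (a j - a k) *
      (\<Sum>r<a j - a k. Re (msym n (squeeze j k r a) z * cnj (msym n b z))))"
proof -
  let ?q = "\<lambda>k l. (z k + z l) * pair_quotient k l n a z"
  have "2 * (\<Sum>k<n. \<Sum>l<k. ?q l k) = (\<Sum>k<n. \<Sum>l<k. ?q k l + ?q l k) + (\<Sum>k<n. ?q k k)"
  proof -
    have "(\<Sum>k<n. ?q k k) = 0"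
      by (simp add: pair_quotient_def)
    moreover have pq: "?q k l + ?q l k = 2 * ?q l k" if "k < n" "l < k" for k l
      using pair_quotient_commute[of k n l z a] that by simp
    moreover have "2 * (\<Sum>k<n. \<Sum>l<k. ?q l k) = (\<Sum>k<n. \<Sum>l<k. ?q k l + ?q l k)"
      unfolding sum_distrib_left by (intro sum.cong refl, intro pq[symmetric]) auto
    ultimately show ?thesis
      by (simp only: add_0_right)
  qed
  also have "\<dots> = (\<Sum>k<n. \<Sum>l<n. ?q k l)"
    by (rule sum_lower_triangle[symmetric])
  finally have *: "(\<Sum>k<n. \<Sum>l<k. ?q l k) = (\<Sum>j<n. \<Sum>k<n. of_nat (a j - a k) * (\<Sum>r<a j - a k. msym n (squeeze j k r a) z))"
    unfolding sum_pair_quotient by simp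
  have "interaction \<beta> n a b z = - (\<beta> / 2) * Re ((\<Sum>k<n. \<Sum>l<k. ?q l k) * cnj (msym n b z))"
    unfolding interaction_def sum_distrib_right Re_sum sum_distrib_left
    by (simp only: mult_minus_left mult_minus_right)
  also have "\<dots> = - (\<beta> / 2) * (\<Sum>j<n. \<Sum>k<n. real (a j - a k) *
      (\<Sum>r<a j - a k. Re (msym n (squeeze j k r a) z * cnj (msym n b z))))"
    unfolding * sum_distrib_right Re_sum sum_distrib_left
    by (simp only: mult.assoc Re_of_nat_mult)
  finally show ?thesis .
qed

text \<open>Green's identity in the family of symmetrized monomials: second derivatives give the sum
  of squares, the interaction gives the squeezes. The coefficients on the right do not depend on b,
  which exhibits the generator as a matrix.\<close>

lemma energy_eq:
  assumes "0 < \<beta>"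
  shows "energy \<beta> n a b = real (\<Sum>j<n. (a j)\<^sup>2) * gram \<beta> n a b
    + \<beta> / 2 * (\<Sum>j<n. \<Sum>k<n. real (a j - a k) * (\<Sum>r<a j - a k. gram \<beta> n (squeeze j k r a) b))"
proof -
  let ?w = "vandermonde_weight \<beta> n"
  let ?m = "\<lambda>c z. Re (msym n c z * cnj (msym n b z))"
  let ?E = "\<lambda>z. \<Sum>j<n. Re (dsym j n a z * cnj (dsym j n b z))"
  have nm: "tame n (?m c)" for c
    by (intro tame_Re tame_mult tame_cnj tame_msym)
  have int: "integrable (torus n) (\<lambda>z. ?w z * F z)" if "tame n F" for F :: "config \<Rightarrow> real"
    using assms that by (intro integrable_vandermonde_tame) auto
  have nE: "tame n ?E"
    by (intro tame_sum tame_Re tame_mult tame_cnj tame_dsym)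
  have "interaction \<beta> n a b z + (\<Sum>j<n. dvfield j n a b z) = ?E z - real (\<Sum>j<n. (a j)\<^sup>2) * ?m a z
     - \<beta> / 2 * (\<Sum>j<n. \<Sum>k<n. real (a j - a k) * (\<Sum>r<a j - a k. ?m (squeeze j k r a) z))" for z
  proof -
    have "(\<Sum>j<n. Re (ddsym j n a z * cnj (msym n b z))) = Re ((\<Sum>j<n. ddsym j n a z) * cnj (msym n b z))"
      by (simp only: sum_distrib_right Re_sum)
    also have "\<dots> = real (\<Sum>j<n. (a j)\<^sup>2) * ?m a z"
      unfolding sum_ddsym by (simp only: mult.assoc Re_of_nat_mult)
    finally show ?thesis
      unfolding interaction_eq dvfield_def sum_subtractf by (simp only: mult_minus_left)
  qed
  then have pt: "?w z * (interaction \<beta> n a b z + (\<Sum>j<n. dvfield j n a b z))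
    = ?w z * ?E z - real (\<Sum>j<n. (a j)\<^sup>2) * (?w z * ?m a z)
     - \<beta> / 2 * (\<Sum>j<n. \<Sum>k<n. real (a j - a k) * (\<Sum>r<a j - a k. ?w z * ?m (squeeze j k r a) z))" for z
    by (simp only: right_diff_distrib sum_distrib_left mult.left_commute)
  have "0 = (\<integral>z. ?w z * ?E z - real (\<Sum>j<n. (a j)\<^sup>2) * (?w z * ?m a z)
     - \<beta> / 2 * (\<Sum>j<n. \<Sum>k<n. real (a j - a k) * (\<Sum>r<a j - a k. ?w z * ?m (squeeze j k r a) z)) \<partial>torus n)"
    using integral_interaction[OF assms, of n a b] unfolding pt by (rule sym)
  also have "\<dots> = energy \<beta> n a b - real (\<Sum>j<n. (a j)\<^sup>2) * gram \<beta> n a b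
    - \<beta> / 2 * (\<Sum>j<n. \<Sum>k<n. real (a j - a k) * (\<Sum>r<a j - a k. gram \<beta> n (squeeze j k r a) b))"
    unfolding gram_def energy_def
    by (simp add: int nm nE Bochner_Integration.integral_sum del: times_complex.sel)
  finally show ?thesis by simp
qed

section \<open>The spectral gap on homogeneous symmetric polynomials\<close>

text \<open>Exponents from position n on are forced to be 0, which makes the set finite.\<close>

definition compositions :: "nat \<Rightarrow> nat \<Rightarrow> (nat \<Rightarrow> nat) set" where
  "compositions n k = {a. (\<forall>i\<ge>n. a i = 0) \<and> (\<Sum>i<n. a i) = k}"

lemma finite_compositions: "finite (compositions n k)"
proof (rule finite_subset)
  show "compositions n k \<subseteq> {a. (\<forall>i. (i \<in> {..<n} \<longrightarrow> a i \<in> {..k}) \<and> (i \<notin> {..<n} \<longrightarrow> a i = 0))}"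
    using member_le_sum[of _ "{..<n}"] by (auto simp: compositions_def)
  show "finite {a. \<forall>i. (i \<in> {..<n} \<longrightarrow> a i \<in> {..k}) \<and> (i \<notin> {..<n} \<longrightarrow> a i = 0)}"
    by (rule finite_set_of_finite_funs) auto
qed

lemma sum_split_two:
  fixes f :: "nat \<Rightarrow> nat"
  assumes "j < n" "k < n" "j \<noteq> k"
  shows "(\<Sum>i<n. f i) = f j + f k + (\<Sum>i\<in>{..<n} - {j, k}. f i)"
proof -
  have "(\<Sum>i\<in>{..<n}. f i) = f j + (\<Sum>i\<in>{..<n} - {j}. f i)"
    using assms by (intro sum.remove) auto
  also have "(\<Sum>i\<in>{..<n} - {j}. f i) = f k + (\<Sum>i\<in>{..<n} - {j} - {k}. f i)"
    using assms by (intro sum.remove) auto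
  also have "{..<n} - {j} - {k} = {..<n} - {j, k}" by auto
  finally show ?thesis by simp
qed

text \<open>With \<open>a j = a k + r + d\<close>, the sum of squares drops by 2 r d.\<close>

lemma squeeze_sums:
  assumes "j < n" "k < n" "r < a j - a k"
  shows "(\<Sum>i<n. squeeze j k r a i) = (\<Sum>i<n. a i)"
    and "0 < r \<Longrightarrow> (\<Sum>i<n. (squeeze j k r a i)\<^sup>2) < (\<Sum>i<n. (a i)\<^sup>2)"
proof -
  have jk: "j \<noteq> k" using assms by auto
  have rest: "(\<Sum>i\<in>{..<n} - {j, k}. f (squeeze j k r a i)) = (\<Sum>i\<in>{..<n} - {j, k}. f (a i))" for f :: "nat \<Rightarrow> nat"
    by (rule sum.cong) (auto simp: squeeze_def)
  show "(\<Sum>i<n. squeeze j k r a i) = (\<Sum>i<n. a i)"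
    unfolding sum_split_two[OF assms(1,2) jk] rest[of "\<lambda>x. x"] using jk assms(3) by (simp add: squeeze_def)
  show "(\<Sum>i<n. (squeeze j k r a i)\<^sup>2) < (\<Sum>i<n. (a i)\<^sup>2)" if "0 < r"
  proof -
    obtain d where d: "a j = a k + r + d" "0 < d"
      using assms(3) that by (metis add.assoc less_diff_conv less_imp_add_positive add.commute)
    have "(a j - r)\<^sup>2 + (a k + r)\<^sup>2 < (a j)\<^sup>2 + (a k)\<^sup>2"
      using that d(2) by (simp add: d(1) power2_eq_square algebra_simps)
    then show ?thesis
      unfolding sum_split_two[OF assms(1,2) jk] rest[of "\<lambda>x. x\<^sup>2"] using jk by (simp add: squeeze_def)
  qed
qed

lemma squeeze_in_compositions:
  assumes "a \<in> compositions n m" "j < n" "k < n" "r < a j - a k"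
  shows "squeeze j k r a \<in> compositions n m"
  using assms squeeze_sums(1)[OF assms(2-4)] by (auto simp: compositions_def squeeze_def)

text \<open>The matrix of minus the generator in the family of symmetrized monomials. The diagonal part of the second sum is the
  contribution of \<open>r = 0\<close>, and all other terms strictly decrease the sum of squares.\<close>

definition coupling :: "real \<Rightarrow> nat \<Rightarrow> (nat \<Rightarrow> nat) \<Rightarrow> (nat \<Rightarrow> nat) \<Rightarrow> real" where
  "coupling \<beta> n a c = (if a = c then real (\<Sum>j<n. (a j)\<^sup>2) else 0)
    + \<beta> / 2 * (\<Sum>j<n. \<Sum>k<n. real (a j - a k) * (\<Sum>r<a j - a k. if squeeze j k r a = c then 1 else 0))"

text \<open>This is \<open>energy_eq\<close> regrouped by the target exponent vector: each squeeze
  keeps the degree m, so its indicator summed over \<open>compositions n m\<close> returns exactly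
  its Gram entry.\<close>

lemma sum_coupling_gram:
  assumes "0 < \<beta>" "a \<in> compositions n m"
  shows "(\<Sum>c\<in>compositions n m. coupling \<beta> n a c * gram \<beta> n c b) = energy \<beta> n a b"
proof -
  let ?I = "compositions n m"
  note fin = finite_compositions[of n m]
  have 1: "(\<Sum>c\<in>?I. (if a = c then real (\<Sum>j<n. (a j)\<^sup>2) else 0) * gram \<beta> n c b) = real (\<Sum>j<n. (a j)\<^sup>2) * gram \<beta> n a b"
    using assms(2) fin by (simp add: if_distrib[of "\<lambda>x. x * _"] cong: if_cong)
  have "(\<Sum>c\<in>?I. (\<beta> / 2 * (\<Sum>j<n. \<Sum>k<n. real (a j - a k) * (\<Sum>r<a j - a k. if squeeze j k r a = c then 1 else 0))) * gram \<beta> n c b)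
    = \<beta> / 2 * (\<Sum>c\<in>?I. \<Sum>j<n. \<Sum>k<n. real (a j - a k) * (\<Sum>r<a j - a k. (if squeeze j k r a = c then 1 else 0) * gram \<beta> n c b))"
    by (simp only: sum_distrib_left sum_distrib_right mult.assoc)
  also have "(\<Sum>c\<in>?I. \<Sum>j<n. \<Sum>k<n. real (a j - a k) * (\<Sum>r<a j - a k. (if squeeze j k r a = c then 1 else 0) * gram \<beta> n c b))
    = (\<Sum>j<n. \<Sum>k<n. real (a j - a k) * (\<Sum>r<a j - a k. \<Sum>c\<in>?I. (if squeeze j k r a = c then 1 else 0) * gram \<beta> n c b))"
    by (simp only: sum.swap[of _ _ ?I] sum_distrib_left)
  also have "\<dots> = (\<Sum>j<n. \<Sum>k<n. real (a j - a k) * (\<Sum>r<a j - a k. gram \<beta> n (squeeze j k r a) b))"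
  proof (intro sum.cong refl arg_cong2[of _ _ _ _ "(*)"])
    fix j k r assume "j \<in> {..<n}" "k \<in> {..<n}" "r \<in> {..<a j - a k}"
    then have "squeeze j k r a \<in> ?I"
      using squeeze_in_compositions assms(2) by simp
    then show "(\<Sum>c\<in>?I. (if squeeze j k r a = c then 1 else 0) * gram \<beta> n c b) = gram \<beta> n (squeeze j k r a) b"
      using fin by (simp add: if_distrib[of "\<lambda>x. x * _"] cong: if_cong)
  qed
  finally show ?thesis
    using 1 unfolding coupling_def distrib_right sum.distrib energy_eq[OF assms(1)] by (simp only:)
qed

lemma energy_commute: "energy \<beta> n a b = energy \<beta> n b a"
  unfolding energy_def by (intro Bochner_Integration.integral_cong refl arg_cong2[of _ _ _ _ "(*)"] sum.cong) (simp add: mult.commute)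

text \<open>The terms r = 0 alone suffice. At most m exponents are nonzero, so at least n - m
  vanish, and each vanishing one, paired with all positions j, contributes the total m.\<close>

lemma coupling_diag:
  assumes "0 \<le> \<beta>" "a \<in> compositions n m"
  shows "\<beta> / 2 * (real m * (real n - real m)) \<le> coupling \<beta> n a a"
proof -
  have sum_a: "(\<Sum>i<n. a i) = m"
    using assms by (simp add: compositions_def)
  define Z where "Z = {l \<in> {..<n}. a l = 0}"
  have "card ({..<n} - Z) = (\<Sum>i\<in>{..<n} - Z. 1)"
    by simp
  also have "\<dots> \<le> (\<Sum>i\<in>{..<n} - Z. a i)"
    by (rule sum_mono) (auto simp: Z_def)
  also have "\<dots> \<le> m"
    unfolding sum_a[symmetric] by (rule sum_mono2) auto
  finally have "n \<le> m + card Z"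
    by (subst (asm) card_Diff_subset) (auto simp: Z_def)
  then have "real m * (real n - real m) \<le> real m * real (card Z)"
    by (intro mult_left_mono) auto
  also have "\<dots> = (\<Sum>j<n. \<Sum>l\<in>Z. real (a j - a l))"
    by (simp add: Z_def sum_a[symmetric] sum_distrib_right mult.commute)
  also have "\<dots> \<le> (\<Sum>j<n. \<Sum>l<n. real (a j - a l))"
    by (intro sum_mono sum_mono2) (auto simp: Z_def)
  also have "\<dots> \<le> (\<Sum>j<n. \<Sum>k<n. real (a j - a k) * (\<Sum>r<a j - a k. if squeeze j k r a = a then 1 else 0))"
  proof (intro sum_mono)
    fix j k
    have "1 \<le> (\<Sum>r<a j - a k. if squeeze j k r a = a then 1 else (0::real))" if "0 < a j - a k"
      using member_le_sum[of 0 "{..<a j - a k}" "\<lambda>r. if squeeze j k r a = a then 1 else (0::real)"] that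
      by (auto simp: squeeze_def)
    then show "real (a j - a k) \<le> real (a j - a k) * (\<Sum>r<a j - a k. if squeeze j k r a = a then 1 else 0)"
      by (cases "0 < a j - a k") (auto simp: mult_le_cancel_left1)
  qed
  finally have "\<beta> / 2 * (real m * (real n - real m)) \<le>
      \<beta> / 2 * (\<Sum>j<n. \<Sum>k<n. real (a j - a k) * (\<Sum>r<a j - a k. if squeeze j k r a = a then 1 else 0))"
    using assms(1) by (intro mult_left_mono) auto
  moreover have "0 \<le> real (\<Sum>j<n. (a j)\<^sup>2)"
    by (rule of_nat_0_le_iff)
  ultimately show ?thesis
    unfolding coupling_def if_P[OF refl] by linarith
qed

lemma coupling_triangular:
  assumes "a \<in> compositions n m" "coupling \<beta> n a c \<noteq> 0"
  shows "c = a \<or> c \<in> compositions n m \<and> (\<Sum>i<n. (c i)\<^sup>2) < (\<Sum>i<n. (a i)\<^sup>2)"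
proof (rule ccontr)
  assume neg: "\<not> ?thesis"
  have "squeeze j k r a \<noteq> c" if "j < n" "k < n" "r < a j - a k" for j k r
  proof (cases "r = 0")
    case True
    then show ?thesis using neg by (auto simp: squeeze_def)
  next
    case False
    then show ?thesis
      using squeeze_in_compositions[OF assms(1) that] squeeze_sums(2)[OF that] neg by auto
  qed
  then have "coupling \<beta> n a c = 0"
    using neg unfolding coupling_def by (auto intro!: sum.neutral)
  then show False
    using assms(2) by simp
qed

lemma cmod_square: "(cmod w)\<^sup>2 = Re (w * cnj w)"
  by (simp add: cmod_power2) (simp add: power2_eq_square)

text \<open>\<open>B\<close> is the Gram form on coefficient vectors, nonnegative as a weighted
  square norm, and \<open>T\<close> applies \<open>coupling\<close>. Their composite is the energy
  form, whose symmetry is the self-adjointness of \<open>T\<close>; the abstract bound is evaluated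
  at the unit vector of a.\<close>

lemma spectral_gap:
  assumes "0 < \<beta>" "a \<in> compositions n m"
  shows "\<beta> / 2 * (real m * (real n - real m)) * gram \<beta> n a a \<le> energy \<beta> n a a"
proof -
  define I where "I = compositions n m"
  define B where "B = (\<lambda>x y. \<Sum>a\<in>I. \<Sum>b\<in>I. x a * y b * gram \<beta> n a b)"
  define T where "T = (\<lambda>x c. \<Sum>a\<in>I. x a * coupling \<beta> n a c)"
  have fin: "finite I"
    unfolding I_def by (rule finite_compositions)
  have gram_commute: "gram \<beta> n a b = gram \<beta> n b a" for a b
    unfolding gram_def by (intro Bochner_Integration.integral_cong refl arg_cong2[of _ _ _ _ "(*)"]) (simp add: mult.commute)
  have int: "integrable (torus n) (\<lambda>z. vandermonde_weight \<beta> n z * Re (msym n a z * cnj (msym n b z)))" for a b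
    using assms(1) by (intro integrable_vandermonde_tame tame_Re tame_mult tame_cnj tame_msym) simp
  interpret psd_form B
  proof
    show "B (\<lambda>a. x a + c * y a) z = B x z + c * B y z" for x y z c
      unfolding B_def by (simp only: distrib_right sum.distrib sum_distrib_left mult.assoc)
    show "B x y = B y x" for x y
      unfolding B_def by (subst sum.swap) (simp add: gram_commute mult_ac)
    show "0 \<le> B x x" for x
    proof -
      have "B x x = (\<integral>z. (\<Sum>a\<in>I. \<Sum>b\<in>I. x a * x b * (vandermonde_weight \<beta> n z * Re (msym n a z * cnj (msym n b z)))) \<partial>torus n)"
        unfolding B_def gram_def by (simp add: int Bochner_Integration.integral_sum del: times_complex.sel)
      also have "\<dots> = (\<integral>z. vandermonde_weight \<beta> n z * (cmod (\<Sum>a\<in>I. of_real (x a) * msym n a z))\<^sup>2 \<partial>torus n)"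
      proof (intro Bochner_Integration.integral_cong refl)
        fix z
        let ?s = "\<Sum>a\<in>I. of_real (x a) * msym n a z"
        have "(cmod ?s)\<^sup>2 = Re (?s * cnj ?s)"
          by (rule cmod_square)
        also have "\<dots> = (\<Sum>a\<in>I. \<Sum>b\<in>I. Re (of_real (x a) * (of_real (x b) * (msym n a z * cnj (msym n b z)))))"
          by (simp only: cnj_sum sum_product Re_sum complex_cnj_mult complex_cnj_complex_of_real mult_ac)
        finally show "(\<Sum>a\<in>I. \<Sum>b\<in>I. x a * x b * (vandermonde_weight \<beta> n z * Re (msym n a z * cnj (msym n b z))))
          = vandermonde_weight \<beta> n z * (cmod ?s)\<^sup>2"
          by (simp only: Re_of_real_mult sum_distrib_left mult_ac)
      qed
      also have "0 \<le> \<dots>"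
        by (intro integral_nonneg_AE always_eventually allI mult_nonneg_nonneg vandermonde_weight_nonneg) simp
      finally show ?thesis .
    qed
  qed
  have BT: "B (T x) y = (\<Sum>a\<in>I. \<Sum>b\<in>I. x a * y b * energy \<beta> n a b)" for x y
  proof -
    have "B (T x) y = (\<Sum>c\<in>I. \<Sum>b\<in>I. \<Sum>a\<in>I. x a * y b * (coupling \<beta> n a c * gram \<beta> n c b))"
      unfolding B_def T_def sum_distrib_right by (simp only: mult_ac)
    also have "\<dots> = (\<Sum>a\<in>I. \<Sum>b\<in>I. \<Sum>c\<in>I. x a * y b * (coupling \<beta> n a c * gram \<beta> n c b))"
      by (subst sum.swap, subst (2) sum.swap, subst sum.swap) (rule refl)
    also have "\<dots> = (\<Sum>a\<in>I. \<Sum>b\<in>I. x a * y b * energy \<beta> n a b)"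
      using sum_coupling_gram[OF assms(1), of _ n m] by (simp add: I_def sum_distrib_left[symmetric])
    finally show ?thesis .
  qed
  have Td: "T (\<lambda>b. if b = a then 1 else 0) c = coupling \<beta> n a c" if "a \<in> I" for a c
    using fin that by (simp add: T_def if_distrib[of "\<lambda>x. x * _"] cong: if_cong)
  let ?e = "\<lambda>b. if b = a then 1 else (0::real)"
  have aI: "a \<in> I" using assms(2) by (simp add: I_def)
  have "T ?e \<in> supported I \<and> \<beta> / 2 * (real m * (real n - real m)) * B ?e ?e \<le> B (T ?e) ?e"
  proof (rule selfadjoint_triangular_bound[where s = "\<lambda>a. \<Sum>i<n. (a i)\<^sup>2"])
    show "T (\<lambda>a. x a + c * y a) = (\<lambda>a. T x a + c * T y a)" for x y c
      unfolding T_def by (simp only: distrib_right sum.distrib sum_distrib_left mult.assoc)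
    show "B (T x) y = B x (T y)" for x y
    proof -
      have "B (T x) y = B (T y) x"
        unfolding BT by (subst sum.swap) (simp add: energy_commute[of \<beta> n] mult_ac)
      then show ?thesis by (simp add: commute)
    qed
    show "\<beta> / 2 * (real m * (real n - real m)) \<le> T (\<lambda>b. if b = a then 1 else 0) a" if "a \<in> I" for a
      unfolding Td[OF that] using coupling_diag[of \<beta> a n m] assms(1) that by (simp add: I_def)
    show "c = a \<or> c \<in> I \<and> (\<Sum>i<n. (c i)\<^sup>2) < (\<Sum>i<n. (a i)\<^sup>2)"
      if "a \<in> I" "T (\<lambda>b. if b = a then 1 else 0) c \<noteq> 0" for a c
      using that(2) coupling_triangular[of a n m \<beta> c] that(1) unfolding Td[OF that(1)] by (simp add: I_def)
    show "?e \<in> supported I"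
      using aI by (auto simp: supported_def)
  qed fact
  moreover have "(\<Sum>a'\<in>I. \<Sum>b\<in>I. ?e a' * ?e b * f a' b) = f a a" for f :: "(nat \<Rightarrow> nat) \<Rightarrow> (nat \<Rightarrow> nat) \<Rightarrow> real"
  proof -
    have "(\<Sum>b\<in>I. ?e a' * ?e b * f a' b) = (if a' = a then f a a else 0)" for a'
      using fin aI by (cases "a' = a") (auto simp: if_distrib[of "\<lambda>x. x * _"] cong: if_cong)
    then show ?thesis
      using fin aI by simp
  qed
  ultimately show ?thesis
    unfolding BT by (simp add: B_def)
qed

section \<open>Second moments of power traces\<close>

definition ptrace :: "nat \<Rightarrow> nat \<Rightarrow> config \<Rightarrow> complex" where
  "ptrace k n z = (\<Sum>j<n. z j ^ k)"

lemma tame_ptrace: "tame n (ptrace k n)"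
  unfolding ptrace_def[abs_def] by (intro tame_sum tame_power tame_coordinate) auto

text \<open>These permutations place the single nonzero exponent, stored at index 0, on the variable
  \<open>z j\<close>. Their number is the same for every j, hence a common factor that
  cancels.\<close>

definition fixing :: "nat \<Rightarrow> nat \<Rightarrow> (nat \<Rightarrow> nat) set" where
  "fixing n j = {\<sigma>. \<sigma> permutes {..<n} \<and> \<sigma> j = 0}"

lemma card_fixing:
  assumes "j < n"
  shows "card (fixing n j) = card (fixing n 0)"
proof -
  let ?t = "Transposition.transpose j 0"
  have t: "?t permutes {..<n}"
    using assms by (intro permutes_swap_id) auto
  have "bij_betw (\<lambda>\<sigma>. \<sigma> \<circ> ?t) (fixing n j) (fixing n 0)"
    by (rule bij_betw_byWitness[where f' = "\<lambda>\<sigma>. \<sigma> \<circ> ?t"])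
      (auto simp: fixing_def comp_assoc permutes_compose[OF t])
  then show ?thesis
    by (rule bij_betw_same_card)
qed

lemma card_fixing_pos: "0 < card (fixing n 0)"
proof -
  have "id \<in> fixing n 0"
    by (auto simp: fixing_def permutes_id)
  moreover have "finite (fixing n 0)"
    unfolding fixing_def by (rule finite_subset[OF _ finite_permutations[of "{..<n}"]]) auto
  ultimately show ?thesis
    by (auto simp: card_gt_0_iff)
qed

abbreviation power_index :: "nat \<Rightarrow> nat \<Rightarrow> nat" where
  "power_index k \<equiv> (\<lambda>i. if i = 0 then k else 0)"

lemma monomial_power_index:
  assumes "\<sigma> \<in> fixing n j" "j < n"
  shows "monomial n (power_index k \<circ> \<sigma>) z = z j ^ k"
proof -
  have "\<sigma> i = 0 \<longleftrightarrow> i = j" for i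
    using assms permutes_inj[of \<sigma> "{..<n}"] by (metis (mono_tags, lifting) fixing_def injD mem_Collect_eq)
  then have "monomial n (power_index k \<circ> \<sigma>) z = (\<Prod>i<n. if i = j then z i ^ k else 1)"
    unfolding monomial_def by (intro prod.cong refl) auto
  then show ?thesis
    using assms(2) by simp
qed

lemma msym_power_index: "msym n (power_index k) z = of_nat (card (fixing n 0)) * ptrace k n z" if "0 < n"
proof -
  let ?P = "{\<sigma>. \<sigma> permutes {..<n}}"
  have fib: "{\<sigma> \<in> ?P. inv \<sigma> 0 = j} = fixing n j" for j
    by (auto simp: fixing_def permutes_inverses permutes_inv_eq)
  have "(\<lambda>\<sigma>. inv \<sigma> 0) ` ?P \<subseteq> {..<n}"
    using that permutes_in_image[OF permutes_inv, of _ "{..<n}" 0] by auto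
  then have "msym n (power_index k) z = (\<Sum>j<n. \<Sum>\<sigma>\<in>{\<sigma> \<in> ?P. inv \<sigma> 0 = j}. monomial n (power_index k \<circ> \<sigma>) z)"
    unfolding msym_def by (intro sum.group[symmetric] finite_permutations) auto
  also have "\<dots> = (\<Sum>j<n. of_nat (card (fixing n 0)) * z j ^ k)"
    unfolding fib
  proof (rule sum.cong[OF refl])
    fix j assume "j \<in> {..<n}"
    then have j: "j < n" by simp
    have "(\<Sum>\<sigma>\<in>fixing n j. monomial n (power_index k \<circ> \<sigma>) z) = (\<Sum>\<sigma>\<in>fixing n j. z j ^ k)"
      by (rule sum.cong[OF refl], rule monomial_power_index[OF _ j])
    also have "\<dots> = of_nat (card (fixing n 0)) * z j ^ k"
      by (simp add: card_fixing[OF j])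
    finally show "(\<Sum>\<sigma>\<in>fixing n j. monomial n (power_index k \<circ> \<sigma>) z) = of_nat (card (fixing n 0)) * z j ^ k" .
  qed
  finally show ?thesis
    by (simp add: ptrace_def sum_distrib_left)
qed

lemma dsym_power_index:
  assumes "j < n"
  shows "dsym j n (power_index k) z = of_nat k * of_nat (card (fixing n 0)) * z j ^ k"
proof -
  have "dsym j n (power_index k) z = (\<Sum>\<sigma>\<in>fixing n j. of_nat (power_index k (\<sigma> j)) * monomial n (power_index k \<circ> \<sigma>) z)"
    unfolding dsym_def by (rule sum.mono_neutral_right) (auto simp: fixing_def finite_permutations)
  also have "\<dots> = (\<Sum>\<sigma>\<in>fixing n j. of_nat k * z j ^ k)"
    by (intro sum.cong refl) (simp add: monomial_power_index[OF _ assms], simp add: fixing_def)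
  finally show ?thesis
    by (simp add: card_fixing[OF assms])
qed

text \<open>Both sides of the gap carry the factor \<open>N\<^sup>2\<close> from counting
  permutations. As n - k is at least n / 2, the gap is at least \<beta> k n / 4 against an energy of
  n k^2 times the mass; this is the origin of the 4.\<close>

lemma ptrace_second_moment:
  assumes "0 < \<beta>" "0 < k" "2 * k \<le> n"
  shows "(\<integral>z. vandermonde_weight \<beta> n z * (cmod (ptrace k n z))\<^sup>2 \<partial>torus n)
    \<le> 4 * real k / \<beta> * (\<integral>z. vandermonde_weight \<beta> n z \<partial>torus n)"
proof -
  let ?w = "vandermonde_weight \<beta> n"
  define N where "N = real (card (fixing n 0))"
  define G where "G = (\<integral>z. ?w z * (cmod (ptrace k n z))\<^sup>2 \<partial>torus n)"
  define W where "W = (\<integral>z. ?w z \<partial>torus n)"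
  have n: "0 < n" using assms by auto
  have N: "0 < N" using card_fixing_pos by (simp add: N_def)
  have "Re (msym n (power_index k) z * cnj (msym n (power_index k) z)) = N\<^sup>2 * (cmod (ptrace k n z))\<^sup>2" for z
    unfolding cmod_square[symmetric] msym_power_index[OF n] by (simp add: norm_mult N_def power_mult_distrib)
  then have "gram \<beta> n (power_index k) (power_index k) = (\<integral>z. N\<^sup>2 * (?w z * (cmod (ptrace k n z))\<^sup>2) \<partial>torus n)"
    unfolding gram_def by (simp only: mult_ac)
  then have gram: "gram \<beta> n (power_index k) (power_index k) = N\<^sup>2 * G"
    by (simp add: G_def)
  have "energy \<beta> n (power_index k) (power_index k) = (\<integral>z. (real n * (real k)\<^sup>2 * N\<^sup>2) * ?w z \<partial>torus n)"
    unfolding energy_def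
  proof (rule integral_cong_AE)
    show "(\<lambda>z. ?w z * (\<Sum>j<n. Re (dsym j n (power_index k) z * cnj (dsym j n (power_index k) z)))) \<in> borel_measurable (torus n)"
      using assms(1) by (intro borel_measurable_integrable integrable_vandermonde_tame tame_sum tame_Re tame_mult tame_cnj tame_dsym) simp
    show "AE z in torus n. ?w z * (\<Sum>j<n. Re (dsym j n (power_index k) z * cnj (dsym j n (power_index k) z)))
       = (real n * (real k)\<^sup>2 * N\<^sup>2) * ?w z"
      using AE_torus[of n]
    proof eventually_elim
      case (elim z)
      then have "(\<Sum>j<n. Re (dsym j n (power_index k) z * cnj (dsym j n (power_index k) z))) = (\<Sum>j<n. (real k)\<^sup>2 * N\<^sup>2)"
        unfolding cmod_square[symmetric]
        by (intro sum.cong refl) (simp add: dsym_power_index norm_mult norm_power N_def power_mult_distrib)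
      then show ?case by simp
    qed
  qed simp
  then have energy: "energy \<beta> n (power_index k) (power_index k) = real n * (real k)\<^sup>2 * N\<^sup>2 * W"
    by (simp add: W_def)
  have "power_index k \<in> compositions n k"
    using n by (auto simp: compositions_def)
  from spectral_gap[OF assms(1) this]
  have "N\<^sup>2 * (\<beta> / 2 * (real k * (real n - real k)) * G) \<le> N\<^sup>2 * (real n * (real k)\<^sup>2 * W)"
    unfolding gram energy by (simp only: mult_ac)
  then have "\<beta> / 2 * (real k * (real n - real k)) * G \<le> real n * (real k)\<^sup>2 * W"
    by (rule mult_left_le_imp_le) (use N in simp)
  then have "real k * (\<beta> / 2 * (real n - real k) * G) \<le> real k * (real n * real k * W)"
    by (simp add: power2_eq_square mult_ac)
  then have 1: "\<beta> / 2 * (real n - real k) * G \<le> real n * real k * W"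
    by (rule mult_left_le_imp_le) (use assms in simp)
  have "0 \<le> G"
    unfolding G_def by (intro integral_nonneg_AE always_eventually allI mult_nonneg_nonneg vandermonde_weight_nonneg) simp
  moreover have "real n / 2 \<le> real n - real k"
    using assms(3) by linarith
  ultimately have "\<beta> / 2 * (real n / 2) * G \<le> \<beta> / 2 * (real n - real k) * G"
    using assms(1) by (intro mult_right_mono mult_left_mono) auto
  then have "\<beta> / 2 * (real n / 2) * G \<le> real n * real k * W"
    using 1 by (rule order_trans)
  then have "real n * (\<beta> / 4 * G) \<le> real n * (real k * W)"
    by (simp add: mult_ac)
  then have "\<beta> / 4 * G \<le> real k * W"
    by (rule mult_left_le_imp_le) (use n in simp)
  then show ?thesis
    using assms(1) unfolding G_def[symmetric] W_def[symmetric] by (simp add: field_simps)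
qed

section \<open>Rotation invariance: orthogonality of frequencies and uniform intensity\<close>

definition rotate_points :: "nat \<Rightarrow> complex \<Rightarrow> config \<Rightarrow> config" where
  "rotate_points n c z = (\<lambda>i\<in>{..<n}. c * z i)"

lemma measurable_rotate [measurable]: "rotate_points n c \<in> torus n \<rightarrow>\<^sub>M torus n"
  unfolding rotate_points_def[abs_def] by measurable

lemma vandermonde_weight_rotate:
  assumes "cmod c = 1"
  shows "vandermonde_weight \<beta> n (rotate_points n c z) = vandermonde_weight \<beta> n z"
  unfolding vandermonde_weight_def
proof (intro prod.cong refl)
  fix k j assume "k \<in> {..<n}" "j \<in> {..<k}"
  then have "rotate_points n c z j - rotate_points n c z k = c * (z j - z k)"
    by (simp add: rotate_points_def right_diff_distrib)
  then show "cmod (rotate_points n c z j - rotate_points n c z k) powr \<beta> = cmod (z j - z k) powr \<beta>"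
    using assms by (simp add: norm_mult)
qed

lemma integral_rotate:
  fixes F :: "config \<Rightarrow> real"
  assumes "cmod c = 1" "F \<in> borel_measurable (torus n)"
  shows "(\<integral>z. F (rotate_points n c z) \<partial>torus n) = (\<integral>z. F z \<partial>torus n)"
  using integral_distr[OF measurable_rotate assms(2), of c] distr_torus_rotate[OF assms(1), of n]
  by (simp add: rotate_points_def[abs_def])

lemma nn_integral_rotate:
  assumes "cmod c = 1" "F \<in> borel_measurable (torus n)"
  shows "(\<integral>\<^sup>+z. F (rotate_points n c z) \<partial>torus n) = (\<integral>\<^sup>+z. F z \<partial>torus n)"
  using nn_integral_distr[OF measurable_rotate, of F n c] assms(2) distr_torus_rotate[OF assms(1), of n]
  by (simp add: rotate_points_def[abs_def])

text \<open>Rotating all points by t multiplies the product of traces by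
  \<open>cis ((k - l) * t)\<close>. The chosen t makes this -1 while the weight is unchanged, so the
  integral equals its own negative.\<close>

lemma ptrace_orthogonal:
  assumes "k \<noteq> l" "0 < \<beta>"
  shows "(\<integral>z. vandermonde_weight \<beta> n z * Re (ptrace k n z * cnj (ptrace l n z)) \<partial>torus n) = 0"
proof -
  define t where "t = pi / (real k - real l)"
  have t: "real k * t - real l * t = pi"
    using assms by (simp add: t_def diff_divide_distrib[symmetric] left_diff_distrib[symmetric])
  let ?F = "\<lambda>z. vandermonde_weight \<beta> n z * Re (ptrace k n z * cnj (ptrace l n z))"
  have p: "ptrace m n (rotate_points n (cis t) z) = cis (real m * t) * ptrace m n z" for m z
    unfolding ptrace_def sum_distrib_left by (intro sum.cong refl) (simp add: rotate_points_def power_mult_distrib Complex.DeMoivre)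
  have "?F (rotate_points n (cis t) z) = - ?F z" for z
  proof -
    have "ptrace k n (rotate_points n (cis t) z) * cnj (ptrace l n (rotate_points n (cis t) z))
      = (cis (real k * t) * cnj (cis (real l * t))) * (ptrace k n z * cnj (ptrace l n z))"
      unfolding p by (simp only: complex_cnj_mult mult_ac)
    also have "cis (real k * t) * cnj (cis (real l * t)) = - 1"
      using t by (simp add: cis_cnj cis_mult)
    finally have "ptrace k n (rotate_points n (cis t) z) * cnj (ptrace l n (rotate_points n (cis t) z))
       = - (ptrace k n z * cnj (ptrace l n z))" by simp
    then show ?thesis
      by (simp only: vandermonde_weight_rotate[OF norm_cis] uminus_complex.sel mult_minus_right)
  qed
  moreover have "?F \<in> borel_measurable (torus n)"
    using assms by (intro borel_measurable_integrable integrable_vandermonde_tame tame_Re tame_mult tame_cnj tame_ptrace) simp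
  ultimately have "(\<integral>z. - ?F z \<partial>torus n) = (\<integral>z. ?F z \<partial>torus n)"
    using integral_rotate[of "cis t" ?F n] by (simp only: norm_cis)
  then show ?thesis
    by (simp del: times_complex.sel)
qed

text \<open>Only the diagonal terms survive. The sum of \<open>real k * (c k)\<^sup>2\<close> is the
  squared \<open>H^{1/2}\<close> seminorm; positive frequencies suffice because the real statistics
  considered are constants plus twice the real part of such sums.\<close>

lemma linear_statistic_second_moment:
  assumes "0 < \<beta>" "2 * K \<le> n"
  shows "(\<integral>z. vandermonde_weight \<beta> n z * (cmod (\<Sum>k=1..K. of_real (c k) * ptrace k n z))\<^sup>2 \<partial>torus n)
    \<le> 4 / \<beta> * (\<Sum>k=1..K. real k * (c k)\<^sup>2) * (\<integral>z. vandermonde_weight \<beta> n z \<partial>torus n)"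
proof -
  let ?w = "vandermonde_weight \<beta> n"
  let ?R = "\<lambda>k l z. Re (ptrace k n z * cnj (ptrace l n z))"
  have int: "integrable (torus n) (\<lambda>z. ?w z * ?R k l z)" for k l
    using assms(1) by (intro integrable_vandermonde_tame tame_Re tame_mult tame_cnj tame_ptrace) simp
  have "(\<integral>z. ?w z * (cmod (\<Sum>k=1..K. of_real (c k) * ptrace k n z))\<^sup>2 \<partial>torus n)
     = (\<integral>z. (\<Sum>k=1..K. \<Sum>l=1..K. c k * c l * (?w z * ?R k l z)) \<partial>torus n)"
  proof (intro Bochner_Integration.integral_cong refl)
    fix z
    let ?s = "\<Sum>k=1..K. of_real (c k) * ptrace k n z"
    have "(cmod ?s)\<^sup>2 = Re (?s * cnj ?s)"
      by (rule cmod_square)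
    also have "\<dots> = (\<Sum>k=1..K. \<Sum>l=1..K. Re (of_real (c k) * (of_real (c l) * (ptrace k n z * cnj (ptrace l n z)))))"
      by (simp only: cnj_sum sum_product Re_sum complex_cnj_mult complex_cnj_complex_of_real mult_ac)
    finally show "?w z * (cmod ?s)\<^sup>2 = (\<Sum>k=1..K. \<Sum>l=1..K. c k * c l * (?w z * ?R k l z))"
      by (simp only: Re_of_real_mult sum_distrib_left mult_ac)
  qed
  also have "\<dots> = (\<Sum>k=1..K. \<Sum>l=1..K. c k * c l * (\<integral>z. ?w z * ?R k l z \<partial>torus n))"
    by (simp add: int Bochner_Integration.integral_sum del: times_complex.sel)
  also have "\<dots> = (\<Sum>k=1..K. \<Sum>l=1..K. if k = l then (c k)\<^sup>2 * (\<integral>z. ?w z * (cmod (ptrace k n z))\<^sup>2 \<partial>torus n) else 0)"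
    using ptrace_orthogonal[OF _ assms(1)] by (intro sum.cong refl) (auto simp: cmod_square power2_eq_square[of "c _"] simp del: times_complex.sel)
  also have "\<dots> = (\<Sum>k=1..K. (c k)\<^sup>2 * (\<integral>z. ?w z * (cmod (ptrace k n z))\<^sup>2 \<partial>torus n))"
    by simp
  also have "\<dots> \<le> (\<Sum>k=1..K. (c k)\<^sup>2 * (4 * real k / \<beta> * (\<integral>z. ?w z \<partial>torus n)))"
    using assms by (intro sum_mono mult_left_mono ptrace_second_moment) auto
  also have "\<dots> = 4 / \<beta> * (\<Sum>k=1..K. real k * (c k)\<^sup>2) * (\<integral>z. ?w z \<partial>torus n)"
    by (simp add: sum_distrib_left sum_distrib_right mult_ac)
  finally show ?thesis .
qed

text \<open>The integral may be averaged over all rotations c, which preserve the weight; for fixed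
  z on the torus, \<open>c * z j\<close> is then uniform on the circle.\<close>

lemma nn_integral_marginal:
  assumes [measurable]: "g \<in> borel_measurable borel" and j: "j < n"
  shows "(\<integral>\<^sup>+z. ennreal (vandermonde_weight \<beta> n z) * g (z j) \<partial>torus n)
    = (\<integral>\<^sup>+z. ennreal (vandermonde_weight \<beta> n z) \<partial>torus n) * (\<integral>\<^sup>+u. g u \<partial>circle_uniform)"
proof -
  let ?w = "\<lambda>z. ennreal (vandermonde_weight \<beta> n z)"
  have [measurable]: "(\<lambda>z. z j) \<in> borel_measurable (torus n)"
    using j by (rule borel_measurable_coordinate)
  interpret pair_sigma_finite "torus n" circle_uniform
    by (intro pair_sigma_finite.intro torus.sigma_finite_measure_axioms circle.sigma_finite_measure_axioms)
  have rot: "(\<integral>\<^sup>+z. ?w z * g (c * z j) \<partial>torus n) = (\<integral>\<^sup>+z. ?w z * g (z j) \<partial>torus n)" if "cmod c = 1" for c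
    using nn_integral_rotate[OF that, of "\<lambda>z. ?w z * g (z j)" n] j
    by (simp add: vandermonde_weight_rotate[OF that]) (simp add: rotate_points_def)
  have "(\<integral>\<^sup>+z. ?w z * g (z j) \<partial>torus n) = (\<integral>\<^sup>+c. (\<integral>\<^sup>+z. ?w z * g (z j) \<partial>torus n) \<partial>circle_uniform)"
    by (simp add: circle.emeasure_space_1[unfolded space_circle_uniform])
  also have "\<dots> = (\<integral>\<^sup>+c. (\<integral>\<^sup>+z. ?w z * g (c * z j) \<partial>torus n) \<partial>circle_uniform)"
    using AE_circle_uniform by (intro nn_integral_cong_AE) (auto elim!: eventually_mono simp: rot)
  also have "\<dots> = (\<integral>\<^sup>+z. (\<integral>\<^sup>+c. ?w z * g (c * z j) \<partial>circle_uniform) \<partial>torus n)"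
    by (rule Fubini') measurable
  also have "\<dots> = (\<integral>\<^sup>+z. ?w z * (\<integral>\<^sup>+u. g u \<partial>circle_uniform) \<partial>torus n)"
  proof (rule nn_integral_cong_AE)
    show "AE z in torus n. (\<integral>\<^sup>+c. ?w z * g (c * z j) \<partial>circle_uniform) = ?w z * (\<integral>\<^sup>+u. g u \<partial>circle_uniform)"
      using AE_torus[of n]
    proof eventually_elim
      case (elim z)
      then have "cmod (z j) = 1" using j by auto
      moreover have "(\<lambda>c. g (z j * c)) \<in> borel_measurable borel"
        by (rule measurable_compose[OF borel_measurable_continuous_onI assms(1)]) (intro continuous_intros)
      then have "(\<lambda>c. g (z j * c)) \<in> borel_measurable circle_uniform"
        by (simp add: measurable_cong_sets[OF sets_circle_uniform refl])
      ultimately show ?case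
        using nn_integral_circle_uniform_rotate[of g "z j"] by (simp add: nn_integral_cmult mult.commute[of _ "z j"])
    qed
  qed
  also have "\<dots> = (\<integral>\<^sup>+z. ?w z \<partial>torus n) * (\<integral>\<^sup>+u. g u \<partial>circle_uniform)"
    by (rule nn_integral_multc) measurable
  finally show ?thesis .
qed

section \<open>Fejer means as test functions\<close>

text \<open>Normalized to the value 1 at u = 1 instead of mass 1, so that a wide kernel is close to
  1 on a given interval and the scaling limit is a squared sinc.\<close>

definition fejer :: "nat \<Rightarrow> complex \<Rightarrow> real" where
  "fejer q u = (cmod (\<Sum>m<q. u ^ m))\<^sup>2 / (real q)\<^sup>2"

lemma fejer_nonneg: "0 \<le> fejer q u"
  by (simp add: fejer_def)

lemma fejer_le_1:
  assumes "cmod u = 1"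
  shows "fejer q u \<le> 1"
proof -
  have "cmod (\<Sum>m<q. u ^ m) \<le> (\<Sum>m<q. 1)"
    by (rule sum_norm_le) (simp add: norm_power assms)
  then have "(cmod (\<Sum>m<q. u ^ m))\<^sup>2 \<le> (real q)\<^sup>2"
    by (intro power_mono) auto
  then show ?thesis
    by (cases "q = 0") (auto simp: fejer_def divide_le_eq_1)
qed

lemma cmod_add_square: "(cmod (a + b))\<^sup>2 = (cmod a)\<^sup>2 + 2 * Re (b * cnj a) + (cmod b)\<^sup>2"
  by (simp add: cmod_power2) (simp add: power2_eq_square algebra_simps)

text \<open>The term m = q has weight 0. Keeping it lets the induction step add its cross terms, the
  frequencies 1 to q, without changing the range.\<close>

lemma norm_geometric_sum_square:
  assumes "cmod u = 1"
  shows "(cmod (\<Sum>m<q. u ^ m))\<^sup>2 = real q + 2 * (\<Sum>m=1..q. (real q - real m) * Re (u ^ m))"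
proof (induction q)
  case (Suc q)
  let ?S = "\<Sum>m<q. u ^ m"
  have inv: "u * cnj u = 1"
    using assms by (simp add: complex_norm_square[symmetric])
  have 1: "u ^ q * cnj (u ^ m) = u ^ (q - m)" if "m < q" for m
  proof -
    have "u ^ q * cnj (u ^ m) = u ^ (q - m) * (u * cnj u) ^ m"
      using that by (simp add: power_mult_distrib power_add[symmetric] mult.assoc[symmetric])
    then show ?thesis by (simp add: inv)
  qed
  have "Re (u ^ q * cnj ?S) = (\<Sum>m<q. Re (u ^ q * cnj (u ^ m)))"
    by (simp only: cnj_sum sum_distrib_left Re_sum)
  also have "\<dots> = (\<Sum>m<q. Re (u ^ (q - m)))"
    by (intro sum.cong refl) (simp only: 1 lessThan_iff)
  also have "\<dots> = (\<Sum>m=1..q. Re (u ^ m))"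
    by (rule sum.reindex_bij_witness[of _ "\<lambda>m. q - m" "\<lambda>m. q - m"]) auto
  finally have cross: "Re (u ^ q * cnj ?S) = (\<Sum>m=1..q. Re (u ^ m))" .
  have "(cmod (?S + u ^ q))\<^sup>2 = (cmod ?S)\<^sup>2 + 2 * Re (u ^ q * cnj ?S) + (cmod (u ^ q))\<^sup>2"
    by (rule cmod_add_square)
  also have "\<dots> = real q + 2 * (\<Sum>m=1..q. (real q - real m) * Re (u ^ m)) + 2 * (\<Sum>m=1..q. Re (u ^ m)) + 1"
    unfolding Suc cross by (simp add: norm_power assms)
  also have "\<dots> = real (Suc q) + 2 * (\<Sum>m=1..q. (real (Suc q) - real m) * Re (u ^ m))"
    by (simp add: algebra_simps sum.distrib sum_subtractf)
  finally show ?case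
    by simp
qed simp

text \<open>The \<open>max\<close> makes the coefficient vanish from q on, so that different scales
  can be expanded over one common range of frequencies.\<close>

definition fejer_coeff :: "nat \<Rightarrow> nat \<Rightarrow> real" where
  "fejer_coeff q m = max 0 (1 - real m / real q) / real q"

lemma fejer_eq:
  assumes "cmod u = 1" "0 < q" "q \<le> K"
  shows "fejer q u = 1 / real q + 2 * (\<Sum>m=1..K. fejer_coeff q m * Re (u ^ m))"
proof -
  have "(\<Sum>m=1..K. fejer_coeff q m * Re (u ^ m)) = (\<Sum>m=1..q. fejer_coeff q m * Re (u ^ m))"
    using assms by (intro sum.mono_neutral_right) (auto simp: fejer_coeff_def max_def field_simps)
  also have "\<dots> = (\<Sum>m=1..q. ((real q - real m) * Re (u ^ m)) / (real q)\<^sup>2)"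
    using assms by (intro sum.cong refl) (auto simp: fejer_coeff_def max_def field_simps power2_eq_square)
  also have "\<dots> = (\<Sum>m=1..q. (real q - real m) * Re (u ^ m)) / (real q)\<^sup>2"
    by (rule sum_divide_distrib[symmetric])
  finally show ?thesis
    using assms unfolding fejer_def norm_geometric_sum_square[OF assms(1)]
    by (simp add: field_simps power2_eq_square)
qed

text \<open>The classical quotient of sines with its denominator multiplied out, so that multiples
  of 2 pi need no exception.\<close>

lemma fejer_sin:
  assumes "0 < q"
  shows "fejer q (cis t) * (real q * sin (t / 2))\<^sup>2 = (sin (real q * t / 2))\<^sup>2"
proof -
  have d: "cmod (cis s - 1) = 2 * \<bar>sin (s / 2)\<bar>" for s
    using dist_exp_i_1[of s] by (simp add: cis_conv_exp)
  have "cis t ^ q - 1 = (cis t - 1) * (\<Sum>m<q. cis t ^ m)"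
    by (rule power_diff_1_eq)
  then have "cmod (cis t ^ q - 1) = cmod (cis t - 1) * cmod (\<Sum>m<q. cis t ^ m)"
    by (metis norm_mult)
  then have "2 * \<bar>sin (real q * t / 2)\<bar> = 2 * \<bar>sin (t / 2)\<bar> * cmod (\<Sum>m<q. cis t ^ m)"
    by (simp only: d Complex.DeMoivre)
  then have "\<bar>sin (real q * t / 2)\<bar>\<^sup>2 = (\<bar>sin (t / 2)\<bar> * cmod (\<Sum>m<q. cis t ^ m))\<^sup>2"
    by simp
  then show ?thesis
    using assms by (simp add: fejer_def power_mult_distrib)
qed

text \<open>For positive y, sin y = 2 sin(y/2) cos(y/2), where sin(y/2) is at least (y/2) cos(y/2)
  by the mean value theorem and cos^2(y/2) is at least 1/2 because cos y is nonnegative.\<close>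

lemma abs_sin_ge_half:
  assumes "\<bar>y\<bar> \<le> pi / 2"
  shows "\<bar>y\<bar> / 2 \<le> \<bar>sin y\<bar>"
proof -
  have "y / 2 \<le> sin y" if "0 < y" "y \<le> pi / 2" for y :: real
  proof -
    have "\<exists>x>0. x < y / 2 \<and> sin (y / 2) - sin 0 = (y / 2 - 0) * cos x"
      using that by (intro MVT2) (auto intro: DERIV_sin)
    then obtain x where x: "0 < x" "x < y / 2" "sin (y / 2) - sin 0 = (y / 2 - 0) * cos x"
      by blast
    have c: "cos (y / 2) \<le> cos x"
      using x that by (intro cos_monotone_0_pi_le) auto
    have c0: "0 \<le> cos (y / 2)"
      using that by (intro cos_ge_zero) auto
    have "0 \<le> cos y"
      using that by (intro cos_ge_zero) auto
    then have "1 / 2 \<le> (cos (y / 2))\<^sup>2"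
      using cos_double_cos[of "y / 2"] by simp
    then have "y / 2 \<le> y * (cos (y / 2) * cos (y / 2))"
      using that by (simp add: power2_eq_square)
    also have "\<dots> \<le> y * (cos x * cos (y / 2))"
      using that c c0 by (intro mult_left_mono mult_right_mono) auto
    also have "\<dots> = sin y"
      using sin_double[of "y / 2"] x by simp
    finally show ?thesis .
  qed
  from this[of y] this[of "- y"] assms show ?thesis
    by (cases "y = 0") (auto simp: abs_if split: if_splits)
qed

text \<open>The trivial bound 1 combined with the bound R^2 / x^2 from the sine quotient. The result
  is free of q and integrable in x, hence a dominating function at the fixed scale R.\<close>

lemma fejer_decay:
  assumes "0 < q" "0 < R" "\<bar>x\<bar> \<le> R * real q / 2"
  shows "fejer q (cis (2 * pi * x / (R * real q))) \<le> (1 + R\<^sup>2) / (1 + x\<^sup>2)"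
proof -
  define t where "t = 2 * pi * x / (R * real q)"
  define f where "f = fejer q (cis t)"
  have f: "0 \<le> f" "f \<le> 1"
    unfolding f_def by (auto intro: fejer_nonneg fejer_le_1)
  have "\<bar>t / 2\<bar> = pi / (R * real q) * \<bar>x\<bar>"
    using assms by (simp add: t_def abs_mult)
  also have "\<dots> \<le> pi / (R * real q) * (R * real q / 2)"
    using assms by (intro mult_left_mono) auto
  finally have "\<bar>t / 2\<bar> / 2 \<le> \<bar>sin (t / 2)\<bar>"
    using assms by (intro abs_sin_ge_half) auto
  then have "real q * (\<bar>t / 2\<bar> / 2) \<le> real q * \<bar>sin (t / 2)\<bar>"
    by (intro mult_left_mono) auto
  also have "real q * (\<bar>t / 2\<bar> / 2) = pi / 2 * (\<bar>x\<bar> / R)"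
    using assms by (simp add: t_def abs_mult)
  finally have "\<bar>x\<bar> / R \<le> real q * \<bar>sin (t / 2)\<bar>"
    using mult_right_mono[of 1 "pi / 2" "\<bar>x\<bar> / R"] pi_ge_two assms by simp
  then have "(\<bar>x\<bar> / R)\<^sup>2 \<le> (real q * \<bar>sin (t / 2)\<bar>)\<^sup>2"
    using assms by (intro power_mono) auto
  then have "f * (\<bar>x\<bar> / R)\<^sup>2 \<le> f * (real q * sin (t / 2))\<^sup>2"
    using f by (intro mult_left_mono) (simp_all add: power_mult_distrib)
  also have "\<dots> \<le> 1"
    unfolding f_def fejer_sin[OF assms(1)] using abs_sin_le_one abs_square_le_1 by blast
  finally have "f * x\<^sup>2 \<le> R\<^sup>2"
    using assms by (simp add: power_divide field_simps)
  then have "f * (1 + x\<^sup>2) \<le> 1 + R\<^sup>2"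
    using f by (simp add: distrib_left)
  moreover have "0 < 1 + x\<^sup>2"
    by (smt (verit) zero_le_power2)
  ultimately show ?thesis
    by (simp add: f_def t_def pos_le_divide_eq)
qed

definition sinc_square :: "real \<Rightarrow> real" where
  "sinc_square y = (sinc y)\<^sup>2"

lemma continuous_on_sinc_square: "continuous_on UNIV sinc_square"
  unfolding sinc_square_def[abs_def] using isCont_sinc
  by (intro continuous_on_power continuous_at_imp_continuous_on) auto

text \<open>The rescaled denominator q sin(y / q) tends to y = pi x / R, and excluding x = 0 keeps
  the limiting quotient nondegenerate. One point is negligible in the integrals for which this is
  used.\<close>

lemma tendsto_fejer:
  assumes q: "filterlim q at_top sequentially" and "x \<noteq> 0" "0 < R"
  shows "(\<lambda>s. fejer (q s) (cis (2 * pi * x / (R * real (q s))))) \<longlonglongrightarrow> sinc_square (pi * x / R)"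
proof -
  define y where "y = pi * x / R"
  have y: "y \<noteq> 0" using assms by (simp add: y_def)
  have "filterlim (\<lambda>s. real (q s)) at_top sequentially"
    using filterlim_compose[OF filterlim_real_sequentially q] .
  then have inv: "(\<lambda>s. y / real (q s)) \<longlonglongrightarrow> 0"
    by (intro real_tendsto_divide_at_top[OF tendsto_const])
  have pos: "\<forall>\<^sub>F s in sequentially. 0 < q s"
  proof -
    have "\<forall>\<^sub>F s in sequentially. 1 \<le> q s"
      using q unfolding filterlim_at_top by blast
    then show ?thesis by eventually_elim simp
  qed
  have "(\<lambda>s. sinc (y / real (q s))) \<longlonglongrightarrow> 1"
    using isCont_tendsto_compose[OF isCont_sinc inv] by simp
  then have scaled: "(\<lambda>s. y * sinc (y / real (q s))) \<longlonglongrightarrow> y * 1"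
    by (intro tendsto_mult tendsto_const)
  have "\<forall>\<^sub>F s in sequentially. y * sinc (y / real (q s)) = real (q s) * sin (y / real (q s))"
    using pos by eventually_elim (use y in auto)
  from Lim_transform_eventually[OF scaled this]
  have lim: "(\<lambda>s. real (q s) * sin (y / real (q s))) \<longlonglongrightarrow> y"
    by (simp only: mult_1_right)
  then have "\<forall>\<^sub>F s in sequentially. real (q s) * sin (y / real (q s)) \<noteq> 0"
    using y by (rule tendsto_imp_eventually_ne)
  then have ev: "\<forall>\<^sub>F s in sequentially. (sin y)\<^sup>2 / (real (q s) * sin (y / real (q s)))\<^sup>2
     = fejer (q s) (cis (2 * pi * x / (R * real (q s))))"
    using pos
  proof eventually_elim
    case (elim s)
    have "2 * pi * x / (R * real (q s)) / 2 = y / real (q s)" "real (q s) * (2 * pi * x / (R * real (q s))) / 2 = y"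
      using elim assms by (auto simp: y_def)
    then have "fejer (q s) (cis (2 * pi * x / (R * real (q s)))) * (real (q s) * sin (y / real (q s)))\<^sup>2 = (sin y)\<^sup>2"
      using fejer_sin[OF elim(2), of "2 * pi * x / (R * real (q s))"] by simp
    then show ?case
      using elim(1) by (simp add: field_simps)
  qed
  have quot: "(\<lambda>s. (sin y)\<^sup>2 / (real (q s) * sin (y / real (q s)))\<^sup>2) \<longlonglongrightarrow> (sin y)\<^sup>2 / y\<^sup>2"
    using y by (intro tendsto_divide tendsto_const tendsto_power lim) auto
  have "(sin y)\<^sup>2 / y\<^sup>2 = sinc_square (pi * x / R)"
    using y by (simp add: sinc_square_def y_def[symmetric] power_divide)
  then show ?thesis
    using Lim_transform_eventually[OF quot ev] by (simp only:)
qed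

section \<open>Averages over dyadic scales and their variance\<close>

definition mean_fejer :: "nat set \<Rightarrow> nat \<Rightarrow> complex \<Rightarrow> real" where
  "mean_fejer I n u = (\<Sum>i\<in>I. fejer (n div 2 ^ i) u) / real (card I)"

lemma continuous_on_mean_fejer: "continuous_on UNIV (mean_fejer I n)"
  unfolding mean_fejer_def[abs_def] fejer_def divide_inverse by (intro continuous_intros)

lemma tame_mean_fejer: "j < n \<Longrightarrow> tame n (\<lambda>z. mean_fejer I n (z j))"
  by (rule tame_compose[OF continuous_on_mean_fejer tame_coordinate])

definition mean_coeff :: "nat set \<Rightarrow> nat \<Rightarrow> nat \<Rightarrow> real" where
  "mean_coeff I n m = (\<Sum>i\<in>I. fejer_coeff (n div 2 ^ i) m) / real (card I)"

text \<open>The zero frequency contributes n / q = \<open>2 ^ i\<close> at scale i, exactly so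
  because \<open>2 ^ L\<close> divides n. As i is at least 1, no frequency exceeds n / 2, the range
  covered by the second moment bound.\<close>

lemma sum_mean_fejer:
  assumes "\<forall>j<n. cmod (z j) = 1" "0 < n" "2 ^ L dvd n" "I \<subseteq> {1..L}"
  shows "(\<Sum>j<n. mean_fejer I n (z j)) - (\<Sum>i\<in>I. 2 ^ i) / real (card I)
     = 2 * Re (\<Sum>m=1..n div 2. of_real (mean_coeff I n m) * ptrace m n z)"
proof -
  let ?K = "n div 2"
  have *: "(\<Sum>j<n. fejer (n div 2 ^ i) (z j)) = 2 ^ i + 2 * (\<Sum>m=1..?K. fejer_coeff (n div 2 ^ i) m * Re (ptrace m n z))"
    if "i \<in> I" for i
  proof -
    have i: "1 \<le> i" "i \<le> L"
      using that assms(4) by auto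
    have dvd: "2 ^ i dvd n"
      using assms(3) i power_le_dvd by blast
    define q where "q = n div 2 ^ i"
    have nq: "n = 2 ^ i * q"
      using dvd by (simp add: q_def)
    then have q: "0 < q" using assms(2) by (metis mult_0_right neq0_conv)
    have "(2::nat) ^ 1 \<le> 2 ^ i"
      using i by (intro power_increasing) auto
    then have "q \<le> ?K"
      unfolding q_def by (intro div_le_mono2) auto
    then have "(\<Sum>j<n. fejer q (z j)) = (\<Sum>j<n. 1 / real q + 2 * (\<Sum>m=1..?K. fejer_coeff q m * Re (z j ^ m)))"
      using assms(1) q by (intro sum.cong refl fejer_eq) auto
    also have "\<dots> = real n / real q + 2 * (\<Sum>j<n. \<Sum>m=1..?K. fejer_coeff q m * Re (z j ^ m))"
      by (simp add: sum.distrib sum_distrib_left)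
    also have "(\<Sum>j<n. \<Sum>m=1..?K. fejer_coeff q m * Re (z j ^ m)) = (\<Sum>m=1..?K. fejer_coeff q m * Re (ptrace m n z))"
      by (subst sum.swap) (simp only: ptrace_def Re_sum sum_distrib_left)
    also have "real n / real q = 2 ^ i"
      using q by (subst nq) simp
    finally show ?thesis
      by (simp add: q_def)
  qed
  have "(\<Sum>j<n. mean_fejer I n (z j)) = (\<Sum>i\<in>I. \<Sum>j<n. fejer (n div 2 ^ i) (z j)) / real (card I)"
    unfolding mean_fejer_def by (subst sum.swap) (simp only: sum_divide_distrib)
  also have "\<dots> = (\<Sum>i\<in>I. 2 ^ i + 2 * (\<Sum>m=1..?K. fejer_coeff (n div 2 ^ i) m * Re (ptrace m n z))) / real (card I)"
    using * by (intro arg_cong2[of _ _ _ _ "(/)"] sum.cong refl) simp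
  also have "\<dots> = (\<Sum>i\<in>I. 2 ^ i) / real (card I)
      + 2 * ((\<Sum>i\<in>I. \<Sum>m=1..?K. fejer_coeff (n div 2 ^ i) m * Re (ptrace m n z)) / real (card I))"
    by (simp add: sum.distrib sum_distrib_left add_divide_distrib)
  also have "(\<Sum>i\<in>I. \<Sum>m=1..?K. fejer_coeff (n div 2 ^ i) m * Re (ptrace m n z)) / real (card I)
     = (\<Sum>m=1..?K. mean_coeff I n m * Re (ptrace m n z))"
    unfolding mean_coeff_def by (subst sum.swap) (simp add: sum_divide_distrib sum_distrib_right)
  also have "\<dots> = Re (\<Sum>m=1..?K. of_real (mean_coeff I n m) * ptrace m n z)"
    by (simp only: Re_sum Re_of_real_mult)
  finally show ?thesis by simp
qed

text \<open>The product vanishes beyond the smaller index q, and each of the at most q remaining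
  terms is at most 1 / q'. This is the almost orthogonality of scales in
  \<open>H^{1/2}\<close>.\<close>

lemma sum_fejer_coeff_product:
  assumes "0 < q" "0 < q'" "q \<le> q'"
  shows "(\<Sum>m=1..K. real m * (fejer_coeff q m * fejer_coeff q' m)) \<le> real q / real q'"
proof -
  have nonneg: "0 \<le> fejer_coeff p m" and le: "fejer_coeff p m \<le> 1 / real p" for p m
    by (auto simp: fejer_coeff_def intro!: divide_right_mono)
  have zero: "fejer_coeff q m = 0" if "q < m" for m
    using that assms by (auto simp: fejer_coeff_def max_def field_simps)
  have "real m * (fejer_coeff q m * fejer_coeff q' m) \<le> real q * (1 / real q * (1 / real q'))" if "m \<le> q" for m
    using that by (intro mult_mono nonneg le mult_nonneg_nonneg) auto
  then have le_term: "real m * (fejer_coeff q m * fejer_coeff q' m) \<le> 1 / real q'" if "m \<le> q" for m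
    using that assms(1) by simp
  have "(\<Sum>m=1..K. real m * (fejer_coeff q m * fejer_coeff q' m)) \<le> (\<Sum>m\<in>{1..q}. 1 / real q')"
  proof (rule order_trans)
    show "(\<Sum>m=1..K. real m * (fejer_coeff q m * fejer_coeff q' m)) \<le> (\<Sum>m\<in>{1..K} \<inter> {1..q}. real m * (fejer_coeff q m * fejer_coeff q' m))"
      by (rule eq_refl, rule sum.mono_neutral_right) (auto simp: zero)
    show "(\<Sum>m\<in>{1..K} \<inter> {1..q}. real m * (fejer_coeff q m * fejer_coeff q' m)) \<le> (\<Sum>m\<in>{1..q}. 1 / real q')"
      by (rule order_trans[OF sum_mono[OF le_term] sum_mono2]) auto
  qed
  also have "\<dots> = real q / real q'"
    using assms by simp
  finally show ?thesis .
qed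

text \<open>The inner products are at most 2^(-|i - i'|), with row sums at most 4: two geometric
  series of at most 2 each. So the double sum is at most 4 N, to be divided by the N^2 of the
  average.\<close>

lemma sum_mean_coeff_square:
  assumes "0 < n" "2 ^ L dvd n" "I \<subseteq> {1..L}" "I \<noteq> {}"
  shows "(\<Sum>m=1..K. real m * (mean_coeff I n m)\<^sup>2) \<le> 4 / real (card I)"
proof -
  define N where "N = real (card I)"
  have fin: "finite I" using assms(3) finite_subset by blast
  then have N: "0 < N" using assms(4) by (simp add: N_def card_gt_0_iff)
  let ?q = "\<lambda>i. n div 2 ^ i"
  let ?d = "\<lambda>i i'. if i \<le> i' then (1 / 2) ^ (i' - i) else (1 / 2 :: real) ^ (i - i')"
  have pair: "(\<Sum>m=1..K. real m * (fejer_coeff (?q i) m * fejer_coeff (?q i') m)) \<le> (1 / 2) ^ (i' - i)"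
    if "i \<in> I" "i' \<in> I" "i \<le> i'" for i i'
  proof -
    have "i' \<le> L" using that assms(3) by auto
    then have "2 ^ i' dvd n" using assms(2) power_le_dvd by blast
    define q where "q = ?q i'"
    have n: "n = 2 ^ i' * q" using \<open>2 ^ i' dvd n\<close> by (simp add: q_def)
    then have q: "0 < q" using assms(1) by (metis mult_0_right neq0_conv)
    have "n = 2 ^ i * (2 ^ (i' - i) * q)"
      using that(3) n by (simp add: mult.assoc[symmetric] power_add[symmetric])
    then have q': "?q i = 2 ^ (i' - i) * q"
      by simp
    have "(\<Sum>m=1..K. real m * (fejer_coeff q m * fejer_coeff (?q i) m)) \<le> real q / real (?q i)"
      unfolding q' using q by (intro sum_fejer_coeff_product) auto
    also have "\<dots> = (1 / 2) ^ (i' - i)"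
      unfolding q' using q by (simp add: power_one_over field_simps)
    finally show ?thesis
      by (simp add: q_def mult.commute)
  qed
  have row: "(\<Sum>i'\<in>I. ?d i i') \<le> 4" for i
  proof -
    have geo: "(\<Sum>i'\<in>J. (1 / 2) ^ f i') \<le> (2::real)" if "finite J" "inj_on f J" for J :: "nat set" and f :: "nat \<Rightarrow> nat"
    proof -
      have "(\<Sum>i'\<in>J. (1 / 2) ^ f i') = (\<Sum>d\<in>f ` J. (1 / 2 :: real) ^ d)"
        using that by (simp add: sum.reindex)
      also have "\<dots> < 1 / (1 - 1 / 2)"
        using that by (intro geometric_sum_less) auto
      finally show ?thesis by simp
    qed
    have "(\<Sum>i'\<in>I. ?d i i') = (\<Sum>i'\<in>{i'\<in>I. i \<le> i'}. (1 / 2) ^ (i' - i)) + (\<Sum>i'\<in>{i'\<in>I. \<not> i \<le> i'}. (1 / 2) ^ (i - i'))"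
      using fin by (subst sum.If_cases) (auto intro!: arg_cong2[of _ _ _ _ "(+)"] sum.cong)
    also have "\<dots> \<le> 2 + 2"
      using fin by (intro add_mono geo) (auto simp: inj_on_def)
    finally show ?thesis by simp
  qed
  have "N\<^sup>2 * (\<Sum>m=1..K. real m * (mean_coeff I n m)\<^sup>2)
     = (\<Sum>m=1..K. \<Sum>i\<in>I. \<Sum>i'\<in>I. real m * (fejer_coeff (?q i) m * fejer_coeff (?q i') m))"
  proof -
    have "N\<^sup>2 * (real m * (mean_coeff I n m)\<^sup>2) = real m * (\<Sum>i\<in>I. fejer_coeff (?q i) m)\<^sup>2" for m
      using N by (simp add: mean_coeff_def N_def[symmetric] power_divide)
    then show ?thesis
      unfolding sum_distrib_left[of "N\<^sup>2"] power2_eq_square[of "sum _ _"] sum_product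
      by (simp only: sum_distrib_left)
  qed
  also have "\<dots> = (\<Sum>i\<in>I. \<Sum>i'\<in>I. \<Sum>m=1..K. real m * (fejer_coeff (?q i) m * fejer_coeff (?q i') m))"
    by (simp only: sum.swap[of _ I "{1..K}"])
  also have "\<dots> \<le> (\<Sum>i\<in>I. \<Sum>i'\<in>I. ?d i i')"
  proof (intro sum_mono)
    fix i i' assume "i \<in> I" "i' \<in> I"
    then show "(\<Sum>m=1..K. real m * (fejer_coeff (?q i) m * fejer_coeff (?q i') m)) \<le> ?d i i'"
      using pair[of i i'] pair[of i' i] by (auto simp: mult.commute[of "fejer_coeff (?q i) _"])
  qed
  also have "\<dots> \<le> (\<Sum>i\<in>I. 4)"
    by (intro sum_mono row)
  also have "\<dots> = 4 * N"
    by (simp add: N_def)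
  finally have "N * (N * (\<Sum>m=1..K. real m * (mean_coeff I n m)\<^sup>2)) \<le> N * 4"
    by (simp add: power2_eq_square mult_ac)
  then have "N * (\<Sum>m=1..K. real m * (mean_coeff I n m)\<^sup>2) \<le> 4"
    by (rule mult_left_le_imp_le) (use N in simp)
  then show ?thesis
    using N by (simp add: N_def[symmetric] field_simps)
qed

lemma mult_Re_square_le:
  assumes "0 \<le> a"
  shows "a * (2 * Re w)\<^sup>2 \<le> 4 * (a * (cmod w)\<^sup>2)"
  using mult_left_mono[of "(Re w)\<^sup>2" "(cmod w)\<^sup>2" a] assms by (simp add: power_mult_distrib cmod_power2)

text \<open>The 64 is 4 * 4 * 4: the square of twice the real part, the constant of
  \<open>linear_statistic_second_moment\<close> and that of
  \<open>sum_mean_coeff_square\<close>.\<close>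

lemma mean_fejer_variance:
  assumes "0 < \<beta>" "0 < n" "2 ^ L dvd n" "I \<subseteq> {1..L}" "I \<noteq> {}"
  shows "(\<integral>z. vandermonde_weight \<beta> n z * ((\<Sum>j<n. mean_fejer I n (z j)) - (\<Sum>i\<in>I. 2 ^ i) / real (card I))\<^sup>2 \<partial>torus n)
    \<le> 64 / (\<beta> * real (card I)) * (\<integral>z. vandermonde_weight \<beta> n z \<partial>torus n)"
proof -
  let ?w = "vandermonde_weight \<beta> n"
  let ?V = "\<lambda>z. (\<Sum>j<n. mean_fejer I n (z j)) - (\<Sum>i\<in>I. 2 ^ i) / real (card I)"
  let ?S = "\<lambda>z. \<Sum>m=1..n div 2. of_real (mean_coeff I n m) * ptrace m n z"
  have W: "0 \<le> (\<integral>z. ?w z \<partial>torus n)"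
    by (intro integral_nonneg_AE always_eventually allI vandermonde_weight_nonneg)
  have nS: "tame n ?S"
    by (intro tame_sum tame_mult tame_const tame_ptrace)
  have "(\<integral>z. ?w z * (?V z)\<^sup>2 \<partial>torus n) = (\<integral>z. ?w z * (2 * Re (?S z))\<^sup>2 \<partial>torus n)"
  proof (rule integral_cong_AE)
    show "AE z in torus n. ?w z * (?V z)\<^sup>2 = ?w z * (2 * Re (?S z))\<^sup>2"
      using AE_torus[of n]
    proof eventually_elim
      case (elim z)
      show ?case
        unfolding sum_mean_fejer[OF elim assms(2-4)] ..
    qed
    have nV: "tame n (\<lambda>z. (?V z)\<^sup>2)"
      by (intro tame_power tame_diff tame_sum tame_mean_fejer tame_const) simp
    have nR: "tame n (\<lambda>z. (2 * Re (?S z))\<^sup>2)"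
      by (intro tame_power tame_const tame_mult tame_Re nS)
    show "(\<lambda>z. ?w z * (?V z)\<^sup>2) \<in> borel_measurable (torus n)"
      using assms(1) nV by (intro borel_measurable_integrable integrable_vandermonde_tame) auto
    show "(\<lambda>z. ?w z * (2 * Re (?S z))\<^sup>2) \<in> borel_measurable (torus n)"
      using assms(1) nR by (intro borel_measurable_integrable integrable_vandermonde_tame) (simp_all only: less_imp_le)
  qed
  also have "\<dots> \<le> (\<integral>z. 4 * (?w z * (cmod (?S z))\<^sup>2) \<partial>torus n)"
  proof (rule integral_mono)
    show "integrable (torus n) (\<lambda>z. ?w z * (2 * Re (?S z))\<^sup>2)"
      using assms(1) nS by (intro integrable_vandermonde_tame tame_power tame_mult tame_const tame_Re) auto
    show "integrable (torus n) (\<lambda>z. 4 * (?w z * (cmod (?S z))\<^sup>2))"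
      using assms(1) nS by (intro integrable_mult_right integrable_vandermonde_tame tame_power tame_norm) auto
    show "?w z * (2 * Re (?S z))\<^sup>2 \<le> 4 * (?w z * (cmod (?S z))\<^sup>2)" for z
      by (rule mult_Re_square_le[OF vandermonde_weight_nonneg])
  qed
  also have "\<dots> = 4 * (\<integral>z. ?w z * (cmod (?S z))\<^sup>2 \<partial>torus n)"
    by simp
  also have "\<dots> \<le> 4 * (4 / \<beta> * (\<Sum>m=1..n div 2. real m * (mean_coeff I n m)\<^sup>2) * (\<integral>z. ?w z \<partial>torus n))"
    using assms(1) by (intro mult_left_mono linear_statistic_second_moment) auto
  also have "\<dots> \<le> 4 * (4 / \<beta> * (4 / real (card I)) * (\<integral>z. ?w z \<partial>torus n))"
    using assms W by (intro mult_left_mono mult_right_mono sum_mean_coeff_square) auto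
  also have "\<dots> = 64 / (\<beta> * real (card I)) * (\<integral>z. ?w z \<partial>torus n)"
    by simp
  finally show ?thesis .
qed

section \<open>Truncated sinc averages and their distance to the Fejer averages\<close>

definition mean_sinc :: "nat set \<Rightarrow> real \<Rightarrow> real" where
  "mean_sinc I x = (\<Sum>i\<in>I. sinc_square (pi * x / 2 ^ i)) / real (card I)"

definition cutoff :: "real \<Rightarrow> real \<Rightarrow> real" where
  "cutoff A x = max 0 (min 1 (A + 1 - \<bar>x\<bar>))"

text \<open>Vague convergence asks for compact support, which squared sinc functions lack. The
  piecewise linear cutoff preserves continuity and is 1 on [-A, A].\<close>

definition bump :: "nat set \<Rightarrow> real \<Rightarrow> real \<Rightarrow> real" where
  "bump I A x = mean_sinc I x * cutoff A x"

lemma sinc_square_bounds: "0 \<le> sinc_square y" "sinc_square y \<le> 1"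
proof -
  show "0 \<le> sinc_square y"
    by (simp add: sinc_square_def)
  have "\<bar>sinc y\<bar> \<le> 1"
    using abs_sin_x_le_abs_x[of y] by (auto simp: divide_le_eq_1)
  then show "sinc_square y \<le> 1"
    unfolding sinc_square_def by (simp only: abs_square_le_1)
qed

lemma continuous_on_mean_sinc: "continuous_on UNIV (mean_sinc I)"
  unfolding mean_sinc_def[abs_def] divide_inverse
  by (intro continuous_on_mult continuous_on_sum continuous_on_const
      continuous_on_compose2[OF continuous_on_sinc_square] continuous_on_id) auto

lemma continuous_on_cutoff: "continuous_on UNIV (cutoff A)"
  unfolding cutoff_def[abs_def] by (intro continuous_intros)

lemma continuous_on_bump: "continuous_on UNIV (bump I A)"
  unfolding bump_def[abs_def] by (intro continuous_on_mult continuous_on_mean_sinc continuous_on_cutoff)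

lemma borel_measurable_mean_sinc [measurable]: "mean_sinc I \<in> borel_measurable borel"
  by (rule borel_measurable_continuous_onI[OF continuous_on_mean_sinc])

lemma borel_measurable_bump [measurable]: "bump I A \<in> borel_measurable borel"
  by (rule borel_measurable_continuous_onI[OF continuous_on_bump])

lemma borel_measurable_mean_fejer [measurable]: "mean_fejer I n \<in> borel_measurable borel"
  by (rule borel_measurable_continuous_onI[OF continuous_on_mean_fejer])

lemma cutoff_bounds: "0 \<le> cutoff A x" "cutoff A x \<le> 1"
  by (auto simp: cutoff_def)

lemma mean_sinc_nonneg: "0 \<le> mean_sinc I x"
  unfolding mean_sinc_def by (intro divide_nonneg_nonneg sum_nonneg sinc_square_bounds) auto

lemma bump_nonneg: "0 \<le> bump I A x"
  unfolding bump_def by (intro mult_nonneg_nonneg mean_sinc_nonneg cutoff_bounds)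

lemma bump_le: "bump I A x \<le> mean_sinc I x"
  unfolding bump_def using mult_left_mono[OF cutoff_bounds(2)[of A x] mean_sinc_nonneg[of I x]] by simp

lemma bump_eq_0: "A + 1 \<le> \<bar>x\<bar> \<Longrightarrow> bump I A x = 0"
  by (simp add: bump_def cutoff_def)

abbreviation l1_integrand :: "nat set \<Rightarrow> real \<Rightarrow> nat \<Rightarrow> real \<Rightarrow> real" where
  "l1_integrand I A n x \<equiv> indicator {- real n / 2..<real n / 2} x * \<bar>mean_fejer I n (cis (2 * pi * x / real n)) - bump I A x\<bar>"

text \<open>One period of the scaled circle has length n and the points have intensity 1 on it, so
  this is the expected sum over the points of the error in replacing the Fejer average by the
  truncated sinc average.\<close>

definition l1_error :: "nat set \<Rightarrow> real \<Rightarrow> nat \<Rightarrow> real" where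
  "l1_error I A n = (\<integral>x. l1_integrand I A n x \<partial>lborel)"

lemma Suc_le_power_mult: "Suc s \<le> 2 ^ m * Suc s"
proof -
  have "1 * Suc s \<le> 2 ^ m * Suc s"
    by (intro mult_le_mono1) simp
  then show ?thesis by (simp only: mult_1_left)
qed

context
  fixes I :: "nat set" and L :: nat
  assumes I: "I \<subseteq> {1..L}" "I \<noteq> {}"
begin

lemma finite_scales: "finite I"
  using I(1) finite_subset by blast

lemma card_scales: "0 < real (card I)"
  using I(2) finite_scales by (simp add: card_gt_0_iff)

lemma mean_le:
  fixes f :: "nat \<Rightarrow> real"
  assumes "\<And>i. i \<in> I \<Longrightarrow> f i \<le> C"
  shows "(\<Sum>i\<in>I. f i) / real (card I) \<le> C"
  using sum_bounded_above[of I f C] assms card_scales by (simp add: field_simps)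

lemma scale_quotient:
  assumes "i \<in> I"
  shows "(2 ^ L * Suc s) div 2 ^ i = 2 ^ (L - i) * Suc s"
    and "real (2 ^ L * Suc s) = 2 ^ i * real (2 ^ (L - i) * Suc s)"
proof -
  have "i \<le> L" using assms I by auto
  then have eq: "2 ^ L * Suc s = 2 ^ i * (2 ^ (L - i) * Suc s)"
    by (simp only: mult.assoc[symmetric] power_add[symmetric] le_add_diff_inverse)
  show "(2 ^ L * Suc s) div 2 ^ i = 2 ^ (L - i) * Suc s"
    unfolding eq by (rule nonzero_mult_div_cancel_left) simp
  show "real (2 ^ L * Suc s) = 2 ^ i * real (2 ^ (L - i) * Suc s)"
    unfolding eq by simp
qed

lemma mean_fejer_nonneg: "0 \<le> mean_fejer I n u"
  unfolding mean_fejer_def by (intro divide_nonneg_nonneg sum_nonneg fejer_nonneg) auto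

text \<open>The widest scale \<open>2 ^ L\<close> majorizes the others, which gives a single
  dominating function for all s.\<close>

lemma mean_fejer_le:
  assumes n: "n = 2 ^ L * Suc s" and x: "\<bar>x\<bar> \<le> real n / 2"
  shows "mean_fejer I n (cis (2 * pi * x / real n)) \<le> (1 + (2 ^ L)\<^sup>2) / (1 + x\<^sup>2)"
  unfolding mean_fejer_def
proof (rule mean_le)
  fix i assume i: "i \<in> I"
  let ?q = "2 ^ (L - i) * Suc s"
  note q = scale_quotient[OF i, of s]
  have "fejer ?q (cis (2 * pi * x / (2 ^ i * real ?q))) \<le> (1 + (2 ^ i)\<^sup>2) / (1 + x\<^sup>2)"
    using x unfolding n q(2) by (intro fejer_decay) auto
  also have "\<dots> \<le> (1 + (2 ^ L)\<^sup>2) / (1 + x\<^sup>2)"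
    using i I(1) by (intro divide_right_mono add_left_mono power_mono power_increasing) auto
  finally show "fejer (n div 2 ^ i) (cis (2 * pi * x / real n)) \<le> (1 + (2 ^ L)\<^sup>2) / (1 + x\<^sup>2)"
    unfolding n q .
qed

lemma tendsto_mean_fejer:
  assumes "x \<noteq> 0"
  shows "(\<lambda>s. mean_fejer I (2 ^ L * Suc s) (cis (2 * pi * x / real (2 ^ L * Suc s)))) \<longlonglongrightarrow> mean_sinc I x"
  unfolding mean_fejer_def mean_sinc_def divide_inverse[of _ "real (card I)"]
proof (intro tendsto_mult tendsto_const tendsto_sum)
  fix i assume i: "i \<in> I"
  have "filterlim (\<lambda>s. 2 ^ (L - i) * Suc s) at_top sequentially"
  proof (rule filterlim_at_top_mono)
    show "filterlim Suc at_top sequentially"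
      by (rule filterlim_Suc)
  qed (intro always_eventually allI Suc_le_power_mult)
  from tendsto_fejer[OF this assms, of "2 ^ i"]
  show "(\<lambda>s. fejer ((2 ^ L * Suc s) div 2 ^ i) (cis (2 * pi * x / real (2 ^ L * Suc s)))) \<longlonglongrightarrow> sinc_square (pi * x / 2 ^ i)"
    unfolding scale_quotient[OF i] by simp
qed

text \<open>The bound is inherited from the Fejer averages in the limit, as a fixed x eventually
  lies in the window. At x = 0 the bound by 1 suffices.\<close>

lemma mean_sinc_le: "mean_sinc I x \<le> (1 + (2 ^ L)\<^sup>2) / (1 + x\<^sup>2)"
proof (cases "x = 0")
  case True
  have "mean_sinc I x \<le> 1"
    unfolding mean_sinc_def by (intro mean_le sinc_square_bounds)
  then show ?thesis
    using True by (simp add: add_increasing2)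
next
  case False
  show ?thesis
  proof (rule LIMSEQ_le_const2[OF tendsto_mean_fejer[OF False]])
    obtain N where N: "2 * \<bar>x\<bar> \<le> real N"
      using real_arch_simple by blast
    have "mean_fejer I (2 ^ L * Suc s) (cis (2 * pi * x / real (2 ^ L * Suc s))) \<le> (1 + (2 ^ L)\<^sup>2) / (1 + x\<^sup>2)" if "N \<le> s" for s
    proof (rule mean_fejer_le[OF refl])
      have "real (Suc s) \<le> real (2 ^ L * Suc s)"
        by (rule of_nat_mono[OF Suc_le_power_mult])
      then show "\<bar>x\<bar> \<le> real (2 ^ L * Suc s) / 2"
        using N that by (simp del: of_nat_mult)
    qed
    then show "\<exists>N. \<forall>s\<ge>N. mean_fejer I (2 ^ L * Suc s) (cis (2 * pi * x / real (2 ^ L * Suc s))) \<le> (1 + (2 ^ L)\<^sup>2) / (1 + x\<^sup>2)"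
      by blast
  qed
qed

lemma integrable_dom: "integrable lborel (\<lambda>x::real. C / (1 + x\<^sup>2))"
proof -
  have "integrable lborel (\<lambda>x::real. inverse (1 + x\<^sup>2))"
    using integrable_inverse_1_plus_square by (simp add: set_integrable_def)
  then have "integrable lborel (\<lambda>x::real. C * inverse (1 + x\<^sup>2))"
    by (rule integrable_mult_right)
  then show ?thesis
    by (simp add: divide_inverse)
qed

lemma l1_error_integrand_le:
  assumes "n = 2 ^ L * Suc s"
  shows "l1_integrand I A n x \<le> (2 * (1 + (2 ^ L)\<^sup>2)) / (1 + x\<^sup>2)"
proof (cases "x \<in> {- real n / 2..<real n / 2}")
  case True
  then have "\<bar>x\<bar> \<le> real n / 2" by auto
  then have "mean_fejer I n (cis (2 * pi * x / real n)) \<le> (1 + (2 ^ L)\<^sup>2) / (1 + x\<^sup>2)"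
    by (rule mean_fejer_le[OF assms])
  moreover have "bump I A x \<le> (1 + (2 ^ L)\<^sup>2) / (1 + x\<^sup>2)"
    using bump_le mean_sinc_le by (rule order_trans)
  moreover note mean_fejer_nonneg[of n "cis (2 * pi * x / real n)"] bump_nonneg[of I A x]
  ultimately have "\<bar>mean_fejer I n (cis (2 * pi * x / real n)) - bump I A x\<bar>
      \<le> (1 + (2 ^ L)\<^sup>2) / (1 + x\<^sup>2) + (1 + (2 ^ L)\<^sup>2) / (1 + x\<^sup>2)"
    by linarith
  then show ?thesis
    using True by (simp add: add_divide_distrib[symmetric])
qed simp

lemma borel_measurable_l1_integrand:
  "(\<lambda>x. l1_integrand I A n x) \<in> borel_measurable lborel"
  by measurable

lemma integrable_l1_integrand:
  assumes "n = 2 ^ L * Suc s"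
  shows "integrable lborel (\<lambda>x. l1_integrand I A n x)"
  by (rule Bochner_Integration.integrable_bound[OF integrable_dom[of "2 * (1 + (2 ^ L)\<^sup>2)"] borel_measurable_l1_integrand])
    (intro always_eventually allI, use l1_error_integrand_le[OF assms] in \<open>simp add: abs_mult add_nonneg_nonneg\<close>)

lemma tendsto_l1_error:
  "(\<lambda>s. l1_error I A (2 ^ L * Suc s)) \<longlonglongrightarrow> (\<integral>x. \<bar>mean_sinc I x - bump I A x\<bar> \<partial>lborel)"
  unfolding l1_error_def
proof (rule integral_dominated_convergence[OF _ _ integrable_dom[of "2 * (1 + (2 ^ L)\<^sup>2)"]])
  show "AE x in lborel. norm (l1_integrand I A (2 ^ L * Suc s) x)
      \<le> 2 * (1 + (2 ^ L)\<^sup>2) / (1 + x\<^sup>2)" for s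
    using l1_error_integrand_le[OF refl, of s _ A] by (intro always_eventually allI) (simp add: abs_mult)
  show "AE x in lborel. (\<lambda>s. l1_integrand I A (2 ^ L * Suc s) x)
      \<longlonglongrightarrow> \<bar>mean_sinc I x - bump I A x\<bar>"
    using AE_lborel_singleton[of 0]
  proof eventually_elim
    case (elim x)
    obtain N where N: "2 * \<bar>x\<bar> \<le> real N"
      using real_arch_simple by blast
    have "\<forall>\<^sub>F s in sequentially. \<bar>mean_fejer I (2 ^ L * Suc s) (cis (2 * pi * x / real (2 ^ L * Suc s))) - bump I A x\<bar>
      = l1_integrand I A (2 ^ L * Suc s) x"
      using eventually_ge_at_top[of N]
    proof eventually_elim
      case (elim s)
      have "real (Suc s) \<le> real (2 ^ L * Suc s)"
        by (rule of_nat_mono[OF Suc_le_power_mult])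
      then have "\<bar>x\<bar> < real (2 ^ L * Suc s) / 2"
        using N elim by (simp del: of_nat_mult)
      then have "x \<in> {- real (2 ^ L * Suc s) / 2..<real (2 ^ L * Suc s) / 2}"
        unfolding atLeastLessThan_iff by linarith
      then show ?case
        by (simp only: indicator_simps mult_1_left)
    qed
    moreover have "(\<lambda>s. \<bar>mean_fejer I (2 ^ L * Suc s) (cis (2 * pi * x / real (2 ^ L * Suc s))) - bump I A x\<bar>)
       \<longlonglongrightarrow> \<bar>mean_sinc I x - bump I A x\<bar>"
      using elim by (intro tendsto_rabs tendsto_diff tendsto_mean_fejer tendsto_const) auto
    ultimately show ?case
      by (rule Lim_transform_eventually[rotated])
  qed
qed measurable

lemma tendsto_cutoff_error:
  "(\<lambda>A. \<integral>x. \<bar>mean_sinc I x - bump I (real A) x\<bar> \<partial>lborel) \<longlonglongrightarrow> 0"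
proof -
  have "(\<lambda>A. \<integral>x. \<bar>mean_sinc I x - bump I (real A) x\<bar> \<partial>lborel) \<longlonglongrightarrow> (\<integral>x. 0 \<partial>(lborel :: real measure))"
  proof (rule integral_dominated_convergence[OF _ _ integrable_dom[of "1 + (2 ^ L)\<^sup>2"]])
    show "(\<lambda>x. 0 :: real) \<in> borel_measurable lborel"
      by simp
    show "(\<lambda>x. \<bar>mean_sinc I x - bump I (real A) x\<bar>) \<in> borel_measurable lborel" for A
      by measurable
    show "AE x in lborel. norm (\<bar>mean_sinc I x - bump I (real A) x\<bar>) \<le> (1 + (2 ^ L)\<^sup>2) / (1 + x\<^sup>2)" for A
      using bump_le[of I "real A"] bump_nonneg[of I "real A"] mean_sinc_le
      by (intro always_eventually allI) (smt (verit) real_norm_def)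
    show "AE x in lborel. (\<lambda>A. \<bar>mean_sinc I x - bump I (real A) x\<bar>) \<longlonglongrightarrow> 0"
    proof (rule always_eventually, rule allI, rule tendsto_eventually)
      fix x :: real
      obtain N where N: "\<bar>x\<bar> \<le> real N"
        using real_arch_simple by blast
      show "\<forall>\<^sub>F A in sequentially. \<bar>mean_sinc I x - bump I (real A) x\<bar> = 0"
        using eventually_ge_at_top[of N]
      proof eventually_elim
        case (elim A)
        then have "cutoff (real A) x = 1"
          using N by (simp add: cutoff_def)
        then show ?case by (simp add: bump_def)
      qed
    qed
  qed
  then show ?thesis by simp
qed

end

section \<open>The test functions under the circular beta ensemble\<close>

text \<open>\<open>Arg\<close> is continuous off the nonpositive real axis and takes only the values
  0, at the origin, and pi on it.\<close>

lemma borel_measurable_Arg [measurable]: "Arg \<in> borel_measurable borel"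
proof (rule measurable_piecewise_restrict[where C = "{\<real>\<^sub>\<le>\<^sub>0, - \<real>\<^sub>\<le>\<^sub>0}"])
  fix S :: "complex set" assume S: "S \<in> {\<real>\<^sub>\<le>\<^sub>0, - \<real>\<^sub>\<le>\<^sub>0}"
  show "S \<inter> space borel \<in> sets borel"
    using S by auto
  show "Arg \<in> borel_measurable (restrict_space borel S)"
  proof (cases "S = - \<real>\<^sub>\<le>\<^sub>0")
    case True
    then show ?thesis
      using borel_measurable_continuous_on_restrict[OF continuous_on_Arg] by simp
  next
    case False
    then have S': "S = \<real>\<^sub>\<le>\<^sub>0" using S by auto
    have "Arg x = (if x = 0 then 0 else pi)" if "x \<in> \<real>\<^sub>\<le>\<^sub>0" for x
    proof (cases "x = 0")
      case False
      then have "Re x < 0" "Im x = 0"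
        using that by (auto simp: complex_nonpos_Reals_iff complex_eq_iff)
      then show ?thesis
        using False by (simp add: Arg_eq_pi)
    qed (simp add: Arg_zero)
    then have "Arg \<in> borel_measurable (restrict_space borel S) \<longleftrightarrow>
        (\<lambda>x. if x = 0 then 0 else pi) \<in> borel_measurable (restrict_space borel S)"
      unfolding S' by (intro measurable_cong) (simp add: space_restrict_space)
    then show ?thesis
      by (simp add: measurable_restrict_space1)
  qed
qed auto

lemma angle_bounds:
  assumes "0 < (r::real)"
  shows "- pi < 2 * pi / r * x \<longleftrightarrow> - r / 2 < x" "- pi \<le> 2 * pi / r * x \<longleftrightarrow> - r / 2 \<le> x"
    and "2 * pi / r * x < pi \<longleftrightarrow> x < r / 2"
proof -
  have eq: "2 * pi / r * x = pi * (2 * x / r)"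
    by simp
  show "- pi < 2 * pi / r * x \<longleftrightarrow> - r / 2 < x"
    unfolding eq using mult_less_cancel_left_pos[of pi "- 1" "2 * x / r"] assms by (simp add: field_simps)
  show "- pi \<le> 2 * pi / r * x \<longleftrightarrow> - r / 2 \<le> x"
    unfolding eq using mult_le_cancel_left_pos[of pi "- 1" "2 * x / r"] assms by (simp add: field_simps)
  show "2 * pi / r * x < pi \<longleftrightarrow> x < r / 2"
    unfolding eq using mult_less_cancel_left_pos[of pi "2 * x / r" 1] assms by (simp add: field_simps)
qed

definition line_coordinate :: "nat \<Rightarrow> complex \<Rightarrow> real" where
  "line_coordinate n u = real n * Arg u / (2 * pi)"

lemma borel_measurable_line_coordinate [measurable]: "line_coordinate n \<in> borel_measurable borel"
  unfolding line_coordinate_def[abs_def] by measurable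

text \<open>A uniform point has a uniform line coordinate on a window of length n, hence the
  division by n. Angles reach [-pi, pi) by way of [pi, 3 pi), since the window lemma takes
  nonnegative starting points.\<close>

lemma nn_integral_circle_l1_error:
  assumes "I \<subseteq> {1..L}" "I \<noteq> {}" and n: "n = 2 ^ L * Suc s"
  shows "(\<integral>\<^sup>+u. ennreal \<bar>mean_fejer I n u - bump I A (line_coordinate n u)\<bar> \<partial>circle_uniform)
    = ennreal (l1_error I A n / real n)"
proof -
  let ?g = "\<lambda>u. ennreal \<bar>mean_fejer I n u - bump I A (line_coordinate n u)\<bar>"
  let ?h = "\<lambda>x. l1_integrand I A n x"
  have "0 < n" using n by simp
  then have n0: "0 < real n" by simp
  have [measurable]: "?g \<in> borel_measurable borel"
    by measurable
  have "(\<integral>\<^sup>+t. ?g (cis t) * indicator {0..<2 * pi} t \<partial>lborel)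
      = (\<integral>\<^sup>+t. ?g (cis t) * indicator {pi..<pi + 2 * pi} t \<partial>lborel)"
    by (rule nn_integral_cis_window[symmetric]) auto
  also have "\<dots> = (\<integral>\<^sup>+t. ?g (cis (2 * pi + 1 * t)) * indicator {pi..<pi + 2 * pi} (2 * pi + 1 * t) \<partial>lborel)"
    by (subst nn_integral_real_affine[where c = 1 and t = "2 * pi"]) auto
  also have "\<dots> = (\<integral>\<^sup>+t. ?g (cis t) * indicator {- pi..<pi} t \<partial>lborel)"
    by (intro nn_integral_cong arg_cong2[of _ _ _ _ "(*)"]) (auto split: split_indicator simp: cis_mult[symmetric])
  also have "\<dots> = ennreal (2 * pi / real n) * (\<integral>\<^sup>+x. ?g (cis (0 + 2 * pi / real n * x)) * indicator {- pi..<pi} (0 + 2 * pi / real n * x) \<partial>lborel)"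
    using n0 by (subst nn_integral_real_affine[where c = "2 * pi / real n" and t = 0]) auto
  also have "(\<integral>\<^sup>+x. ?g (cis (0 + 2 * pi / real n * x)) * indicator {- pi..<pi} (0 + 2 * pi / real n * x) \<partial>lborel)
     = (\<integral>\<^sup>+x. ennreal (?h x) \<partial>lborel)"
  proof (rule nn_integral_cong_AE)
    show "AE x in lborel. ?g (cis (0 + 2 * pi / real n * x)) * indicator {- pi..<pi} (0 + 2 * pi / real n * x) = ennreal (?h x)"
      \<comment> \<open>\<open>Arg\<close> has values in (-pi, pi], so the left endpoint would be
        sent to n / 2; it is discarded as a null set.\<close>
      using AE_lborel_singleton[of "- real n / 2"]
    proof eventually_elim
      case (elim x)
      have iff: "2 * pi / real n * x \<in> {- pi..<pi} \<longleftrightarrow> x \<in> {- real n / 2..<real n / 2}"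
        using angle_bounds[OF n0, of x] by auto
      show ?case
      proof (cases "x \<in> {- real n / 2..<real n / 2}")
        case True
        then have "2 * pi / real n * x \<in> {- pi<..pi}"
          using elim angle_bounds[OF n0, of x] by auto
        then have "Arg (cis (2 * pi / real n * x)) = 2 * pi / real n * x"
          by (rule Arg_cis)
        then have "line_coordinate n (cis (2 * pi / real n * x)) = x"
          using n0 by (simp add: line_coordinate_def)
        then show ?thesis
          using True iff by simp
      next
        case False
        then have "2 * pi / real n * x \<notin> {- pi..<pi}"
          using iff by blast
        then have 1: "indicator {- pi..<pi} (0 + 2 * pi / real n * x) = (0 :: ennreal)"
          unfolding add_0_left by (rule indicator_simps(2))
        have 2: "indicator {- real n / 2..<real n / 2} x = (0 :: real)"
          using False by (rule indicator_simps(2))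
        show ?thesis
          unfolding 1 2 by simp
      qed
    qed
  qed
  also have "\<dots> = ennreal (l1_error I A n)"
    unfolding l1_error_def
    by (rule nn_integral_eq_integral[OF integrable_l1_integrand[OF assms]]) auto
  finally have "(\<integral>\<^sup>+u. ?g u \<partial>circle_uniform) = ennreal (2 * pi / real n) * ennreal (l1_error I A n) / ennreal (2 * pi)"
    by (simp add: nn_integral_circle_uniform)
  also have "\<dots> = ennreal (2 * pi / real n * l1_error I A n / (2 * pi))"
  proof -
    have "0 \<le> l1_error I A n"
      unfolding l1_error_def by (intro integral_nonneg_AE always_eventually allI) simp
    then show ?thesis
      using n0 by (simp add: ennreal_mult[symmetric] divide_ennreal)
  qed
  also have "2 * pi / real n * l1_error I A n / (2 * pi) = l1_error I A n / real n"
    by simp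
  finally show ?thesis .
qed

text \<open>Counting measure of a set forgets multiplicities, so the points must be distinct. A
  function vanishing for |x| \<ge> n / 2 sees only the principal determination of each angle in the
  periodic set.\<close>

lemma integral_counting_measure:
  fixes \<phi> :: "real \<Rightarrow> real"
  assumes [measurable]: "\<phi> \<in> borel_measurable borel"
    and unit: "\<forall>j<n. cmod (z j) = 1" and inj: "inj_on z {..<n}"
    and supp: "\<And>x. real n / 2 \<le> \<bar>x\<bar> \<Longrightarrow> \<phi> x = 0"
  shows "(\<integral>x. \<phi> x \<partial>counting_measure (scaled_eigenangles n z)) = (\<Sum>j<n. \<phi> (line_coordinate n (z j)))"
proof -
  let ?E = "scaled_eigenangles n z" and ?x = "\<lambda>j. line_coordinate n (z j)"
  have cis_x: "cis (2 * pi * ?x j / real n) = z j" if "j < n" for j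
  proof -
    have "z j \<noteq> 0" "sgn (z j) = z j"
      using unit that by (auto simp: sgn_eq)
    then show ?thesis
      using cis_Arg[of "z j"] that by (simp add: line_coordinate_def)
  qed
  have eq: "{x \<in> ?E. \<phi> x \<noteq> 0} = {x \<in> ?x ` {..<n}. \<phi> x \<noteq> 0}"
  proof (intro set_eqI iffI; clarsimp)
    fix x assume x: "x \<in> ?E" "\<phi> x \<noteq> 0"
    then have small: "\<bar>x\<bar> < real n / 2"
      using supp[of x] by linarith
    obtain j where j: "j < n" "cis (2 * pi * x / real n) = z j"
      using x(1) by (auto simp: scaled_eigenangles_def)
    have "2 * pi / real n * x \<in> {- pi<..pi}"
      using small j(1) angle_bounds[of "real n" x] by auto
    then have "2 * pi * x / real n \<in> {- pi<..pi}"
      by simp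
    then have "Arg (z j) = 2 * pi * x / real n"
      using Arg_cis j(2) by metis
    then have "?x j = x"
      using j(1) by (simp add: line_coordinate_def)
    then show "x \<in> ?x ` {..<n}"
      using j(1) by blast
  next
    fix j assume "j < n"
    then show "?x j \<in> ?E"
      by (auto simp: scaled_eigenangles_def cis_x)
  qed
  have inj_x: "inj_on ?x {..<n}"
  proof (rule inj_onI)
    fix j k assume "j \<in> {..<n}" "k \<in> {..<n}" "?x j = ?x k"
    then have "z j = z k"
      using cis_x by (metis lessThan_iff)
    then show "j = k"
      using \<open>j \<in> {..<n}\<close> \<open>k \<in> {..<n}\<close> by (rule inj_onD[OF inj])
  qed
  have "(\<integral>x. \<phi> x \<partial>counting_measure ?E) = (\<integral>x. \<phi> x \<partial>count_space ?E)"
    unfolding counting_measure_def by (subst integral_distr) auto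
  also have "\<dots> = (\<Sum>x | x \<in> ?E \<and> \<phi> x \<noteq> 0. \<phi> x)"
    by (rule lebesgue_integral_count_space_finite_support) (simp add: eq)
  also have "\<dots> = (\<Sum>x\<in>?x ` {..<n}. \<phi> x)"
    unfolding eq by (rule sum.mono_neutral_left) auto
  also have "\<dots> = (\<Sum>j<n. \<phi> (?x j))"
    by (rule sum.reindex_cong[OF inj_x]) auto
  finally show ?thesis .
qed

lemma inj_on_if_weight_nonzero:
  assumes "vandermonde_weight \<beta> n z \<noteq> 0"
  shows "inj_on z {..<n}"
proof (rule inj_onI)
  fix j k assume "j \<in> {..<n}" "k \<in> {..<n}" "z j = z k"
  then show "j = k"
    using vandermonde_weight_eq_0[of j n k z \<beta>] vandermonde_weight_eq_0[of k n j z \<beta>] assms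
    by (metis lessThan_iff linorder_neqE_nat)
qed

text \<open>An arithmetic-geometric mean inequality that turns a second moment into a first moment,
  in place of Cauchy-Schwarz.\<close>

lemma abs_le_square_div: "0 < s \<Longrightarrow> \<bar>v\<bar> \<le> s + v\<^sup>2 / (s::real)"
proof -
  assume s: "0 < s"
  have "0 \<le> (\<bar>v\<bar> - s)\<^sup>2" by simp
  then have "2 * (\<bar>v\<bar> * s) \<le> s * s + v\<^sup>2"
    by (simp add: power2_eq_square algebra_simps)
  then have "\<bar>v\<bar> * s \<le> s * s + v\<^sup>2"
    using s by (smt (verit) mult_nonneg_nonneg)
  then show ?thesis
    using s by (simp add: field_simps)
qed

text \<open>The functional is at most the absolute centred Fejer statistic plus the errors at the n
  points. The former has mean at most e + e^2 / e = 2 e, the latter contribute n times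
  \<open>l1_error I A n / real n\<close>.\<close>

lemma cbe_test_function_bound:
  assumes \<beta>: "0 < \<beta>" and I: "I \<subseteq> {1..L}" "I \<noteq> {}" and n: "n = 2 ^ L * Suc s"
    and A: "0 \<le> A" "A + 1 \<le> real n / 2" and e: "0 < e" "64 / (\<beta> * real (card I)) \<le> e\<^sup>2"
  shows "(\<integral>v. min 1 \<bar>(\<integral>x. bump I A x \<partial>counting_measure (scaled_eigenangles n v)) - (\<Sum>i\<in>I. 2 ^ i) / real (card I)\<bar>
      \<partial>circular_beta_ensemble \<beta> n) \<le> 2 * e + l1_error I A n"
proof -
  let ?w = "vandermonde_weight \<beta> n" and ?c = "(\<Sum>i\<in>I. 2 ^ i) / real (card I)"
  let ?F = "\<lambda>v. min 1 \<bar>(\<integral>x. bump I A x \<partial>counting_measure (scaled_eigenangles n v)) - ?c\<bar>"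
  let ?V = "\<lambda>z. (\<Sum>j<n. mean_fejer I n (z j)) - ?c"
  let ?g = "\<lambda>u. \<bar>mean_fejer I n u - bump I A (line_coordinate n u)\<bar>"
  let ?Q = "\<lambda>z. ?w z * (e + (?V z)\<^sup>2 / e)" and ?G = "\<lambda>j z. ennreal (?w z) * ennreal (?g (z j))"
  define Z where "Z = (\<integral>\<^sup>+z. ennreal (?w z) \<partial>torus n)"
  define W where "W = (\<integral>z. ?w z \<partial>torus n)"
  have cbe: "circular_beta_ensemble \<beta> n = density (torus n) (\<lambda>z. ennreal (?w z) / Z)"
    by (simp add: circular_beta_ensemble_def Z_def Let_def)
  have int_w: "integrable (torus n) ?w"
    using integrable_vandermonde_tame[of \<beta> n "\<lambda>_. 1"] \<beta> by (simp add: tame_const)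
  have W: "0 \<le> W"
    unfolding W_def by (intro integral_nonneg_AE always_eventually allI vandermonde_weight_nonneg)
  have Z: "Z = ennreal W"
    unfolding Z_def W_def by (rule nn_integral_eq_integral[OF int_w]) (simp add: vandermonde_weight_nonneg)
  have n0: "0 < n" using n by simp
  have err: "0 \<le> l1_error I A n"
    unfolding l1_error_def by (intro integral_nonneg_AE always_eventually allI) simp
  show ?thesis
  proof (cases "integrable (circular_beta_ensemble \<beta> n) ?F")
    \<comment> \<open>A non-integrable function has integral 0 by convention, so the bound is
      immediate. In the other case integrability supplies the measurability of the
      functional.\<close>
    case False
    then show ?thesis
      using e err by (simp add: not_integrable_integral_eq)
  next
    case True
    then have "?F \<in> borel_measurable (circular_beta_ensemble \<beta> n)"
      by (rule borel_measurable_integrable)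
    then have F [measurable]: "?F \<in> borel_measurable (torus n)"
      by (simp add: cbe)
    have nV: "tame n (\<lambda>z. e + (?V z)\<^sup>2 / e)" "tame n (\<lambda>z. (?V z)\<^sup>2)"
      unfolding divide_inverse[of _ e] by (intro tame_add tame_mult tame_power tame_diff tame_sum tame_mean_fejer tame_const, simp)+
    have int_V: "integrable (torus n) (\<lambda>z. ?Q z)" "integrable (torus n) (\<lambda>z. ?w z * (?V z)\<^sup>2)"
      using \<beta> nV by (auto intro!: integrable_vandermonde_tame)
    have bound: "AE z in torus n. ennreal (?w z) * ennreal (?F z)
       \<le> ennreal (?Q z) + (\<Sum>j<n. ?G j z)"
      using AE_torus[of n]
    proof eventually_elim
      case (elim z)
      show ?case
      \<comment> \<open>Distinctness of the points comes from a nonzero weight; where the weight is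
        0 the left side vanishes.\<close>
      proof (cases "?w z = 0")
        case False
        have "(\<integral>x. bump I A x \<partial>counting_measure (scaled_eigenangles n z)) = (\<Sum>j<n. bump I A (line_coordinate n (z j)))"
          using A by (intro integral_counting_measure borel_measurable_bump elim inj_on_if_weight_nonzero[OF False] bump_eq_0) auto
        then have "?F z \<le> \<bar>?V z - (\<Sum>j<n. mean_fejer I n (z j) - bump I A (line_coordinate n (z j)))\<bar>"
          by (simp add: sum_subtractf)
        also have "\<dots> \<le> \<bar>?V z\<bar> + (\<Sum>j<n. ?g (z j))"
          by (rule order_trans[OF abs_triangle_ineq4 add_left_mono[OF sum_abs]])
        also have "\<dots> \<le> (e + (?V z)\<^sup>2 / e) + (\<Sum>j<n. ?g (z j))"
          by (intro add_right_mono abs_le_square_div e)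
        finally have "?w z * ?F z \<le> ?w z * ((e + (?V z)\<^sup>2 / e) + (\<Sum>j<n. ?g (z j)))"
          by (rule mult_left_mono[OF _ vandermonde_weight_nonneg])
        then have "ennreal (?w z * ?F z) \<le> ennreal (?Q z + (\<Sum>j<n. ?w z * ?g (z j)))"
          by (intro ennreal_leI) (simp only: distrib_left sum_distrib_left)
        also have "\<dots> = ennreal (?Q z) + (\<Sum>j<n. ennreal (?w z * ?g (z j)))"
          using e by (subst ennreal_plus)
            (auto intro!: mult_nonneg_nonneg sum_nonneg add_nonneg_nonneg vandermonde_weight_nonneg simp: sum_ennreal vandermonde_weight_nonneg)
        finally show ?thesis
          by (simp add: ennreal_mult vandermonde_weight_nonneg)
      qed simp
    qed
    have first: "(\<integral>\<^sup>+z. ennreal (?Q z) \<partial>torus n) \<le> ennreal (2 * e) * Z"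
    proof -
      have "(\<integral>\<^sup>+z. ennreal (?Q z) \<partial>torus n) = ennreal (\<integral>z. ?Q z \<partial>torus n)"
        using e by (intro nn_integral_eq_integral int_V) (auto intro!: mult_nonneg_nonneg vandermonde_weight_nonneg add_nonneg_nonneg)
      also have "(\<integral>z. ?Q z \<partial>torus n) = (\<integral>z. e * ?w z + (?w z * (?V z)\<^sup>2) / e \<partial>torus n)"
        by (simp add: distrib_left mult.commute)
      also have "\<dots> = e * W + (\<integral>z. ?w z * (?V z)\<^sup>2 \<partial>torus n) / e"
        unfolding W_def using int_w int_V(2) by simp
      also have "\<dots> \<le> e * W + (64 / (\<beta> * real (card I)) * W) / e"
        using mean_fejer_variance[OF \<beta> n0 _ I, of] e n unfolding W_def
        by (intro add_left_mono divide_right_mono) auto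
      also have "\<dots> \<le> e * W + (e\<^sup>2 * W) / e"
        using e W by (intro add_left_mono divide_right_mono mult_right_mono) auto
      also have "\<dots> = 2 * e * W"
        using e by (simp add: power2_eq_square)
      finally show ?thesis
        using e W by (simp add: Z ennreal_mult[symmetric] ennreal_leI)
    qed
    have meas: "(\<lambda>z. ?G j z) \<in> borel_measurable (torus n)" if "j < n" for j
    proof (rule borel_measurable_times_ennreal)
      have "(\<lambda>u. ennreal (?g u)) \<in> borel_measurable borel"
        by measurable
      then show "(\<lambda>z. ennreal (?g (z j))) \<in> borel_measurable (torus n)"
        by (rule measurable_compose[OF borel_measurable_coordinate[OF that]])
    qed measurable
    then have meas_sum: "(\<lambda>z. \<Sum>j<n. ?G j z) \<in> borel_measurable (torus n)"
      by (intro borel_measurable_sum) simp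
    have second: "(\<integral>\<^sup>+z. (\<Sum>j<n. ?G j z) \<partial>torus n) = ennreal (l1_error I A n) * Z"
    proof -
      have [measurable]: "?g \<in> borel_measurable borel"
        by measurable
      have "(\<integral>\<^sup>+z. (\<Sum>j<n. ?G j z) \<partial>torus n)
        = (\<Sum>j<n. \<integral>\<^sup>+z. ?G j z \<partial>torus n)"
        by (rule nn_integral_sum) (simp add: meas)
      also have "\<dots> = (\<Sum>j<n. Z * ennreal (l1_error I A n / real n))"
        unfolding Z_def nn_integral_circle_l1_error[OF I n, symmetric]
        by (intro sum.cong refl nn_integral_marginal) auto
      also have "\<dots> = ennreal (l1_error I A n) * Z"
        using n0 err W by (simp add: Z ennreal_mult[symmetric] ennreal_of_nat_eq_real_of_nat)
      finally show ?thesis .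
    qed
    have "(\<integral>\<^sup>+v. ennreal (?F v) \<partial>circular_beta_ensemble \<beta> n) = (\<integral>\<^sup>+z. ennreal (?w z) / Z * ennreal (?F z) \<partial>torus n)"
      unfolding cbe by (rule nn_integral_density) measurable
    also have "\<dots> = (\<integral>\<^sup>+z. (ennreal (?w z) * ennreal (?F z)) / Z \<partial>torus n)"
      by (intro nn_integral_cong) (simp add: divide_ennreal_def mult_ac)
    also have "\<dots> = (\<integral>\<^sup>+z. ennreal (?w z) * ennreal (?F z) \<partial>torus n) / Z"
      by (rule nn_integral_divide) measurable
    also have "\<dots> \<le> (\<integral>\<^sup>+z. ennreal (?Q z) + (\<Sum>j<n. ?G j z) \<partial>torus n) / Z"
      by (rule divide_right_mono_ennreal[OF nn_integral_mono_AE[OF bound]])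
    also have "\<dots> = ((\<integral>\<^sup>+z. ennreal (?Q z) \<partial>torus n) + ennreal (l1_error I A n) * Z) / Z"
      unfolding second[symmetric] using borel_measurable_integrable[OF int_V(1)] meas_sum
      by (subst nn_integral_add) auto
    also have "\<dots> \<le> (ennreal (2 * e) * Z + ennreal (l1_error I A n) * Z) / Z"
      by (intro divide_right_mono_ennreal add_right_mono first)
    also have "\<dots> = ennreal (2 * e + l1_error I A n) * Z / Z"
      using e err by (simp add: distrib_right[symmetric])
    \<comment> \<open>If W = 0 the quotient 0 / 0 is 0 in \<open>ennreal\<close>; otherwise Z is
      finite and nonzero and cancels.\<close>
    also have "\<dots> \<le> ennreal (2 * e + l1_error I A n)"
      unfolding Z by (cases "W = 0") (use W in \<open>auto simp: ennreal_mult_divide_eq\<close>)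
    finally show ?thesis
      using e err by (intro integral_real_bounded) auto
  qed
qed

section \<open>A criterion for rigidity\<close>

lemma borel_measurable_cong_on_space:
  "(\<And>w. w \<in> space N \<Longrightarrow> f w = g w) \<Longrightarrow> g \<in> borel_measurable N \<Longrightarrow> f \<in> borel_measurable N"
  by (simp cong: measurable_cong)

text \<open>Measurability is asked only for masses of Borel sets inside C, which lets the base carry
  the sigma-algebra \<open>point_sigma M X C\<close>. With C = \<open>UNIV\<close> it is the usual
  measurability of integrals against a random measure.\<close>

lemma borel_measurable_kernel_nn_integral:
  fixes X :: "'w \<Rightarrow> 'a::polish_space measure" and f :: "'a \<Rightarrow> ennreal"
  assumes sets: "\<And>w. w \<in> space N \<Longrightarrow> sets (X w) = sets borel"
    and meas: "\<And>A. A \<in> sets borel \<Longrightarrow> A \<subseteq> C \<Longrightarrow> (\<lambda>w. emeasure (X w) A) \<in> borel_measurable N"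
    and C: "C \<in> sets borel" and f: "f \<in> borel_measurable borel"
  shows "(\<lambda>w. \<integral>\<^sup>+x. f x * indicator C x \<partial>X w) \<in> borel_measurable N"
  using f
proof (induction f rule: borel_measurable_induct)
  have m: "g \<in> borel_measurable (X w)" if "w \<in> space N" "g \<in> borel_measurable borel" for g :: "'a \<Rightarrow> ennreal" and w
    using that by (simp add: measurable_cong_sets[OF sets refl])
  have ind: "(\<lambda>x. indicator C x :: ennreal) \<in> borel_measurable borel"
    using C by simp
  have mi: "(\<lambda>x. g x * indicator C x) \<in> borel_measurable (X w)"
    if "w \<in> space N" "g \<in> borel_measurable borel" for g :: "'a \<Rightarrow> ennreal" and w
    by (rule m[OF that(1) borel_measurable_times_ennreal[OF that(2) ind]])
  {
    case (cong f g)
    then have "f = g" by auto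
    then show ?case using cong by simp
  next
    case (set A)
    have eq: "(\<integral>\<^sup>+x. indicator A x * indicator C x \<partial>X w) = emeasure (X w) (A \<inter> C)" if "w \<in> space N" for w
    proof -
      have "A \<inter> C \<in> sets (X w)"
        using that set C by (simp add: sets)
      then have "(\<integral>\<^sup>+x. indicator (A \<inter> C) x \<partial>X w) = emeasure (X w) (A \<inter> C)"
        by (rule nn_integral_indicator)
      then show ?thesis
        by (simp only: indicator_inter_arith)
    qed
    show ?case
      by (rule borel_measurable_cong_on_space[OF eq], assumption, rule meas) (use set C in auto)
  next
    case (mult f c)
    have eq: "(\<integral>\<^sup>+x. c * f x * indicator C x \<partial>X w) = c * (\<integral>\<^sup>+x. f x * indicator C x \<partial>X w)" if "w \<in> space N" for w
      using nn_integral_cmult[OF mi[OF that mult(2)], of c] by (simp only: mult.assoc)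
    show ?case
      by (rule borel_measurable_cong_on_space[OF eq], assumption) (use mult in \<open>intro borel_measurable_times_ennreal, auto\<close>)
  next
    case (add f g)
    have eq: "(\<integral>\<^sup>+x. (g x + f x) * indicator C x \<partial>X w)
        = (\<integral>\<^sup>+x. g x * indicator C x \<partial>X w) + (\<integral>\<^sup>+x. f x * indicator C x \<partial>X w)" if "w \<in> space N" for w
      using nn_integral_add[OF mi[OF that add(3)] mi[OF that add(1)]] by (simp only: distrib_right)
    show ?case
      by (rule borel_measurable_cong_on_space[OF eq], assumption) (use add in \<open>intro borel_measurable_add, auto\<close>)
  next
    case (seq U)
    have eq: "(\<integral>\<^sup>+x. (SUP i. U i) x * indicator C x \<partial>X w) = (SUP i. \<integral>\<^sup>+x. U i x * indicator C x \<partial>X w)" if "w \<in> space N" for w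
    proof -
      have "(\<integral>\<^sup>+x. (SUP i. U i) x * indicator C x \<partial>X w) = (\<integral>\<^sup>+x. (SUP i. U i x * indicator C x) \<partial>X w)"
        by (simp add: SUP_mult_right_ennreal image_comp)
      also have "\<dots> = (SUP i. \<integral>\<^sup>+x. U i x * indicator C x \<partial>X w)"
        using seq(3) by (intro nn_integral_monotone_convergence_SUP mi[OF that seq(1)])
          (auto simp: incseq_def le_fun_def intro!: mult_right_mono)
      finally show ?thesis .
    qed
    show ?case
      by (rule borel_measurable_cong_on_space[OF eq], assumption) (use seq in \<open>intro borel_measurable_SUP, auto\<close>)
  }
qed

lemma space_point_sigma [simp]: "space (point_sigma M X C) = space M"
  by (simp add: point_sigma_def space_measure_of_conv)

lemma borel_measurable_point_sigma_emeasure: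
  assumes "A \<in> sets borel" "A \<subseteq> C"
  shows "(\<lambda>w. emeasure (X w) A) \<in> borel_measurable (point_sigma M X C)"
proof (rule measurableI)
  fix U :: "ennreal set" assume "U \<in> sets borel"
  then show "(\<lambda>w. emeasure (X w) A) -` U \<inter> space (point_sigma M X C) \<in> sets (point_sigma M X C)"
    using assms unfolding space_point_sigma unfolding point_sigma_def by (intro in_measure_of) auto
qed simp

lemma emeasure_compact_finite:
  assumes "\<mu> \<in> radon_measures" "compact K"
  shows "emeasure \<mu> K < \<infinity>"
proof -
  have sets: "sets \<mu> = sets borel"
    using assms by (simp add: radon_measures_def)
  have "\<forall>x. \<exists>U. open U \<and> x \<in> U \<and> emeasure \<mu> U < \<infinity>"
    using assms by (simp add: radon_measures_def)
  then obtain U where U: "\<And>x. open (U x)" "\<And>x. x \<in> U x" "\<And>x. emeasure \<mu> (U x) < \<infinity>"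
    by metis
  have "K \<subseteq> (\<Union>x\<in>K. U x)" using U(2) by auto
  then obtain F where F: "F \<subseteq> K" "finite F" "K \<subseteq> (\<Union>x\<in>F. U x)"
    using compactE_image[OF assms(2), of K U] U(1) by metis
  have "emeasure \<mu> K \<le> emeasure \<mu> (\<Union>x\<in>F. U x)"
    using F U by (intro emeasure_mono) (auto simp: sets)
  also have "\<dots> \<le> (\<Sum>x\<in>F. emeasure \<mu> (U x))"
    using F U by (intro emeasure_subadditive_finite) (auto simp: sets)
  also have "\<dots> < \<infinity>"
    using F U by simp
  finally show ?thesis .
qed

text \<open>The subbasic set given by the zero test function and \<open>UNIV\<close> already
  contains every Radon measure.\<close>

lemma topspace_vague: "topspace vague_topology = radon_measures"
proof -
  have "(\<lambda>x. 0) \<in> test_functions"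
    by (auto simp: test_functions_def intro!: exI[of _ "{}"])
  then have "{\<mu> \<in> radon_measures. (\<integral>x. 0 \<partial>\<mu>) \<in> (UNIV :: real set)}
     \<in> {{\<mu> \<in> radon_measures. (\<integral>x. \<phi> x \<partial>\<mu>) \<in> U} | \<phi> U. \<phi> \<in> test_functions \<and> open U}"
    by (intro CollectI exI[of _ "\<lambda>x. 0"] exI[of _ UNIV]) simp
  then show ?thesis
    unfolding vague_topology_def topology_generated_by_topspace by auto
qed

lemma continuous_map_vague_integral:
  assumes "\<phi> \<in> test_functions"
  shows "continuous_map vague_topology euclideanreal (\<lambda>\<mu>. \<integral>x. \<phi> x \<partial>\<mu>)"
  unfolding continuous_map_def
proof (intro conjI allI impI)
  show "(\<lambda>\<mu>. \<integral>x. \<phi> x \<partial>\<mu>) \<in> topspace vague_topology \<rightarrow> topspace euclideanreal"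
    by simp
  fix U :: "real set" assume "openin euclideanreal U"
  then have "open U" by simp
  then have "openin vague_topology {\<mu> \<in> radon_measures. (\<integral>x. \<phi> x \<partial>\<mu>) \<in> U}"
    unfolding vague_topology_def using assms by (intro topology_generated_by_Basis) auto
  then show "openin vague_topology {\<mu> \<in> topspace vague_topology. (\<integral>x. \<phi> x \<partial>\<mu>) \<in> U}"
    by (simp add: topspace_vague)
qed

lemma point_configurations_radon: "point_configurations \<subseteq> radon_measures"
  by (auto simp: point_configurations_def)

lemma radon_sets: "\<mu> \<in> radon_measures \<Longrightarrow> sets \<mu> = sets borel"
  by (simp add: radon_measures_def)

context
  fixes M :: "'w measure" and X :: "'w \<Rightarrow> real measure"
  assumes X: "point_process M X"
begin

lemma process_radon: "w \<in> space M \<Longrightarrow> X w \<in> radon_measures"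
  using X point_configurations_radon by (auto simp: point_process_def)

lemma process_sets: "w \<in> space M \<Longrightarrow> sets (X w) = sets borel"
  using process_radon radon_sets by blast

lemma borel_measurable_process_integral:
  fixes \<phi> :: "real \<Rightarrow> real"
  assumes "\<phi> \<in> borel_measurable borel" "\<And>x. 0 \<le> \<phi> x"
  shows "(\<lambda>w. \<integral>x. \<phi> x \<partial>X w) \<in> borel_measurable M"
proof -
  have "(\<lambda>w. \<integral>\<^sup>+x. ennreal (\<phi> x) * indicator UNIV x \<partial>X w) \<in> borel_measurable M"
    using X assms(1) by (intro borel_measurable_kernel_nn_integral process_sets) (auto simp: point_process_def)
  then have "(\<lambda>w. enn2real (\<integral>\<^sup>+x. ennreal (\<phi> x) * indicator UNIV x \<partial>X w)) \<in> borel_measurable M"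
    by (rule borel_measurable_enn2real)
  moreover have "(\<integral>x. \<phi> x \<partial>X w) = enn2real (\<integral>\<^sup>+x. ennreal (\<phi> x) * indicator UNIV x \<partial>X w)" if "w \<in> space M" for w
    using assms by (subst integral_eq_nn_integral) (auto simp: measurable_cong_sets[OF process_sets[OF that] refl])
  ultimately show ?thesis
    by (simp cong: measurable_cong)
qed

end

text \<open>A Borel-Cantelli argument without events: the expectations are summable, so the series
  of the \<open>F k\<close> converges almost surely and its terms tend to 0.\<close>

lemma AE_tendsto_0_if_expectation_small:
  fixes F :: "nat \<Rightarrow> 'w \<Rightarrow> real"
  assumes "prob_space M" and [measurable]: "\<And>k. F k \<in> borel_measurable M"
    and bounds: "\<And>k w. 0 \<le> F k w" "\<And>k w. F k w \<le> 1"
    and small: "\<And>k. (\<integral>w. F k w \<partial>M) \<le> (1 / 2) ^ k"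
  shows "AE w in M. (\<lambda>k. F k w) \<longlonglongrightarrow> 0"
proof -
  interpret prob_space M by fact
  have int: "integrable M (F k)" for k
    using bounds by (intro integrable_const_bound[where B = 1]) auto
  have "(\<integral>\<^sup>+w. (\<Sum>k. ennreal (F k w)) \<partial>M) = (\<Sum>k. \<integral>\<^sup>+w. ennreal (F k w) \<partial>M)"
    by (rule nn_integral_suminf) measurable
  also have "\<dots> \<le> (\<Sum>k. ennreal ((1 / 2) ^ k))"
  proof (intro suminf_le allI)
    show "(\<integral>\<^sup>+w. ennreal (F k w) \<partial>M) \<le> ennreal ((1 / 2) ^ k)" for k
      using bounds small[of k] by (subst nn_integral_eq_integral[OF int]) (auto intro: ennreal_leI)
  qed auto
  also have "\<dots> = ennreal (\<Sum>k. (1 / 2) ^ k)"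
    by (rule suminf_ennreal2) (auto intro: summable_geometric)
  also have "\<dots> < \<infinity>" by simp
  finally have "(\<integral>\<^sup>+w. (\<Sum>k. ennreal (F k w)) \<partial>M) \<noteq> \<infinity>" by simp
  then have "AE w in M. (\<Sum>k. ennreal (F k w)) \<noteq> \<infinity>"
    by (intro nn_integral_PInf_AE) measurable
  then show ?thesis
  proof eventually_elim
    case (elim w)
    then have "summable (\<lambda>k. F k w)"
      using bounds by (intro summable_suminf_not_top) auto
    then show ?case
      by (rule summable_LIMSEQ_zero)
  qed
qed

lemma tendsto_0_min_1:
  fixes f :: "nat \<Rightarrow> real"
  assumes "(\<lambda>k. min 1 \<bar>f k\<bar>) \<longlonglongrightarrow> 0"
  shows "f \<longlonglongrightarrow> 0"
proof -
  have "\<forall>\<^sub>F k in sequentially. min 1 \<bar>f k\<bar> < 1"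
    using order_tendstoD(2)[OF assms, of 1] by simp
  then have "\<forall>\<^sub>F k in sequentially. min 1 \<bar>f k\<bar> = \<bar>f k\<bar>"
    by eventually_elim auto
  then have "(\<lambda>k. \<bar>f k\<bar>) \<longlonglongrightarrow> 0"
    by (rule Lim_transform_eventually[OF assms])
  then show ?thesis
    by (rule tendsto_rabs_zero_cancel)
qed

text \<open>Errors of \<open>(1 / 2) ^ k\<close> are summable, which upgrades closeness in
  probability to almost sure convergence. The sum over the points in B differs from X(B) by at most
  \<open>(1 / 2) ^ k\<close> times X(B), which is finite because B is bounded.\<close>

lemma rigidity_criterion:
  fixes M :: "'w measure" and X :: "'w \<Rightarrow> real measure"
  assumes X: "point_process M X"
    and approx: "\<And>b \<eta>. 0 < \<eta> \<Longrightarrow> \<exists>\<phi> c. \<phi> \<in> test_functions \<and> (\<forall>x. 0 \<le> \<phi> x) \<and>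
        (\<forall>x. \<bar>x\<bar> \<le> b \<longrightarrow> \<bar>\<phi> x - 1\<bar> \<le> \<eta>) \<and>
        (\<integral>w. min 1 \<bar>(\<integral>x. \<phi> x \<partial>X w) - c\<bar> \<partial>M) \<le> \<eta>"
    and B: "B \<in> sets borel" "bounded B"
  shows "\<exists>Y\<in>borel_measurable (point_sigma M X (UNIV - B)). AE w in M. emeasure (X w) B = Y w"
proof -
  let ?N = "point_sigma M X (UNIV - B)"
  obtain b where b: "\<And>x. x \<in> B \<Longrightarrow> \<bar>x\<bar> \<le> b"
    using B(2) unfolding bounded_iff by auto
  have "\<exists>\<phi> c. \<phi> \<in> test_functions \<and> (\<forall>x. 0 \<le> \<phi> x) \<and>
        (\<forall>x. \<bar>x\<bar> \<le> b \<longrightarrow> \<bar>\<phi> x - 1\<bar> \<le> (1 / 2) ^ k) \<and>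
        (\<integral>w. min 1 \<bar>(\<integral>x. \<phi> x \<partial>X w) - c\<bar> \<partial>M) \<le> (1 / 2) ^ k" for k :: nat
    by (rule approx) simp
  then obtain \<phi> c where \<phi>: "\<And>k. \<phi> k \<in> test_functions" "\<And>k x. 0 \<le> \<phi> k x"
    "\<And>k x. \<bar>x\<bar> \<le> b \<Longrightarrow> \<bar>\<phi> k x - 1\<bar> \<le> (1 / 2) ^ k"
    "\<And>k. (\<integral>w. min 1 \<bar>(\<integral>x. \<phi> k x \<partial>X w) - c k\<bar> \<partial>M) \<le> (1 / 2) ^ k"
    by metis
  have meas_\<phi> [measurable]: "\<phi> k \<in> borel_measurable borel" for k
    using \<phi>(1)[of k] by (auto simp: test_functions_def intro: borel_measurable_continuous_onI)
  \<comment> \<open>As \<open>enn2real\<close> of a nonnegative integral this is measurable for the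
    points outside B alone; it becomes a Bochner integral once integrability is known.\<close>
  define out where "out = (\<lambda>k w. enn2real (\<integral>\<^sup>+x. ennreal (\<phi> k x) * indicator (UNIV - B) x \<partial>X w))"
  have meas_out [measurable]: "out k \<in> borel_measurable ?N" for k
    unfolding out_def using B(1)
    by (intro borel_measurable_enn2real borel_measurable_kernel_nn_integral borel_measurable_point_sigma_emeasure)
      (auto simp: process_sets[OF X])
  have "AE w in M. (\<lambda>k. min 1 \<bar>(\<integral>x. \<phi> k x \<partial>X w) - c k\<bar>) \<longlonglongrightarrow> 0"
  proof (rule AE_tendsto_0_if_expectation_small)
    show "prob_space M"
      using X by (simp add: point_process_def)
    show "(\<lambda>w. min 1 \<bar>(\<integral>x. \<phi> k x \<partial>X w) - c k\<bar>) \<in> borel_measurable M" for k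
      using borel_measurable_process_integral[OF X meas_\<phi> \<phi>(2)] by measurable
  qed (use \<phi>(4) in auto)
  \<comment> \<open>\<open>lim\<close> has a value even where the sequence diverges and is
    measurable as a function of w, so it defines the required variable everywhere.\<close>
  then have "AE w in M. emeasure (X w) B = ennreal (lim (\<lambda>k. c k - out k w))"
    using AE_space
  proof eventually_elim
    case (elim w)
    have radon: "X w \<in> radon_measures" and sets: "sets (X w) = sets borel"
      using process_radon[OF X elim(2)] process_sets[OF X elim(2)] by auto
    have B_sets: "B \<in> sets (X w)"
      using B(1) sets by simp
    have "emeasure (X w) B \<le> emeasure (X w) {- b..b}"
      using b sets by (intro emeasure_mono) (force simp: abs_le_iff)+
    also have "\<dots> < \<infinity>"
      by (rule emeasure_compact_finite[OF radon]) simp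
    finally have B_fin: "emeasure (X w) B < \<infinity>" .
    have m\<phi>: "\<phi> k \<in> borel_measurable (X w)" for k
      by (simp add: measurable_cong_sets[OF sets refl])
    have int: "integrable (X w) (\<phi> k)" for k
    proof -
      obtain K where K: "compact K" "\<And>x. x \<notin> K \<Longrightarrow> \<phi> k x = 0" and cont: "continuous_on UNIV (\<phi> k)"
        using \<phi>(1)[of k] by (auto simp: test_functions_def)
      have "compact (\<phi> k ` K)"
        using K(1) cont by (intro compact_continuous_image) (auto intro: continuous_on_subset)
      then obtain C where C: "\<And>x. x \<in> K \<Longrightarrow> norm (\<phi> k x) \<le> C"
        using compact_imp_bounded[of "\<phi> k ` K"] unfolding bounded_iff by blast
      have "integrable (X w) (\<lambda>x. C * indicator K x)"
        using K(1) sets emeasure_compact_finite[OF radon K(1)]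
        by (intro integrable_mult_right integrable_real_indicator) (auto simp: borel_compact)
      then show ?thesis
        by (rule Bochner_Integration.integrable_bound[OF _ m\<phi>])
          (intro always_eventually allI, use C K(2) in \<open>auto split: split_indicator\<close>, fastforce)
    qed
    define inn where "inn = (\<lambda>k. \<integral>x. \<phi> k x * indicator B x \<partial>X w)"
    have int_in: "integrable (X w) (\<lambda>x. \<phi> k x * indicator B x)" for k
      using integrable_mult_indicator[OF B_sets int[of k]] by (simp add: mult.commute)
    have B_co: "UNIV - B \<in> sets (X w)"
      using B(1) sets by auto
    have int_out: "integrable (X w) (\<lambda>x. \<phi> k x * indicator (UNIV - B) x)" for k
      using integrable_mult_indicator[OF B_co int[of k]] by (simp add: mult.commute)
    have out_eq: "out k w = (\<integral>x. \<phi> k x * indicator (UNIV - B) x \<partial>X w)" for k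
      unfolding out_def using \<phi>(2) int_out[of k]
      by (subst integral_eq_nn_integral) (auto simp: ennreal_mult ennreal_indicator[symmetric] simp del: ennreal_indicator)
    have split: "(\<integral>x. \<phi> k x \<partial>X w) = inn k + out k w" for k
    proof -
      have "(\<integral>x. \<phi> k x \<partial>X w) = (\<integral>x. \<phi> k x * indicator B x + \<phi> k x * indicator (UNIV - B) x \<partial>X w)"
        by (intro Bochner_Integration.integral_cong) (auto split: split_indicator)
      then show ?thesis
        by (simp add: int_in int_out inn_def out_eq)
    qed
    have int_B: "integrable (X w) (indicat_real B)"
      using B_sets B_fin by (intro integrable_real_indicator) auto
    have in_close: "\<bar>inn k - measure (X w) B\<bar> \<le> (1 / 2) ^ k * measure (X w) B" for k
    proof -
      have "inn k - measure (X w) B = (\<integral>x. \<phi> k x * indicator B x - indicator B x \<partial>X w)"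
        using B_sets int_in int_B by (simp add: inn_def)
      also have "\<bar>\<dots>\<bar> \<le> (\<integral>x. \<bar>\<phi> k x * indicator B x - indicator B x\<bar> \<partial>X w)"
        by (rule integral_abs_bound)
      also have "\<dots> \<le> (\<integral>x. (1 / 2) ^ k * indicator B x \<partial>X w)"
        using int_in int_B \<phi>(3)[OF b] by (intro integral_mono) (auto split: split_indicator)
      also have "\<dots> = (1 / 2) ^ k * measure (X w) B"
        using B_sets by simp
      finally show ?thesis .
    qed
    have "(\<lambda>k. inn k - measure (X w) B) \<longlonglongrightarrow> 0"
    proof (rule Lim_null_comparison)
      show "\<forall>\<^sub>F k in sequentially. norm (inn k - measure (X w) B) \<le> (1 / 2) ^ k * measure (X w) B"
        unfolding real_norm_def by (rule always_eventually) (rule allI, rule in_close)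
      show "(\<lambda>k. (1 / 2) ^ k * measure (X w) B) \<longlonglongrightarrow> 0"
        by (rule tendsto_mult_left_zero, rule LIMSEQ_realpow_zero) simp_all
    qed
    moreover have "(\<lambda>k. (\<integral>x. \<phi> k x \<partial>X w) - c k) \<longlonglongrightarrow> 0"
      using elim(1) by (rule tendsto_0_min_1)
    ultimately have "(\<lambda>k. (inn k - measure (X w) B) - ((\<integral>x. \<phi> k x \<partial>X w) - c k)) \<longlonglongrightarrow> 0 - 0"
      by (rule tendsto_diff)
    moreover have "(inn k - measure (X w) B) - ((\<integral>x. \<phi> k x \<partial>X w) - c k) = (c k - out k w) - measure (X w) B" for k
      unfolding split by simp
    ultimately have "(\<lambda>k. (c k - out k w) - measure (X w) B) \<longlonglongrightarrow> 0"
      by (simp only: diff_zero)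
    then have "(\<lambda>k. c k - out k w) \<longlonglongrightarrow> measure (X w) B"
      by (simp only: LIM_zero_iff)
    then have "lim (\<lambda>k. c k - out k w) = measure (X w) B"
      by (rule limI)
    then show ?case
      using B_fin by (simp add: emeasure_eq_ennreal_measure)
  qed
  moreover have "(\<lambda>w. ennreal (lim (\<lambda>k. c k - out k w))) \<in> borel_measurable ?N"
    by (intro measurable_compose[OF _ measurable_ennreal] borel_measurable_lim_metric) measurable
  ultimately show ?thesis
    by (intro bexI[where x = "\<lambda>w. ennreal (lim (\<lambda>k. c k - out k w))"])
qed

section \<open>Rigidity of the sine-beta process\<close>

lemma bump_test_function: "bump I A \<in> test_functions"
proof -
  have "bump I A x = 0" if "x \<notin> {- (A + 1)..A + 1}" for x
    using that by (intro bump_eq_0) auto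
  then show ?thesis
    unfolding test_functions_def using continuous_on_bump by (intro CollectI conjI exI[of _ "{- (A + 1)..A + 1}"]) auto
qed

text \<open>The functional is bounded and vaguely continuous, so convergence in law carries the
  bound to the limit. It is used along the dimensions \<open>2 ^ L * Suc s\<close>, which all scales
  divide.\<close>

lemma sine_beta_test_function_bound:
  assumes \<beta>: "0 < \<beta>" and X: "sine_beta_process \<beta> M X"
    and I: "I \<subseteq> {1..L}" "I \<noteq> {}" and A: "0 \<le> A" and e: "0 < e" "64 / (\<beta> * real (card I)) \<le> e\<^sup>2"
  shows "(\<integral>w. min 1 \<bar>(\<integral>x. bump I A x \<partial>X w) - (\<Sum>i\<in>I. 2 ^ i) / real (card I)\<bar> \<partial>M)
    \<le> 2 * e + (\<integral>x. \<bar>mean_sinc I x - bump I A x\<bar> \<partial>lborel)"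
proof -
  let ?c = "(\<Sum>i\<in>I. 2 ^ i) / real (card I)"
  define F :: "real measure \<Rightarrow> real" where "F = (\<lambda>\<mu>. min 1 \<bar>(\<integral>x. bump I A x \<partial>\<mu>) - ?c\<bar>)"
  let ?n = "\<lambda>s. 2 ^ L * Suc s"
  let ?E = "\<lambda>n. \<integral>v. F (counting_measure (scaled_eigenangles n v)) \<partial>circular_beta_ensemble \<beta> n"
  have cont: "continuous_map vague_topology euclideanreal F"
    unfolding F_def
    by (intro continuous_map_real_min continuous_map_real_abs continuous_map_diff
        continuous_map_vague_integral bump_test_function) (simp_all add: continuous_map_const)
  have bdd: "bounded (F ` radon_measures)"
    unfolding bounded_iff by (intro exI[of _ 1]) (auto simp: F_def)
  have lim: "?E \<longlonglongrightarrow> (\<integral>w. F (X w) \<partial>M)"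
    using X cont bdd unfolding sine_beta_process_def converges_in_law_vaguely_def by blast
  have "strict_mono ?n"
    by (auto intro!: strict_monoI)
  from LIMSEQ_subseq_LIMSEQ[OF lim this]
  have lim': "(\<lambda>s. ?E (?n s)) \<longlonglongrightarrow> (\<integral>w. F (X w) \<partial>M)"
    by (simp only: o_def)
  have rhs: "(\<lambda>s. 2 * e + l1_error I A (?n s)) \<longlonglongrightarrow> 2 * e + (\<integral>x. \<bar>mean_sinc I x - bump I A x\<bar> \<partial>lborel)"
    by (intro tendsto_add tendsto_const tendsto_l1_error[OF I])
  obtain S where S: "2 * (A + 1) \<le> real S"
    using real_arch_simple by blast
  have "?E (?n s) \<le> 2 * e + l1_error I A (?n s)" if "S \<le> s" for s
    unfolding F_def
  proof (rule cbe_test_function_bound[OF \<beta> I refl A _ e])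
    have "real (Suc s) \<le> real (?n s)"
      by (rule of_nat_mono[OF Suc_le_power_mult])
    then show "A + 1 \<le> real (?n s) / 2"
      using S that by (simp del: of_nat_mult)
  qed
  then have "(\<integral>w. F (X w) \<partial>M) \<le> 2 * e + (\<integral>x. \<bar>mean_sinc I x - bump I A x\<bar> \<partial>lborel)"
    by (intro LIMSEQ_le[OF lim' rhs]) blast
  then show ?thesis
    by (simp only: F_def)
qed

lemma sine_beta_approximation:
  assumes \<beta>: "0 < \<beta>" and X: "sine_beta_process \<beta> M X" and \<eta>: "0 < \<eta>"
  shows "\<exists>\<phi> c. \<phi> \<in> test_functions \<and> (\<forall>x. 0 \<le> \<phi> x) \<and> (\<forall>x. \<bar>x\<bar> \<le> b \<longrightarrow> \<bar>\<phi> x - 1\<bar> \<le> \<eta>) \<and>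
    (\<integral>w. min 1 \<bar>(\<integral>x. \<phi> x \<partial>X w) - c\<bar> \<partial>M) \<le> \<eta>"
proof -
  \<comment> \<open>Two thirds of \<eta> pay for the 2 e of the concentration bound, one third for
    the cutoff.\<close>
  define e where "e = \<eta> / 3"
  have e: "0 < e" using \<eta> by (simp add: e_def)
  \<comment> \<open>The number of scales, large enough for 64 / (\<beta> N) \<le> e^2.\<close>
  obtain N :: nat where N: "64 / (\<beta> * e\<^sup>2) < real N"
    using reals_Archimedean2 by blast
  have N0: "0 < real N"
    using N \<beta> e by (smt (verit) divide_nonneg_pos zero_less_mult_iff zero_less_power)
  have "isCont sinc_square 0"
    using continuous_on_sinc_square by (simp add: continuous_on_eq_continuous_at)
  then have "\<forall>\<^sub>F y in nhds 0. dist (sinc_square y) (sinc_square 0) < \<eta>"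
    using \<eta> unfolding continuous_at tendsto_at_iff_tendsto_nhds by (rule tendstoD)
  then obtain d where d: "0 < d" "\<And>y. \<bar>y\<bar> < d \<Longrightarrow> \<bar>sinc_square y - 1\<bar> < \<eta>"
    unfolding eventually_nhds_metric by (auto simp: dist_real_def sinc_square_def)
  \<comment> \<open>Beyond the scale \<open>2 ^ i0\<close> every squared sinc has its argument
    within d of 0 on the interval, so it is \<eta>-close to 1 there. The N scales start at
    \<open>Suc i0\<close>, hence at 1 or later.\<close>
  obtain i0 where i0: "pi * \<bar>b\<bar> / d < 2 ^ i0"
    using real_arch_pow[of 2] by auto
  define I where "I = {Suc i0..i0 + N}"
  have I: "I \<subseteq> {1..i0 + N}" "I \<noteq> {}" and cardI: "card I = N"
    using N0 by (auto simp: I_def)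
  have close: "\<bar>mean_sinc I x - 1\<bar> \<le> \<eta>" if "\<bar>x\<bar> \<le> b" for x
  proof -
    have each: "\<bar>sinc_square (pi * x / 2 ^ i) - 1\<bar> \<le> \<eta>" if "i \<in> I" for i
    proof -
      have "pi * \<bar>x\<bar> / d \<le> pi * \<bar>b\<bar> / d"
        using \<open>\<bar>x\<bar> \<le> b\<close> d by (intro divide_right_mono mult_left_mono) auto
      also note i0
      also have "(2::real) ^ i0 \<le> 2 ^ i"
        using that by (intro power_increasing) (auto simp: I_def)
      finally have "\<bar>pi * x / 2 ^ i\<bar> < d"
        using d by (simp add: abs_mult field_simps)
      then show ?thesis
        using d(2) less_imp_le by blast
    qed
    have "mean_sinc I x - 1 = (\<Sum>i\<in>I. sinc_square (pi * x / 2 ^ i) - 1) / real N"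
      using N0 by (simp add: mean_sinc_def cardI sum_subtractf diff_divide_distrib)
    also have "\<bar>\<dots>\<bar> \<le> (\<Sum>i\<in>I. \<eta>) / real N"
      unfolding abs_divide using each
      by (simp only: abs_of_nat) (intro divide_right_mono order_trans[OF sum_abs] sum_mono, auto)
    also have "\<dots> = \<eta>"
      using N0 by (simp add: cardI)
    finally show ?thesis .
  qed
  \<comment> \<open>The cutoff radius is chosen after the scales, since the tail to be removed
    depends on I.\<close>
  have "\<forall>\<^sub>F A in sequentially. (\<integral>x. \<bar>mean_sinc I x - bump I (real A) x\<bar> \<partial>lborel) < e"
    using order_tendstoD(2)[OF tendsto_cutoff_error[OF I] e] .
  then obtain A0 where A0: "\<And>A. A0 \<le> A \<Longrightarrow> (\<integral>x. \<bar>mean_sinc I x - bump I (real A) x\<bar> \<partial>lborel) < e"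
    unfolding eventually_sequentially by blast
  obtain A1 :: nat where A1: "b \<le> real A1"
    using real_arch_simple by blast
  define A where "A = real (max A0 A1)"
  have A: "0 \<le> A" "b \<le> A" "(\<integral>x. \<bar>mean_sinc I x - bump I A x\<bar> \<partial>lborel) < e"
    using A0[of "max A0 A1"] A1 by (auto simp: A_def)
  have "64 / (\<beta> * real (card I)) \<le> e\<^sup>2"
    using N \<beta> e N0 by (simp add: cardI field_simps)
  from sine_beta_test_function_bound[OF \<beta> X I A(1) e this]
  have "(\<integral>w. min 1 \<bar>(\<integral>x. bump I A x \<partial>X w) - (\<Sum>i\<in>I. 2 ^ i) / real (card I)\<bar> \<partial>M) \<le> \<eta>"
    using A(3) by (simp add: e_def)
  moreover have "\<bar>bump I A x - 1\<bar> \<le> \<eta>" if "\<bar>x\<bar> \<le> b" for x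
    using close[OF that] A(2) that by (simp add: bump_def cutoff_def)
  ultimately show ?thesis
    using bump_test_function bump_nonneg by blast
qed

theorem theorem1p2:
  fixes \<beta> :: real and M :: "'w measure" and X :: "'w \<Rightarrow> real measure"
  assumes "\<beta> > 0"
    and "sine_beta_process \<beta> M X"
  shows "\<forall>B\<in>sets (borel :: real measure). bounded B \<longrightarrow>
    (\<exists>Y\<in>borel_measurable (point_sigma M X (UNIV - B)). AE w in M. emeasure (X w) B = Y w)"
proof (intro ballI impI)
  fix B :: "real set" assume "B \<in> sets borel" "bounded B"
  moreover have "point_process M X"
    using assms(2) by (simp add: sine_beta_process_def)
  ultimately show "\<exists>Y\<in>borel_measurable (point_sigma M X (UNIV - B)). AE w in M. emeasure (X w) B = Y w"
    using sine_beta_approximation[OF assms] by (intro rigidity_criterion)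
qed

end
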